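(* The set of rational numbers $s_0$ for which there exists a nonzero ideal $\mathcal{I}\subset \mathbb{C}[x,y]$ with $0\in\mathrm{Supp}(\mathcal{I})$ such that the local topological zeta function $Z_{top,\mathcal{I}}(s)$ has a pole in $s_0$ is equal to $$\mathbb{Q}\cap\left([-1,0)\cup\left\{-1-\tfrac{1}{i}\;\middle|\; i\in\mathbb{Z}_{>0}\right\}\right).$$
   Context: $\mathrm{Supp}(\mathcal{I})$ denotes the zero set of $\mathcal{I}$ in $\mathbb{C}^2$. Principalization. A principalization of an ideal $\mathcal{I}\subset\mathbb{C}[x,y]$ (in a neighbourhood of $0$) is a finite composition $\sigma : X \to \mathbb{C}^2$ of point blow-ups (over a neighbourhood of $0$) such that the total transform $\sigma^*\mathcal{I} = \mathcal{I}\mathcal{O}_X$ is the (locally principal) ideal of a simple normal crossings divisor. Numerical data. Let $E_i$, $i\in T$, be the irreducible components of the support of $\sigma^*\mathcal{I}$. The numerical data $(N_i,\nu_i)$ of $E_i$ are defined as follows: $N_i$ is the multiplicity of $E_i$ in the divisor of $\sigma^*\mathcal{I}$, and $\nu_i - 1$ is the multiplicity of $E_i$ in the divisor of $\sigma^*(dx\wedge dy)$. Local topological zeta function. For an ideal $\mathcal{I}$ with $0\in \mathrm{Supp}(\mathcal{I})$, $$Z_{top,\mathcal{I}}(s) := \sum_{I\subset T} \chi\big(E_I^\circ \cap \sigma^{-1}(0)\big) \prod_{i\in I} \frac{1}{\nu_i + sN_i},$$ where $\chi$ is the topological Euler characteristic and $E_I^\circ := (\cap_{i\in I}E_i)\setminus(\cup_{j\notin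 I}E_j)$. This does not depend on the chosen principalization. *)

theory Defs
  imports
    "HOL-Homology.Homology"
    "HOL-Complex_Analysis.Complex_Analysis"
    "HOL-Computational_Algebra.Computational_Algebra"
    "HOL-Computational_Algebra.Field_as_Ring"
begin

section \<open>Polynomials in two variables\<close>

text \<open>The ring \<open>\<complex>[x,y]\<close> is the type \<open>complex poly poly\<close>; the inner variable is \<open>x\<close>, the outer
  one is \<open>y\<close>.\<close>

definition const2 :: "complex \<Rightarrow> complex poly poly" where
  "const2 c = [:[:c:]:]"

definition varx :: "complex poly poly" where
  "varx = [:[:0, 1:]:]"

definition vary :: "complex poly poly" where
  "vary = [:0, 1:]"

definition eval2 :: "complex poly poly \<Rightarrow> complex \<times> complex \<Rightarrow> complex" where
  "eval2 f w = poly (poly f [:snd w:]) (fst w)"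

text \<open>\<open>subst2 f P Q\<close> is \<open>f(P,Q)\<close>.\<close>

definition subst2 ::
    "complex poly poly \<Rightarrow> complex poly poly \<Rightarrow> complex poly poly \<Rightarrow> complex poly poly" where
  "subst2 f P Q = poly (map_poly (\<lambda>c. poly (map_poly const2 c) P) f) Q"

text \<open>\<open>jacobian2 P Q = P\<^sub>x Q\<^sub>y - P\<^sub>y Q\<^sub>x\<close>; note that \<open>pderiv\<close> on the outer level differentiates with
  respect to \<open>y\<close>.\<close>

definition jacobian2 :: "complex poly poly \<Rightarrow> complex poly poly \<Rightarrow> complex poly poly" where
  "jacobian2 P Q = map_poly pderiv P * pderiv Q - pderiv P * map_poly pderiv Q"

text \<open>Ideals are the submodules of the ring regarded as a module over itself.\<close>

lemma module_times: "Modules.module ((*) :: 'a::comm_ring_1 \<Rightarrow> 'a \<Rightarrow> 'a)"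
  by (rule Modules.module.intro) (simp_all add: algebra_simps)

definition is_ideal :: "'a::comm_ring_1 set \<Rightarrow> bool" where
  "is_ideal I \<longleftrightarrow> Modules.module.subspace (*) I"

definition ideal_gen :: "'a::comm_ring_1 set \<Rightarrow> 'a set" where
  "ideal_gen S = Modules.module.span (*) S"

definition Supp :: "complex poly poly set \<Rightarrow> (complex \<times> complex) set" where
  "Supp I = {w. \<forall>f\<in>I. eval2 f w = 0}"

text \<open>Let \<open>O\<close> be the local ring of the affine plane at the origin, i.e. the localization of
  \<open>\<complex>[x,y]\<close> at the polynomials that do not vanish at the origin. \<open>local_ideal S\<close> is the set of
  polynomials lying in the ideal \<open>S O\<close>. An ideal of \<open>O\<close> is determined by the polynomials it
  contains, so \<open>local_ideal S = local_ideal S'\<close> says that \<open>S O = S' O\<close>.\<close>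

definition local_ideal :: "complex poly poly set \<Rightarrow> complex poly poly set" where
  "local_ideal S = {g. \<exists>h. eval2 h (0, 0) \<noteq> 0 \<and> h * g \<in> ideal_gen S}"

text \<open>\<open>z\<^sub>1, z\<^sub>2\<close> generate the maximal ideal of \<open>O\<close>. Up to units, any regular system of parameters
  consists of polynomials.\<close>

definition local_parameters :: "complex poly poly \<Rightarrow> complex poly poly \<Rightarrow> bool" where
  "local_parameters z1 z2 \<longleftrightarrow> local_ideal {z1, z2} = local_ideal {varx, vary}"


section \<open>Compositions of point blow-ups of the plane\<close>

text \<open>The points of all surfaces obtained from the plane by point blow-ups: a proper point of
  the plane, or a point on the exceptional curve of the blow-up of a point \<open>p\<close>, that is, a
  tangent direction at \<open>p\<close>. Directions are expressed in the coordinates \<open>(u, v)\<close> of the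
  chart centred at \<open>p\<close> (see below): \<open>Slope p t\<close> is the direction of the line \<open>v = t u\<close>, and
  \<open>Vertical p\<close> is the direction of the line \<open>u = 0\<close>.\<close>

datatype pt = Proper complex complex | Slope pt complex | Vertical pt

definition blow_up :: "pt \<Rightarrow> pt set \<Rightarrow> pt set" where
  "blow_up p X = (X - {p}) \<union> range (Slope p) \<union> {Vertical p}"

inductive iterated_blow_up :: "(complex \<times> complex) set \<Rightarrow> pt set \<Rightarrow> bool"
  for U :: "(complex \<times> complex) set" where
  plane: "iterated_blow_up U ((\<lambda>(a, b). Proper a b) ` U)"
| blow_up: "iterated_blow_up U X \<Longrightarrow> p \<in> X \<Longrightarrow> iterated_blow_up U (blow_up p X)"

text \<open>The composition \<open>\<sigma>\<close> of the blow-ups, as a map of points.\<close>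

primrec blow_down :: "pt \<Rightarrow> complex \<times> complex" where
  "blow_down (Proper a b) = (a, b)"
| "blow_down (Slope p t) = blow_down p"
| "blow_down (Vertical p) = blow_down p"

text \<open>Charts. The chart centred at \<open>Proper a b\<close> is the translation of the plane. If \<open>(u', v')\<close>
  are the coordinates of the chart centred at \<open>p\<close>, then the blow-up of \<open>p\<close> is covered near its
  exceptional curve by the charts with \<open>(u', v') = (u, u (t + v))\<close>, centred at \<open>Slope p t\<close>, and
  by the chart with \<open>(u', v') = (u v, v)\<close>, centred at \<open>Vertical p\<close>. \<open>chart q w\<close> is the point
  with coordinates \<open>w\<close> in the chart centred at \<open>q\<close>. If \<open>X\<close> is an iterated blow-up of an open set
  and \<open>q \<in> X\<close>, then the domain of the chart is the set of all \<open>w\<close> with \<open>chart q w \<in> X\<close>; this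
  excludes the points blown up elsewhere and those outside the open set.\<close>

fun chart :: "pt \<Rightarrow> complex \<times> complex \<Rightarrow> pt" where
  "chart (Proper a b) (u, v) = Proper (a + u) (b + v)"
| "chart (Slope p t) (u, v) = (if u = 0 then Slope p (t + v) else chart p (u, u * (t + v)))"
| "chart (Vertical p) (u, v) =
     (if v = 0 then (if u = 0 then Vertical p else Slope p (1 / u)) else chart p (u * v, v))"

text \<open>\<open>pullback q f\<close> is the polynomial \<open>\<sigma>\<^sup>*f\<close> in the coordinates of the chart centred at \<open>q\<close>.\<close>

primrec pullback :: "pt \<Rightarrow> complex poly poly \<Rightarrow> complex poly poly" where
  "pullback (Proper a b) f = subst2 f (const2 a + varx) (const2 b + vary)"
| "pullback (Slope p t) f = subst2 (pullback p f) varx (varx * (const2 t + vary))"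
| "pullback (Vertical p) f = subst2 (pullback p f) (varx * vary) vary"

lemma eval2_add [simp]: "eval2 (f + g) w = eval2 f w + eval2 g w"
  and eval2_mult [simp]: "eval2 (f * g) w = eval2 f w * eval2 g w"
  and eval2_const2 [simp]: "eval2 (const2 c) w = c"
  and eval2_varx [simp]: "eval2 varx w = fst w"
  and eval2_vary [simp]: "eval2 vary w = snd w"
  and eval2_0 [simp]: "eval2 0 w = 0"
  by (simp_all add: eval2_def const2_def varx_def vary_def)

lemma eval2_pCons: "eval2 (pCons c f) w = poly c (fst w) + snd w * eval2 f w"
  by (simp add: eval2_def)

lemma eval2_subst2: "eval2 (subst2 f P Q) w = eval2 f (eval2 P w, eval2 Q w)"
proof -
  have zero: "const2 0 = 0"
    by (simp add: const2_def)
  have inner: "eval2 (poly (map_poly const2 c) P) w = poly c (eval2 P w)" for c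
    by (induction c) (simp_all add: map_poly_pCons zero)
  show ?thesis
    unfolding subst2_def
    by (induction f) (simp_all add: map_poly_pCons inner eval2_pCons)
qed

lemma chart_0 [simp]: "chart p (0, 0) = p"
  by (induction p) auto

lemma eval2_pullback: "eval2 (pullback q f) w = eval2 f (blow_down (chart q w))"
proof (induction q arbitrary: w)
  case (Proper a b)
  then show ?case
    by (cases w) (simp add: eval2_subst2)
next
  case (Slope p t)
  then show ?case
    by (cases w) (simp add: eval2_subst2)
next
  case (Vertical p)
  then show ?case
    by (cases w) (simp add: eval2_subst2)
qed

text \<open>The Euclidean topology of a surface: the charts are homeomorphisms onto open subsets.\<close>

definition euclidean_top :: "pt set \<Rightarrow> pt topology" where
  "euclidean_top X =
     topology (\<lambda>S. S \<subseteq> X \<and> (\<forall>q\<in>S. eventually (\<lambda>w. chart q w \<in> S) (nhds (0, 0))))"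

lemma openin_euclidean_top:
  "openin (euclidean_top X) S \<longleftrightarrow>
     S \<subseteq> X \<and> (\<forall>q\<in>S. eventually (\<lambda>w. chart q w \<in> S) (nhds (0, 0)))"
proof -
  have "istopology (\<lambda>S. S \<subseteq> X \<and> (\<forall>q\<in>S. eventually (\<lambda>w. chart q w \<in> S) (nhds (0, 0))))"
    unfolding istopology_def
  proof (intro conjI allI impI)
    fix \<K> assume *: "\<forall>S\<in>\<K>. S \<subseteq> X \<and> (\<forall>q\<in>S. eventually (\<lambda>w. chart q w \<in> S) (nhds (0, 0)))"
    show "\<forall>q\<in>\<Union>\<K>. eventually (\<lambda>w. chart q w \<in> \<Union>\<K>) (nhds (0, 0))"
    proof
      fix q assume "q \<in> \<Union>\<K>"
      then obtain S where S: "S \<in> \<K>" "q \<in> S" by blast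
      with * have "eventually (\<lambda>w. chart q w \<in> S) (nhds (0, 0))" by blast
      then show "eventually (\<lambda>w. chart q w \<in> \<Union>\<K>) (nhds (0, 0))"
        by (rule eventually_mono) (use S in blast)
    qed
  qed (auto intro: eventually_conj)
  then show ?thesis
    by (simp add: euclidean_top_def)
qed

text \<open>The Zariski topology of a surface: a set is open if in every chart it is the complement
  of the common zero set of a set of polynomials.\<close>

definition zariski_top :: "pt set \<Rightarrow> pt topology" where
  "zariski_top X =
     topology (\<lambda>S. S \<subseteq> X \<and>
       (\<forall>q\<in>X. \<exists>P. \<forall>w. chart q w \<in> X \<longrightarrow> (chart q w \<in> S \<longleftrightarrow> (\<exists>f\<in>P. eval2 f w \<noteq> 0))))"

lemma openin_zariski_top:
  "openin (zariski_top X) S \<longleftrightarrow> S \<subseteq> X \<and>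
     (\<forall>q\<in>X. \<exists>P. \<forall>w. chart q w \<in> X \<longrightarrow> (chart q w \<in> S \<longleftrightarrow> (\<exists>f\<in>P. eval2 f w \<noteq> 0)))"
proof -
  let ?Z = "\<lambda>S q P. \<forall>w. chart q w \<in> X \<longrightarrow> (chart q w \<in> S \<longleftrightarrow> (\<exists>f\<in>P. eval2 f w \<noteq> 0))"
  have "istopology (\<lambda>S. S \<subseteq> X \<and> (\<forall>q\<in>X. \<exists>P. ?Z S q P))"
    unfolding istopology_def
  proof (intro conjI allI impI)
    fix S T assume S: "S \<subseteq> X \<and> (\<forall>q\<in>X. \<exists>P. ?Z S q P)" and T: "T \<subseteq> X \<and> (\<forall>q\<in>X. \<exists>P. ?Z T q P)"
    then show "S \<inter> T \<subseteq> X" by blast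
    show "\<forall>q\<in>X. \<exists>P. ?Z (S \<inter> T) q P"
    proof
      fix q assume "q \<in> X"
      from S have "\<exists>P. ?Z S q P" by (rule conjunct2 [THEN bspec]) fact
      then obtain P where P: "?Z S q P" by (rule exE)
      from T have "\<exists>P. ?Z T q P" by (rule conjunct2 [THEN bspec]) fact
      then obtain Q where Q: "?Z T q Q" by (rule exE)
      have "(\<exists>h\<in>{f * g |f g. f \<in> P \<and> g \<in> Q}. eval2 h w \<noteq> 0) \<longleftrightarrow>
          (\<exists>f\<in>P. eval2 f w \<noteq> 0) \<and> (\<exists>g\<in>Q. eval2 g w \<noteq> 0)" (is "?l \<longleftrightarrow> ?r") for w
      proof
        assume ?l
        then obtain f g where "f \<in> P" "g \<in> Q" "eval2 (f * g) w \<noteq> 0" by blast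
        then show ?r by auto
      next
        assume ?r
        then obtain f g where "f \<in> P" "g \<in> Q" "eval2 (f * g) w \<noteq> 0" by auto
        then show ?l by blast
      qed
      with P Q have "?Z (S \<inter> T) q {f * g |f g. f \<in> P \<and> g \<in> Q}" by simp
      then show "\<exists>P. ?Z (S \<inter> T) q P" by (rule exI)
    qed
  next
    fix \<K> assume *: "\<forall>S\<in>\<K>. S \<subseteq> X \<and> (\<forall>q\<in>X. \<exists>P. ?Z S q P)"
    then show "\<Union>\<K> \<subseteq> X" by blast
    show "\<forall>q\<in>X. \<exists>P. ?Z (\<Union>\<K>) q P"
    proof
      fix q assume "q \<in> X"
      with * have "\<forall>S\<in>\<K>. \<exists>P. ?Z S q P" by (intro ballI) (drule (1) bspec, drule conjunct2, erule (1) bspec)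
      then obtain P where P: "\<forall>S\<in>\<K>. ?Z S q (P S)" by (rule bchoice [THEN exE])
      have "?Z (\<Union>\<K>) q (\<Union>S\<in>\<K>. P S)"
      proof (intro allI impI)
        fix w assume "chart q w \<in> X"
        with P have "\<forall>S\<in>\<K>. chart q w \<in> S \<longleftrightarrow> (\<exists>f\<in>P S. eval2 f w \<noteq> 0)"
          by (simp del: split_paired_All)
        then show "chart q w \<in> \<Union>\<K> \<longleftrightarrow> (\<exists>f\<in>\<Union>S\<in>\<K>. P S. eval2 f w \<noteq> 0)" by simp
      qed
      then show "\<exists>P. ?Z (\<Union>\<K>) q P" by (rule exI)
    qed
  qed
  then show ?thesis
    by (simp add: zariski_top_def del: split_paired_All)
qed

definition zariski_open_plane :: "(complex \<times> complex) set \<Rightarrow> bool" where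
  "zariski_open_plane U \<longleftrightarrow> (\<exists>P. U = {w. \<exists>f\<in>P. eval2 f w \<noteq> 0})"

definition irreducible_closed :: "'a topology \<Rightarrow> 'a set \<Rightarrow> bool" where
  "irreducible_closed T C \<longleftrightarrow> closedin T C \<and> C \<noteq> {} \<and>
     (\<forall>A B. closedin T A \<and> closedin T B \<and> C = A \<union> B \<longrightarrow> C = A \<or> C = B)"

definition irreducible_components :: "'a topology \<Rightarrow> 'a set \<Rightarrow> 'a set set" where
  "irreducible_components T S =
     {C. irreducible_closed T C \<and> C \<subseteq> S \<and>
         (\<forall>D. irreducible_closed T D \<and> C \<subseteq> D \<and> D \<subseteq> S \<longrightarrow> D = C)}"


section \<open>Principalizations and numerical data\<close>

text \<open>Near \<open>q\<close> the ideal \<open>\<sigma>\<^sup>*I\<close> is generated by a monomial in a regular system of parameters of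
  the Zariski local ring at \<open>q\<close>. Working with the Zariski (rather than the analytic) local ring
  amounts to simple normal crossings: a component cannot cross itself.\<close>

definition snc_at :: "complex poly poly set \<Rightarrow> pt \<Rightarrow> bool" where
  "snc_at I q \<longleftrightarrow> (\<exists>z1 z2 a b. local_parameters z1 z2 \<and>
     local_ideal (pullback q ` I) = local_ideal {z1 ^ a * z2 ^ b})"

definition principalization :: "complex poly poly set \<Rightarrow> pt set \<Rightarrow> bool" where
  "principalization I X \<longleftrightarrow>
     (\<exists>U. zariski_open_plane U \<and> (0, 0) \<in> U \<and> iterated_blow_up U X) \<and> (\<forall>q\<in>X. snc_at I q)"

definition total_components :: "pt set \<Rightarrow> complex poly poly set \<Rightarrow> pt set set" where
  "total_components X I = irreducible_components (zariski_top X) {q \<in> X. blow_down q \<in> Supp I}"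

text \<open>\<open>e\<close> is an equation of the irreducible curve \<open>E\<close> in the chart centred at \<open>q \<in> E\<close>. Being
  irreducible, \<open>e\<close> generates the ideal of \<open>E\<close>.\<close>

definition curve_equation :: "pt set \<Rightarrow> pt set \<Rightarrow> pt \<Rightarrow> complex poly poly \<Rightarrow> bool" where
  "curve_equation X E q e \<longleftrightarrow> Factorial_Ring.irreducible e \<and>
     (\<forall>w. chart q w \<in> X \<longrightarrow> (chart q w \<in> E \<longleftrightarrow> eval2 e w = 0))"

text \<open>The multiplicity of \<open>E\<close> in the effective divisor whose local equations at \<open>q\<close> are the
  polynomials \<open>g\<close> with \<open>D q g\<close>. As \<open>e\<close> is prime and vanishes at the origin, its multiplicities in
  \<open>g\<close> as a polynomial and as an element of the local ring agree.\<close>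

definition divisor_mult :: "pt set \<Rightarrow> (pt \<Rightarrow> complex poly poly \<Rightarrow> bool) \<Rightarrow> pt set \<Rightarrow> nat" where
  "divisor_mult X D E =
     (THE n. \<forall>q\<in>E. \<forall>e g. curve_equation X E q e \<and> D q g \<longrightarrow> multiplicity e g = n)"

definition ideal_divisor :: "complex poly poly set \<Rightarrow> pt \<Rightarrow> complex poly poly \<Rightarrow> bool" where
  "ideal_divisor I q g \<longleftrightarrow> local_ideal {g} = local_ideal (pullback q ` I)"

text \<open>In the chart centred at \<open>q\<close>, \<open>\<sigma>\<^sup>*(dx \<and> dy)\<close> is the Jacobian determinant of \<open>\<sigma>\<close> times
  \<open>du \<and> dv\<close>.\<close>

definition form_divisor :: "pt \<Rightarrow> complex poly poly \<Rightarrow> bool" where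
  "form_divisor q g \<longleftrightarrow> g = jacobian2 (pullback q varx) (pullback q vary)"

definition num_N :: "pt set \<Rightarrow> complex poly poly set \<Rightarrow> pt set \<Rightarrow> nat" where
  "num_N X I E = divisor_mult X (ideal_divisor I) E"

definition num_nu :: "pt set \<Rightarrow> pt set \<Rightarrow> nat" where
  "num_nu X E = divisor_mult X form_divisor E + 1"


section \<open>The topological Euler characteristic\<close>

text \<open>Rank of an abelian group (only used when it is finite): the largest cardinality of a
  \<open>\<int>\<close>-linearly independent set.\<close>

definition abelian_rank :: "('a, 'b) monoid_scheme \<Rightarrow> nat" where
  "abelian_rank G = Sup {card S |S. finite S \<and> S \<subseteq> carrier G \<and>
     (\<forall>c :: 'a \<Rightarrow> int. finprod G (\<lambda>x. x [^]\<^bsub>G\<^esub> c x) S = \<one>\<^bsub>G\<^esub> \<longrightarrow> (\<forall>x\<in>S. c x = 0))}"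

definition betti :: "nat \<Rightarrow> 'a topology \<Rightarrow> nat" where
  "betti p T = abelian_rank (homology_group (int p) T)"

definition euler_char :: "'a topology \<Rightarrow> int" where
  "euler_char T = (\<Sum>p | betti p T \<noteq> 0. (-1) ^ p * int (betti p T))"


section \<open>The local topological zeta function\<close>

definition stratum :: "pt set \<Rightarrow> pt set set \<Rightarrow> pt set set \<Rightarrow> pt set" where
  "stratum X T J = (X \<inter> \<Inter>J) - \<Union>(T - J)"

definition zeta_of :: "pt set \<Rightarrow> complex poly poly set \<Rightarrow> complex \<Rightarrow> complex" where
  "zeta_of X I s =
     (\<Sum>J\<in>Pow (total_components X I).
        of_int (euler_char (subtopology (euclidean_top X)
          (stratum X (total_components X I) J \<inter> {q. blow_down q = (0, 0)})))
        * (\<Prod>E\<in>J. 1 / (of_nat (num_nu X E) + s * of_nat (num_N X I E))))"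

text \<open>\<open>Z\<close> is the local topological zeta function of \<open>I\<close>. It is computed from a principalization,
  on the choice of which it does not depend.\<close>

definition local_top_zeta ::
    "complex poly poly set \<Rightarrow> (complex \<Rightarrow> complex) \<Rightarrow> bool" where
  "local_top_zeta I Z \<longleftrightarrow> (\<exists>X. principalization I X \<and> Z = zeta_of X I)"

end

theory Submission
  imports Defs
begin

text \<open>
  For an exceptional curve with numerical data \<open>(N, \<nu>)\<close> put \<open>\<delta> = \<nu> - N\<close>. If the weak transform of the
  ideal has multiplicity \<open>m\<close> at a blown up point, then the new curve has \<open>\<delta> = \<delta>\<^sub>1 + \<delta>\<^sub>2 - m\<close>, where
  \<open>\<delta>\<^sub>1\<close>, \<open>\<delta>\<^sub>2\<close> belong to the exceptional curves through the point (and are 1 if there is no such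
  curve). As long as \<open>m \<ge> 1\<close>, induction gives \<open>\<delta> \<le> 1\<close>, so that \<open>-\<nu>/N\<close> is in the given set. Over a point
  where the ideal is monomial, \<open>m = 0\<close>, and there the contributions of all strata sum up to
  \<open>1 / ((\<nu>\<^sub>1 + s N\<^sub>1) (\<nu>\<^sub>2 + s N\<^sub>2))\<close>, without new poles. The components that are not exceptional have
  \<open>\<nu> = 1\<close>.

  Conversely, a chain of \<open>n\<close> blow-ups with data \<open>(r + j, j + 1)\<close>, \<open>j = 1, \<dots>, n\<close>, that is
  \<open>a\<^sub>j = j + 1 + (r + j) s\<close>, gives \<open>(a\<^sub>n + a\<^sub>1 + n - 1) / (a\<^sub>1 a\<^sub>n)\<close>, which has the pole
  \<open>- (n + 1) / (r + n)\<close>.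
\<close>

section \<open>Ranks of abelian groups\<close>

text \<open>A centre at which the ideal is already monomial can produce a curve with \<nu> > N + 1,
  hence a candidate pole outside the set. Bounds on numerical data alone therefore do not suffice:
  the cancellation itself must be exhibited. For this the sum over strata is rewritten as a
  recursion along infinitely near points (\<open>tree_sum\<close>), in which a monomial subtree
  collapses to one term.

  Over a blown up origin the strata are finite sets and projective lines without finitely many
  points. Their Euler characteristics are derived from singular homology, so finiteness of the ranks
  has to be carried through every long exact sequence.

  In the converse, the multiplicity is r + 1 at the first centre and 1 at all later ones. Thus
  \<delta> = 1 - r stays constant along the chain, and the last pair (\<nu>, N) = (n + 1, r + n)
  runs through all pairs with 2 \<le> \<nu> \<le> N + 1.\<close>

definition lincomb :: "('a, 'b) monoid_scheme \<Rightarrow> ('a \<Rightarrow> int) \<Rightarrow> 'a set \<Rightarrow> 'a" where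
  "lincomb G c S = finprod G (\<lambda>x. x [^]\<^bsub>G\<^esub> c x) S"

definition indep_set :: "('a, 'b) monoid_scheme \<Rightarrow> 'a set \<Rightarrow> bool" where
  "indep_set G S \<longleftrightarrow> finite S \<and> S \<subseteq> carrier G \<and>
     (\<forall>c. lincomb G c S = \<one>\<^bsub>G\<^esub> \<longrightarrow> (\<forall>x\<in>S. c x = 0))"

text \<open>Stated for a subset \<open>A\<close>, so that kernels and images have a rank without
  being made into groups. Torsion is invisible, since only a nonzero multiple of each element has to
  be a combination.\<close>

definition has_rank :: "('a, 'b) monoid_scheme \<Rightarrow> 'a set \<Rightarrow> nat \<Rightarrow> bool" where
  "has_rank G A n \<longleftrightarrow> (\<exists>S. indep_set G S \<and> S \<subseteq> A \<and> card S = n \<and>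
     (\<forall>g\<in>A. \<exists>m c. m \<noteq> (0::int) \<and> g [^]\<^bsub>G\<^esub> m = lincomb G c S))"

lemma indep_setD: "indep_set G S \<Longrightarrow> lincomb G c S = \<one>\<^bsub>G\<^esub> \<Longrightarrow> x \<in> S \<Longrightarrow> c x = 0"
  unfolding indep_set_def by blast

text \<open>Gaussian elimination over the integers, by induction on the equations.
  Cross-multiplication with a pivot replaces division.\<close>

lemma integer_relation_exists:
  fixes a :: "'j \<Rightarrow> 's \<Rightarrow> int"
  assumes "finite S" "finite J" "card S < card J"
  shows "\<exists>c. (\<exists>j\<in>J. c j \<noteq> 0) \<and> (\<forall>s\<in>S. (\<Sum>j\<in>J. c j * a j s) = 0)"
  using assms
proof (induction S arbitrary: J a rule: finite_induct)
  case empty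
  then obtain j where "j \<in> J" by fastforce
  then show ?case by (intro exI[of _ "\<lambda>_. 1"]) auto
next
  case (insert s S)
  show ?case
  proof (cases "\<forall>j\<in>J. a j s = 0")
    case True
    from insert have "card S < card J" by simp
    from insert.IH[OF insert.prems(1) this, of a] obtain c where
      c: "\<exists>j\<in>J. c j \<noteq> 0" "\<forall>s\<in>S. (\<Sum>j\<in>J. c j * a j s) = 0" by blast
    with True show ?thesis by (intro exI[of _ c]) auto
  next
    case False
    then obtain j0 where j0: "j0 \<in> J" "a j0 s \<noteq> 0" by blast
    let ?J = "J - {j0}"
    \<comment> \<open>The combination of row \<open>j\<close> with the pivot row \<open>j0\<close>
      whose entry at \<open>s\<close> is 0. Expanding a relation among these rows collects all pivot
      terms in the coefficient of \<open>j0\<close>, which is the exceptional value of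
      \<open>d\<close> below.\<close>
    define b where "b = (\<lambda>j t. a j0 s * a j t - a j s * a j0 t)"
    have "card S < card ?J" using insert j0 by simp
    from insert.IH[OF _ this, of b] insert.prems obtain c where
      c: "\<exists>j\<in>?J. c j \<noteq> 0" "\<forall>t\<in>S. (\<Sum>j\<in>?J. c j * b j t) = 0" by blast
    define d where "d = (\<lambda>j. if j = j0 then - (\<Sum>j\<in>?J. c j * a j s) else a j0 s * c j)"
    have sum_d: "(\<Sum>j\<in>J. d j * a j t) = (\<Sum>j\<in>?J. c j * b j t)" for t
    proof -
      have "(\<Sum>j\<in>J. d j * a j t) = d j0 * a j0 t + (\<Sum>j\<in>?J. d j * a j t)"
        using insert.prems j0 by (simp add: sum.remove)
      also have "(\<Sum>j\<in>?J. d j * a j t) = (\<Sum>j\<in>?J. a j0 s * c j * a j t)"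
        by (rule sum.cong) (auto simp: d_def)
      also have "d j0 * a j0 t + \<dots> = (\<Sum>j\<in>?J. c j * b j t)"
        by (simp add: d_def b_def algebra_simps sum_subtractf sum_distrib_left sum_distrib_right)
      finally show ?thesis .
    qed
    have "b j s = 0" for j by (simp add: b_def)
    then have "\<forall>t\<in>insert s S. (\<Sum>j\<in>J. d j * a j t) = 0" using c(2) by (auto simp: sum_d)
    moreover have "\<exists>j\<in>J. d j \<noteq> 0" using c(1) j0 by (auto simp: d_def)
    ultimately show ?thesis by blast
  qed
qed

section \<open>Independent sets and ranks in an abelian group\<close>

context comm_group
begin

lemma lincomb_closed [simp]: "S \<subseteq> carrier G \<Longrightarrow> lincomb G c S \<in> carrier G"
  unfolding lincomb_def by (rule finprod_closed) auto

lemma lincomb_empty [simp]: "lincomb G c {} = \<one>"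
  by (simp add: lincomb_def)

lemma lincomb_insert [simp]:
  "finite S \<Longrightarrow> x \<notin> S \<Longrightarrow> insert x S \<subseteq> carrier G \<Longrightarrow>
    lincomb G c (insert x S) = x [^] c x \<otimes> lincomb G c S"
  unfolding lincomb_def by (rule finprod_insert) auto

lemma lincomb_cong: "S \<subseteq> carrier G \<Longrightarrow> (\<And>x. x \<in> S \<Longrightarrow> c x = d x) \<Longrightarrow> lincomb G c S = lincomb G d S"
  unfolding lincomb_def by (rule finprod_cong) (auto simp: simp_implies_def)

lemma lincomb_zero: "S \<subseteq> carrier G \<Longrightarrow> (\<And>x. x \<in> S \<Longrightarrow> c x = 0) \<Longrightarrow> lincomb G c S = \<one>"
  unfolding lincomb_def by (rule finprod_one_eqI) auto

lemma lincomb_add: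
  "S \<subseteq> carrier G \<Longrightarrow> lincomb G (\<lambda>x. c x + d x) S = lincomb G c S \<otimes> lincomb G d S"
proof -
  assume S: "S \<subseteq> carrier G"
  have "lincomb G (\<lambda>x. c x + d x) S = finprod G (\<lambda>x. x [^] c x \<otimes> x [^] d x) S"
    unfolding lincomb_def by (rule finprod_cong) (use S in \<open>auto simp: simp_implies_def int_pow_mult\<close>)
  also have "\<dots> = lincomb G c S \<otimes> lincomb G d S"
    unfolding lincomb_def by (rule finprod_multf) (use S in auto)
  finally show ?thesis .
qed

lemma lincomb_pow:
  assumes "finite S" "S \<subseteq> carrier G"
  shows "lincomb G c S [^] (m::int) = lincomb G (\<lambda>x. c x * m) S"
  using assms
  by (induction S rule: finite_induct) (auto simp: int_pow_distrib int_pow_pow)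

lemma lincomb_Un_disjoint:
  assumes "finite S" "finite T" "S \<inter> T = {}" "S \<subseteq> carrier G" "T \<subseteq> carrier G"
  shows "lincomb G c (S \<union> T) = lincomb G c S \<otimes> lincomb G c T"
  unfolding lincomb_def by (rule finprod_Un_disjoint) (use assms in auto)

lemma lincomb_lincomb:
  assumes "finite J" "finite S" "S \<subseteq> carrier G"
  shows "finprod G (\<lambda>j. lincomb G (a j) S [^] (d j :: int)) J = lincomb G (\<lambda>s. \<Sum>j\<in>J. d j * a j s) S"
  using assms(1)
proof (induction J rule: finite_induct)
  case empty
  then show ?case using assms by (simp add: lincomb_zero)
next
  case (insert j J)
  have "finprod G (\<lambda>j. lincomb G (a j) S [^] d j) (insert j J) =
      lincomb G (a j) S [^] d j \<otimes> finprod G (\<lambda>j. lincomb G (a j) S [^] d j) J"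
    using insert assms by (intro finprod_insert) auto
  also have "\<dots> = lincomb G (\<lambda>s. a j s * d j) S \<otimes> lincomb G (\<lambda>s. \<Sum>j\<in>J. d j * a j s) S"
    using insert assms by (simp add: lincomb_pow)
  also have "\<dots> = lincomb G (\<lambda>s. a j s * d j + (\<Sum>j\<in>J. d j * a j s)) S"
    using assms by (simp add: lincomb_add)
  finally show ?case using insert by (simp add: mult.commute)
qed

text \<open>Steinitz exchange up to torsion: if multiples \<open>m g\<close> of the elements of
  \<open>S\<close> are combinations of fewer elements, their coefficient vectors satisfy an integer
  relation \<open>d\<close>, and \<open>m g * d g\<close> is a relation in \<open>S\<close>.\<close>

lemma indep_set_card_le:
  assumes "indep_set G S" "finite T" "T \<subseteq> carrier G"
    and span: "\<And>g. g \<in> S \<Longrightarrow> \<exists>m c. m \<noteq> (0::int) \<and> g [^] m = lincomb G c T"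
  shows "card S \<le> card T"
proof (rule ccontr)
  assume "\<not> card S \<le> card T"
  then have less: "card T < card S" by simp
  have S: "finite S" "S \<subseteq> carrier G" using assms by (auto simp: indep_set_def)
  from span obtain m a where ma: "\<And>g. g \<in> S \<Longrightarrow> m g \<noteq> (0::int)"
    "\<And>g. g \<in> S \<Longrightarrow> g [^] m g = lincomb G (a g) T" by metis
  obtain d where d: "\<exists>g\<in>S. d g \<noteq> 0" "\<forall>t\<in>T. (\<Sum>g\<in>S. d g * a g t) = 0"
    using integer_relation_exists[OF assms(2) S(1) less] by blast
  have "lincomb G (\<lambda>g. m g * d g) S = finprod G (\<lambda>g. lincomb G (a g) T [^] d g) S"
    unfolding lincomb_def[of _ _ S] using S assms(3)
    by (intro finprod_cong) (auto simp: simp_implies_def ma(2)[symmetric] int_pow_pow)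
  also have "\<dots> = \<one>"
    using assms S d by (simp add: lincomb_lincomb lincomb_zero)
  finally have "\<forall>g\<in>S. m g * d g = 0" using indep_setD[OF assms(1), of "\<lambda>g. m g * d g"] by blast
  with ma(1) d(1) show False by auto
qed

lemma has_rank_indep_set_le:
  assumes "has_rank G A n" "indep_set G S" "S \<subseteq> A"
  shows "card S \<le> n"
proof -
  from assms(1) obtain T where T: "indep_set G T" "card T = n"
    "\<forall>g\<in>A. \<exists>m c. m \<noteq> (0::int) \<and> g [^] m = lincomb G c T" by (auto simp: has_rank_def)
  have "card S \<le> card T"
  proof (rule indep_set_card_le[OF assms(2)])
    show "finite T" "T \<subseteq> carrier G" using T by (auto simp: indep_set_def)
  qed (use T assms in blast)
  with T show ?thesis by simp
qed

lemma has_rank_imp_abelian_rank: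
  assumes "has_rank G (carrier G) n"
  shows "abelian_rank G = n"
proof -
  let ?X = "{card S |S. finite S \<and> S \<subseteq> carrier G \<and>
     (\<forall>c :: 'a \<Rightarrow> int. finprod G (\<lambda>x. x [^] c x) S = \<one> \<longrightarrow> (\<forall>x\<in>S. c x = 0))}"
  have X: "?X = {card S |S. indep_set G S}"
    by (simp add: indep_set_def lincomb_def)
  have "n \<in> ?X" using assms unfolding X has_rank_def by blast
  moreover have "\<And>k. k \<in> ?X \<Longrightarrow> k \<le> n"
    unfolding X using has_rank_indep_set_le[OF assms] by (auto simp: indep_set_def)
  ultimately show ?thesis unfolding abelian_rank_def by (intro cSup_eq_maximum)
qed

text \<open>A maximal independent subset works: any further element creates a relation, whose
  coefficient at that element is nonzero because the subset itself is independent.\<close>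

lemma has_rank_exists:
  assumes "A \<subseteq> carrier G" and bound: "\<And>S. indep_set G S \<Longrightarrow> S \<subseteq> A \<Longrightarrow> card S \<le> n"
  shows "\<exists>k. has_rank G A k"
proof -
  have e: "indep_set G {} \<and> {} \<subseteq> A" by (simp add: indep_set_def)
  obtain S where S: "indep_set G S" "S \<subseteq> A"
    and max: "\<And>T. indep_set G T \<Longrightarrow> T \<subseteq> A \<Longrightarrow> card T \<le> card S"
    using ex_has_greatest_nat[of "\<lambda>S. indep_set G S \<and> S \<subseteq> A" "{}" card "Suc n"] e bound
    by (metis less_Suc_eq_le)
  have fin: "finite S" and Sc: "S \<subseteq> carrier G" using S by (auto simp: indep_set_def)
  have "\<exists>m c. m \<noteq> (0::int) \<and> g [^] m = lincomb G c S" if g: "g \<in> A" for g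
  proof (cases "g \<in> S")
    case True
    then have "S = insert g (S - {g})" by blast
    then have "lincomb G (\<lambda>x. if x = g then 1 else 0) S =
        lincomb G (\<lambda>x. if x = g then 1 else 0) (insert g (S - {g}))" by simp
    also have "\<dots> = g [^] (1::int) \<otimes> lincomb G (\<lambda>x. if x = g then 1 else 0) (S - {g})"
      using fin Sc True by (subst lincomb_insert) auto
    also have "\<dots> = g [^] (1::int)"
      using g assms Sc by (subst lincomb_zero) auto
    finally have "(1::int) \<noteq> 0 \<and> g [^] (1::int) = lincomb G (\<lambda>x. if x = g then 1 else 0) S" by simp
    then show ?thesis by blast
  next
    case False
    then have "\<not> indep_set G (insert g S)"
      using max[of "insert g S"] S(2) g fin by auto
    then obtain c where c: "lincomb G c (insert g S) = \<one>" "\<exists>x\<in>insert g S. c x \<noteq> 0"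
      using fin Sc g assms(1) by (auto simp: indep_set_def)
    have gc: "g \<in> carrier G" using g assms by blast
    have eq: "g [^] c g \<otimes> lincomb G c S = \<one>" using c fin Sc False gc by simp
    have "c g \<noteq> 0"
    proof
      assume "c g = 0"
      with eq gc Sc have "lincomb G c S = \<one>" by simp
      with S have "\<forall>x\<in>S. c x = 0" by (auto simp: indep_set_def)
      with c \<open>c g = 0\<close> show False by auto
    qed
    moreover have "g [^] c g = lincomb G (\<lambda>x. - c x) S"
    proof -
      have "lincomb G c S \<otimes> lincomb G (\<lambda>x. - c x) S = \<one>"
        using Sc by (subst lincomb_add[symmetric]) (auto simp: lincomb_zero)
      with eq Sc gc show ?thesis
        by (metis inv_unique int_pow_closed lincomb_closed m_comm)
    qed
    ultimately show ?thesis by blast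
  qed
  with S show ?thesis by (auto simp: has_rank_def)
qed

end

section \<open>Ranks of kernels and images\<close>

locale comm_group_hom = G: comm_group G + H: comm_group H for G (structure) and H (structure) +
  fixes f assumes f: "f \<in> hom G H"
begin

sublocale group_hom G H f
  by unfold_locales (rule f)

lemma hom_lincomb:
  assumes "finite S" "S \<subseteq> carrier G"
  shows "f (lincomb G c S) = finprod H (\<lambda>x. f x [^]\<^bsub>H\<^esub> c x) S"
  using assms
proof (induction S rule: finite_induct)
  case (insert x S)
  have "finprod H (\<lambda>x. f x [^]\<^bsub>H\<^esub> c x) (insert x S) =
    f x [^]\<^bsub>H\<^esub> c x \<otimes>\<^bsub>H\<^esub> finprod H (\<lambda>x. f x [^]\<^bsub>H\<^esub> c x) S"
    using insert by (intro H.finprod_insert) auto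
  with insert show ?case by (simp add: hom_int_pow)
qed simp

lemma hom_lincomb_lift:
  assumes "finite S" "S \<subseteq> carrier H" "L ` S \<subseteq> carrier G" "\<And>y. y \<in> S \<Longrightarrow> f (L y) = y"
  shows "f (lincomb G c (L ` S)) = lincomb H (\<lambda>y. c (L y)) S"
proof -
  have inj: "inj_on L S" using assms(4) by (metis inj_onI)
  have "f (lincomb G c (L ` S)) = finprod H (\<lambda>x. f x [^]\<^bsub>H\<^esub> c x) (L ` S)"
    using assms by (intro hom_lincomb) auto
  also have "\<dots> = finprod H (\<lambda>y. f (L y) [^]\<^bsub>H\<^esub> c (L y)) S"
    using inj assms by (intro H.finprod_reindex) auto
  also have "\<dots> = lincomb H (\<lambda>y. c (L y)) S"
    unfolding lincomb_def using assms by (intro H.finprod_cong) (auto simp: simp_implies_def)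
  finally show ?thesis .
qed

lemma indep_set_lift:
  assumes "indep_set H S" "L ` S \<subseteq> carrier G" "\<And>y. y \<in> S \<Longrightarrow> f (L y) = y"
  shows "indep_set G (L ` S)"
  unfolding indep_set_def
proof (intro conjI allI impI)
  have S: "finite S" "S \<subseteq> carrier H" using assms by (auto simp: indep_set_def)
  then show "finite (L ` S)" by simp
  show "L ` S \<subseteq> carrier G" by fact
  fix c assume "lincomb G c (L ` S) = \<one>"
  then have "lincomb H (\<lambda>y. c (L y)) S = \<one>\<^bsub>H\<^esub>"
    using hom_lincomb_lift[OF S assms(2,3), of c] by simp
  then have "\<forall>y\<in>S. c (L y) = 0" using indep_setD[OF assms(1), of "\<lambda>y. c (L y)"] by blast
  then show "\<forall>x\<in>L ` S. c x = 0" by simp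
qed

text \<open>A basis of the kernel together with lifts of a basis of the image is independent and
  spans up to multiples.\<close>

lemma rank_nullity:
  assumes K: "has_rank G (kernel G H f) k" and I: "has_rank H (f ` carrier G) m"
  shows "has_rank G (carrier G) (k + m)"
proof -
  from K obtain A where A: "indep_set G A" "A \<subseteq> kernel G H f" "card A = k"
    "\<forall>g\<in>kernel G H f. \<exists>m c. m \<noteq> (0::int) \<and> g [^] m = lincomb G c A" by (auto simp: has_rank_def)
  from I obtain B where B: "indep_set H B" "B \<subseteq> f ` carrier G" "card B = m"
    "\<forall>g\<in>f ` carrier G. \<exists>m c. m \<noteq> (0::int) \<and> g [^]\<^bsub>H\<^esub> m = lincomb H c B" by (auto simp: has_rank_def)
  have "\<forall>y\<in>B. \<exists>x. x \<in> carrier G \<and> f x = y" using B(2) by blast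
  then obtain L where L: "\<And>y. y \<in> B \<Longrightarrow> L y \<in> carrier G" "\<And>y. y \<in> B \<Longrightarrow> f (L y) = y"
    by metis
  have fin: "finite A" "finite B" and sub: "A \<subseteq> carrier G" "B \<subseteq> carrier H" "L ` B \<subseteq> carrier G"
    using A B L by (auto simp: indep_set_def)
  have inj: "inj_on L B" using L by (metis inj_onI)
  have one: "\<one>\<^bsub>H\<^esub> \<notin> B"
  proof
    assume *: "\<one>\<^bsub>H\<^esub> \<in> B"
    have "lincomb H (\<lambda>x. if x = \<one>\<^bsub>H\<^esub> then 1 else 0) B = \<one>\<^bsub>H\<^esub>"
      unfolding lincomb_def by (rule H.finprod_one_eqI) auto
    from indep_setD[OF B(1) this *] show False by simp
  qed
  have disj: "A \<inter> L ` B = {}"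
    using A(2) L one by (fastforce simp: kernel_def)
  have indep: "indep_set G (A \<union> L ` B)"
    unfolding indep_set_def
  proof (intro conjI allI impI)
    fix c assume c: "lincomb G c (A \<union> L ` B) = \<one>"
    then have eq: "lincomb G c A \<otimes> lincomb G c (L ` B) = \<one>"
      using G.lincomb_Un_disjoint[of A "L ` B" c] fin sub disj by simp
    have "f (lincomb G c A) = \<one>\<^bsub>H\<^esub>"
      using A(2) fin sub by (subst hom_lincomb) (auto intro!: H.finprod_one_eqI simp: kernel_def)
    moreover have "f (lincomb G c (L ` B)) = lincomb H (\<lambda>y. c (L y)) B"
      by (rule hom_lincomb_lift) (use fin sub L in auto)
    moreover have "f (lincomb G c A \<otimes> lincomb G c (L ` B)) = \<one>\<^bsub>H\<^esub>" using eq by simp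
    ultimately have "lincomb H (\<lambda>y. c (L y)) B = \<one>\<^bsub>H\<^esub>"
      using sub by simp
    then have "\<forall>y\<in>B. c (L y) = 0" using indep_setD[OF B(1), of "\<lambda>y. c (L y)"] by blast
    then have zB: "\<forall>x\<in>L ` B. c x = 0" by simp
    then have "lincomb G c (L ` B) = \<one>" using sub by (intro G.lincomb_zero) auto
    with eq sub have "lincomb G c A = \<one>" by simp
    then have "\<forall>x\<in>A. c x = 0" using indep_setD[OF A(1)] by blast
    with zB show "\<forall>x\<in>A \<union> L ` B. c x = 0" by blast
  qed (use fin sub in auto)
  have span: "\<exists>m c. m \<noteq> (0::int) \<and> g [^] m = lincomb G c (A \<union> L ` B)" if g: "g \<in> carrier G" for g
  proof -
    from B(4) g obtain m c where mc: "m \<noteq> (0::int)" "f g [^]\<^bsub>H\<^esub> m = lincomb H c B" by blast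
    define c' where "c' = (\<lambda>x. c (f x))"
    have fl: "f (lincomb G c' (L ` B)) = lincomb H c B"
    proof -
      have "f (lincomb G c' (L ` B)) = lincomb H (\<lambda>y. c' (L y)) B"
        by (rule hom_lincomb_lift) (use fin sub L in auto)
      also have "\<dots> = lincomb H c B" using sub L by (intro H.lincomb_cong) (auto simp: c'_def)
      finally show ?thesis .
    qed
    let ?h = "lincomb G c' (L ` B)"
    have h: "?h \<in> carrier G" using sub by simp
    have "f (g [^] m \<otimes> inv ?h) = \<one>\<^bsub>H\<^esub>"
      using g h mc fl sub by (simp add: hom_int_pow)
    then have "g [^] m \<otimes> inv ?h \<in> kernel G H f" using g h by (simp add: kernel_def)
    with A(4) obtain n d where nd: "n \<noteq> (0::int)" "(g [^] m \<otimes> inv ?h) [^] n = lincomb G d A" by blast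
    \<comment> \<open>A first multiple \<open>m\<close> of \<open>g\<close> differs from the lift by
      an element of the kernel, and only a second multiple \<open>n\<close> of this difference is a
      combination of \<open>A\<close>. Hence \<open>c'\<close> has to be scaled by
      \<open>n\<close>.\<close>
    define e where "e = (\<lambda>x. if x \<in> A then d x else c' x * n)"
    have "g [^] (m * n) = (g [^] m \<otimes> inv ?h) [^] n \<otimes> ?h [^] n"
      using g h by (simp add: G.int_pow_pow[symmetric] G.int_pow_distrib[symmetric] G.m_assoc)
    also have "\<dots> = lincomb G d A \<otimes> lincomb G (\<lambda>x. c' x * n) (L ` B)"
      using nd fin sub by (simp add: G.lincomb_pow)
    also have "lincomb G d A = lincomb G e A"
      using sub by (intro G.lincomb_cong) (auto simp: e_def)
    also have "lincomb G (\<lambda>x. c' x * n) (L ` B) = lincomb G e (L ` B)"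
      using sub disj by (intro G.lincomb_cong) (auto simp: e_def)
    also have "lincomb G e A \<otimes> lincomb G e (L ` B) = lincomb G e (A \<union> L ` B)"
      using fin sub disj by (simp add: G.lincomb_Un_disjoint)
    finally show ?thesis using mc nd by (metis mult_eq_0_iff)
  qed
  have "card (A \<union> L ` B) = k + m"
    using fin disj A B inj by (simp add: card_Un_disjoint card_image)
  with indep span sub show ?thesis unfolding has_rank_def by (intro exI[of _ "A \<union> L ` B"]) auto
qed

text \<open>Finiteness of both ranks comes first: independent sets in the kernel are independent in
  \<open>G\<close>, and those in the image lift to \<open>G\<close>. Additivity then identifies the
  sum with \<open>n\<close>.\<close>

lemma rank_kernel_image:
  assumes "has_rank G (carrier G) n"
  shows "\<exists>k m. has_rank G (kernel G H f) k \<and> has_rank H (f ` carrier G) m \<and> n = k + m"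
proof -
  have "\<exists>k. has_rank G (kernel G H f) k"
    by (rule G.has_rank_exists[of _ n])
      (auto simp: kernel_def intro!: G.has_rank_indep_set_le[OF assms])
  moreover have "\<exists>m. has_rank H (f ` carrier G) m"
  proof (rule H.has_rank_exists[of _ n])
    fix S assume S: "indep_set H S" "S \<subseteq> f ` carrier G"
    then have "\<forall>y\<in>S. \<exists>x. x \<in> carrier G \<and> f x = y" by blast
    then obtain L where L: "\<And>y. y \<in> S \<Longrightarrow> L y \<in> carrier G" "\<And>y. y \<in> S \<Longrightarrow> f (L y) = y"
      by metis
    have "indep_set G (L ` S)" by (rule indep_set_lift) (use S L in auto)
    then have "card (L ` S) \<le> n"
      using G.has_rank_indep_set_le[OF assms] by (auto simp: indep_set_def)
    moreover have "inj_on L S" using L by (metis inj_onI)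
    ultimately show "card S \<le> n" by (simp add: card_image)
  qed auto
  ultimately obtain k m where km: "has_rank G (kernel G H f) k" "has_rank H (f ` carrier G) m" by blast
  from rank_nullity[OF this] have "abelian_rank G = k + m" by (rule G.has_rank_imp_abelian_rank)
  moreover have "abelian_rank G = n" using assms by (rule G.has_rank_imp_abelian_rank)
  ultimately show ?thesis using km by auto
qed

lemma finite_rank_middle:
  assumes "has_rank G (kernel G H f) k" "has_rank H (carrier H) m"
  shows "\<exists>n. has_rank G (carrier G) n"
proof -
  have "\<exists>m. has_rank H (f ` carrier G) m"
    by (rule H.has_rank_exists[of _ m]) (auto intro!: H.has_rank_indep_set_le[OF assms(2)])
  with rank_nullity[OF assms(1)] show ?thesis by blast
qed

end

lemma (in comm_group) has_rank_trivial:
  assumes "A = {\<one>}" shows "has_rank G A 0"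
  unfolding has_rank_def indep_set_def
proof (intro exI[of _ "{}"] conjI ballI)
  fix g assume "g \<in> A"
  with assms have "(1::int) \<noteq> 0 \<and> g [^] (1::int) = lincomb G (\<lambda>_. 0) {}" by simp
  then show "\<exists>m c. m \<noteq> (0::int) \<and> g [^] m = lincomb G c {}" by blast
qed auto

lemma has_rank_iso:
  assumes "comm_group G" "comm_group H" "G \<cong> H" "has_rank H (carrier H) n"
  shows "has_rank G (carrier G) n"
proof -
  from assms(3) obtain f where f: "f \<in> iso G H" by (auto simp: is_iso_def)
  then have bij: "bij_betw f (carrier G) (carrier H)" unfolding Group.iso_def by blast
  interpret comm_group_hom G H f
    using assms f by (simp add: comm_group_hom_def comm_group_hom_axioms_def Group.iso_def)
  from bij have im: "f ` carrier G = carrier H" by (rule bij_betw_imp_surj_on)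
  have "x = \<one>\<^bsub>G\<^esub>" if "x \<in> kernel G H f" for x
    using that inj_onD[OF bij_betw_imp_inj_on[OF bij], of x "\<one>\<^bsub>G\<^esub>"] by (simp add: kernel_def)
  then have "kernel G H f = {\<one>\<^bsub>G\<^esub>}" by (auto simp: kernel_def)
  then have "has_rank G (kernel G H f) 0" by (rule G.has_rank_trivial)
  from rank_nullity[OF this] assms(4) show ?thesis by (simp add: im)
qed

lemma has_rank_integer_group: "has_rank integer_group (carrier integer_group) 1"
proof -
  interpret comm_group integer_group by (rule abelian_integer_group)
  have pow: "x [^]\<^bsub>integer_group\<^esub> (n::int) = n * x" for x n by simp
  have lc: "lincomb integer_group c {1} = c 1" for c
    using lincomb_insert[of "{}" 1 c] by (simp add: pow)
  show ?thesis
    unfolding has_rank_def indep_set_def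
  proof (intro exI[of _ "{1}"] conjI ballI)
    fix g :: int
    have "(1::int) \<noteq> 0 \<and> g [^]\<^bsub>integer_group\<^esub> (1::int) = lincomb integer_group (\<lambda>_. g) {1}"
      by (simp add: pow lc)
    then show "\<exists>m c. m \<noteq> (0::int) \<and> g [^]\<^bsub>integer_group\<^esub> m = lincomb integer_group c {1}" by blast
  qed (auto simp: lc)
qed

lemma (in comm_group) has_rank_unique:
  assumes "has_rank G A m" "has_rank G A n" shows "m = n"
proof -
  have "m \<le> n" if a: "has_rank G A m" "has_rank G A n" for m n
  proof -
    from a(1) obtain S where "indep_set G S" "S \<subseteq> A" "card S = m" by (auto simp: has_rank_def)
    with has_rank_indep_set_le[OF a(2)] show ?thesis by auto
  qed
  with assms show ?thesis by (simp add: antisym)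
qed

section \<open>Euler characteristics and long exact sequences\<close>

text \<open>\<open>A\<close>, \<open>X\<close>, \<open>R\<close> stand for the homology of a
  subspace, of the space and of the pair. \<open>triv\<close> ends the sequence, since the boundary
  map in degree 0 lands in degree -1.\<close>

locale long_exact =
  fixes A X R :: "int \<Rightarrow> ('g, 'm) monoid_scheme" and f g d :: "int \<Rightarrow> 'g \<Rightarrow> 'g"
  assumes commA: "\<And>p. comm_group (A p)" and commX: "\<And>p. comm_group (X p)"
    and commR: "\<And>p. comm_group (R p)"
    and homf: "\<And>p. f p \<in> hom (A p) (X p)" and homg: "\<And>p. g p \<in> hom (X p) (R p)"
    and homd: "\<And>p. d p \<in> hom (R p) (A (p - 1))"
    and exX: "\<And>p. f p ` carrier (A p) = kernel (X p) (R p) (g p)"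
    and exR: "\<And>p. g p ` carrier (X p) = kernel (R p) (A (p - 1)) (d p)"
    and exA: "\<And>p. d p ` carrier (R p) = kernel (A (p - 1)) (X (p - 1)) (f (p - 1))"
    and triv: "trivial_group (A (-1))"
begin

lemma hom_f: "comm_group_hom (A p) (X p) (f p)"
  and hom_g: "comm_group_hom (X p) (R p) (g p)"
  and hom_d: "comm_group_hom (R p) (A (p - 1)) (d p)"
  by (simp_all add: comm_group_hom_def comm_group_hom_axioms_def commA commX commR homf homg homd)

lemma finite_rank_total:
  assumes "has_rank (A p) (carrier (A p)) a" "has_rank (R p) (carrier (R p)) r"
  shows "\<exists>x. has_rank (X p) (carrier (X p)) x"
proof -
  from comm_group_hom.rank_kernel_image[OF hom_f assms(1)]
  obtain i where "has_rank (X p) (f p ` carrier (A p)) i" by blast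
  then have "has_rank (X p) (kernel (X p) (R p) (g p)) i" by (simp add: exX)
  from comm_group_hom.finite_rank_middle[OF hom_g this assms(2)] show ?thesis .
qed

lemma finite_rank_sub:
  assumes "has_rank (X p) (carrier (X p)) x" "has_rank (R (p + 1)) (carrier (R (p + 1))) r"
  shows "\<exists>a. has_rank (A p) (carrier (A p)) a"
proof -
  from comm_group_hom.rank_kernel_image[OF hom_d assms(2)]
  obtain i where "has_rank (A p) (d (p + 1) ` carrier (R (p + 1))) i" by auto
  then have "has_rank (A p) (kernel (A p) (X p) (f p)) i" using exA[of "p + 1"] by simp
  from comm_group_hom.finite_rank_middle[OF hom_f this assms(1)] show ?thesis .
qed

text \<open>\<open>i\<close>, \<open>j\<close>, \<open>t\<close> are the ranks of the images of
  \<open>f\<close>, \<open>g\<close>, \<open>d\<close>. Exactness identifies each of them with the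
  rank of the next kernel, and \<open>t 0 = 0\<close> because its target is trivial.\<close>

lemma ranks_split:
  assumes a: "\<And>p::nat. has_rank (A p) (carrier (A p)) (a p)"
    and x: "\<And>p::nat. has_rank (X p) (carrier (X p)) (x p)"
    and r: "\<And>p::nat. has_rank (R p) (carrier (R p)) (r p)"
  shows "\<exists>i j t. t 0 = 0 \<and> (\<forall>p. a p = t (Suc p) + i p \<and> x p = i p + j p \<and> r p = j p + t p)"
proof -
  have "\<forall>p::nat. \<exists>e i. has_rank (A p) (kernel (A p) (X p) (f p)) e \<and>
      has_rank (X p) (f p ` carrier (A p)) i \<and> a p = e + i"
    using comm_group_hom.rank_kernel_image[OF hom_f a] by blast
  then obtain e i :: "nat \<Rightarrow> nat" where ei: "\<And>p::nat. has_rank (A p) (kernel (A p) (X p) (f p)) (e p)"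
    "\<And>p::nat. has_rank (X p) (f p ` carrier (A p)) (i p)" "\<And>p. a p = e p + i p" by metis
  have "\<forall>p::nat. \<exists>e i. has_rank (X p) (kernel (X p) (R p) (g p)) e \<and>
      has_rank (R p) (g p ` carrier (X p)) i \<and> x p = e + i"
    using comm_group_hom.rank_kernel_image[OF hom_g x] by blast
  then obtain i' j :: "nat \<Rightarrow> nat" where ij: "\<And>p::nat. has_rank (X p) (kernel (X p) (R p) (g p)) (i' p)"
    "\<And>p::nat. has_rank (R p) (g p ` carrier (X p)) (j p)" "\<And>p. x p = i' p + j p" by metis
  have "\<forall>p::nat. \<exists>e i. has_rank (R p) (kernel (R p) (A (int p - 1)) (d p)) e \<and>
      has_rank (A (int p - 1)) (d p ` carrier (R p)) i \<and> r p = e + i"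
    using comm_group_hom.rank_kernel_image[OF hom_d r] by blast
  then obtain j' t :: "nat \<Rightarrow> nat" where jt: "\<And>p::nat. has_rank (R p) (kernel (R p) (A (int p - 1)) (d p)) (j' p)"
    "\<And>p::nat. has_rank (A (int p - 1)) (d p ` carrier (R p)) (t p)" "\<And>p. r p = j' p + t p" by metis
  have "i' p = i p" for p
    using comm_group.has_rank_unique[OF commX ij(1)[of p]] ei(2)[of p] by (simp add: exX)
  moreover have "j' p = j p" for p
    using comm_group.has_rank_unique[OF commR jt(1)[of p]] ij(2)[of p] by (simp add: exR)
  moreover have "t (Suc p) = e p" for p
  proof -
    have "d (int (Suc p)) ` carrier (R (int (Suc p))) = kernel (A p) (X p) (f p)"
      using exA[of "int (Suc p)"] by simp
    then show ?thesis
      using comm_group.has_rank_unique[OF commA ei(1)[of p]] jt(2)[of "Suc p"] by simp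
  qed
  moreover have "t 0 = 0"
  proof -
    have "d 0 ` carrier (R 0) \<subseteq> carrier (A (-1))" using homd[of 0] by (auto simp: hom_def)
    moreover have "\<one>\<^bsub>A (-1)\<^esub> \<in> d 0 ` carrier (R 0)"
      using group_hom.hom_one[OF comm_group_hom.axioms(1)[OF hom_d[of 0], THEN comm_group.axioms(2), THEN group_hom.intro]]
      comm_group_hom.f[OF hom_d[of 0]]
      by (metis (no_types, lifting) commA commR comm_group.axioms(2) diff_0 group.is_monoid hom_one image_eqI
          monoid.one_closed)
    ultimately have "d 0 ` carrier (R 0) = {\<one>\<^bsub>A (-1)\<^esub>}" using triv by (auto simp: trivial_group_def)
    then have "has_rank (A (-1)) (d 0 ` carrier (R 0)) 0"
      by (rule comm_group.has_rank_trivial[OF commA])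
    then show ?thesis using comm_group.has_rank_unique[OF commA jt(2)[of 0]] by simp
  qed
  ultimately show ?thesis using ei(3) ij(3) jt(3) by (intro exI[of _ i] exI[of _ j] exI[of _ t]) auto
qed

end

lemma alternating_sum_split:
  fixes t :: "nat \<Rightarrow> nat"
  shows "(\<Sum>p\<le>N. (-1) ^ p * (int (t p) + int (t (Suc p)))) = int (t 0) + (-1) ^ N * int (t (Suc N))"
  by (induction N) (auto simp: algebra_simps)

text \<open>Finite ranks in all degrees and their vanishing beyond some \<open>N\<close> belong to
  the notion, because the supremum in \<open>abelian_rank\<close> and the sum in
  \<open>euler_char\<close> are meaningful only then.\<close>

definition has_euler_rel :: "'a topology \<Rightarrow> 'a set \<Rightarrow> int \<Rightarrow> bool" where
  "has_euler_rel T S e \<longleftrightarrow> (\<exists>b N.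
     (\<forall>p::nat. has_rank (relative_homology_group p T S) (carrier (relative_homology_group p T S)) (b p)) \<and>
     (\<forall>p>N. b p = 0) \<and> e = (\<Sum>p\<le>N. (-1) ^ p * int (b p)))"

abbreviation "has_euler T \<equiv> has_euler_rel T {}"

lemma alternating_sum_extend:
  fixes b :: "nat \<Rightarrow> nat"
  assumes "\<forall>p>N. b p = 0" "N \<le> M"
  shows "(\<Sum>p\<le>M. (-1) ^ p * int (b p)) = (\<Sum>p\<le>N. (-1) ^ p * int (b p))"
  by (rule sum.mono_neutral_right) (use assms in auto)

lemma has_euler_imp_euler_char:
  assumes "has_euler T e" shows "euler_char T = e"
proof -
  from assms obtain b N where b: "\<And>p::nat. has_rank (homology_group p T) (carrier (homology_group p T)) (b p)"
    "\<forall>p>N. b p = 0" "e = (\<Sum>p\<le>N. (-1) ^ p * int (b p))" by (auto simp: has_euler_rel_def)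
  have betti: "betti p T = b p" for p
    unfolding betti_def by (rule comm_group.has_rank_imp_abelian_rank[OF abelian_homology_group b(1)])
  have "euler_char T = (\<Sum>p\<le>N. (-1) ^ p * int (b p))"
    unfolding euler_char_def betti using b(2)
    by (intro sum.mono_neutral_left) (auto simp: not_less[symmetric])
  with b show ?thesis by simp
qed

lemma long_exact_pair:
  "long_exact (\<lambda>p. homology_group p (subtopology T S)) (\<lambda>p. homology_group p T)
     (\<lambda>p. relative_homology_group p T S)
     (\<lambda>p. hom_induced p (subtopology T S) {} T {} id) (\<lambda>p. hom_induced p T {} T S id)
     (\<lambda>p. hom_boundary p T S)"
proof (rule long_exact.intro)
  fix p
  show "hom_induced p (subtopology T S) {} T {} id ` carrier (homology_group p (subtopology T S)) =
      kernel (homology_group p T) (relative_homology_group p T S) (hom_induced p T {} T S id)"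
    using homology_exactness_axiom_3[of p T S] by simp
  show "hom_induced p T {} T S id ` carrier (homology_group p T) =
      kernel (relative_homology_group p T S) (homology_group (p - 1) (subtopology T S)) (hom_boundary p T S)"
    using homology_exactness_axiom_1[of p T S] by simp
  show "hom_boundary p T S ` carrier (relative_homology_group p T S) =
      kernel (homology_group (p - 1) (subtopology T S)) (homology_group (p - 1) T)
       (hom_induced (p - 1) (subtopology T S) {} T {} id)"
    using homology_exactness_axiom_2[of p T S] by simp
qed (auto simp: hom_induced_hom hom_boundary_hom abelian_homology_group)

text \<open>Telescoping leaves the end terms \<open>t 0\<close> and \<open>t (Suc N)\<close>, and
  the latter is at most \<open>r (Suc N) = 0\<close>.\<close>

lemma alternating_sum_exact:
  fixes a x r :: "nat \<Rightarrow> nat"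
  assumes "t 0 = 0" "\<forall>p. a p = t (Suc p) + i p \<and> x p = i p + j p \<and> r p = j p + t p" "r (Suc N) = 0"
  shows "(\<Sum>p\<le>N. (-1) ^ p * int (x p)) =
    (\<Sum>p\<le>N. (-1) ^ p * int (a p)) + (\<Sum>p\<le>N. (-1) ^ p * int (r p))"
proof -
  have "(\<Sum>p\<le>N. (-1) ^ p * int (a p)) + (\<Sum>p\<le>N. (-1) ^ p * int (r p)) =
    (\<Sum>p\<le>N. (-1) ^ p * int (x p)) + (\<Sum>p\<le>N. (-1) ^ p * (int (t p) + int (t (Suc p))))"
    unfolding sum.distrib[symmetric] using assms(2) by (intro sum.cong) (auto simp: algebra_simps)
  moreover have "t (Suc N) = 0" using assms by (metis add_is_0)
  ultimately show ?thesis using assms(1) by (simp add: alternating_sum_split)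
qed

lemma has_euler_total:
  assumes "has_euler_rel T S r" "has_euler (subtopology T S) a"
  shows "has_euler T (a + r)"
proof -
  interpret long_exact "\<lambda>p. homology_group p (subtopology T S)" "\<lambda>p. homology_group p T"
     "\<lambda>p. relative_homology_group p T S"
     "\<lambda>p. hom_induced p (subtopology T S) {} T {} id" "\<lambda>p. hom_induced p T {} T S id"
     "\<lambda>p. hom_boundary p T S" by (rule long_exact_pair)
  from assms(1) obtain br N1 where r: "\<And>p::nat. has_rank (relative_homology_group p T S) (carrier (relative_homology_group p T S)) (br p)"
    "\<forall>p>N1. br p = 0" "r = (\<Sum>p\<le>N1. (-1) ^ p * int (br p))" by (auto simp: has_euler_rel_def)
  from assms(2) obtain ba N2 where a: "\<And>p::nat. has_rank (homology_group p (subtopology T S)) (carrier (homology_group p (subtopology T S))) (ba p)"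
    "\<forall>p>N2. ba p = 0" "a = (\<Sum>p\<le>N2. (-1) ^ p * int (ba p))" by (auto simp: has_euler_rel_def)
  have "\<forall>p::nat. \<exists>x. has_rank (homology_group p T) (carrier (homology_group p T)) x"
    using finite_rank_total[OF a(1) r(1)] by blast
  then obtain bx :: "nat \<Rightarrow> nat" where x: "\<And>p::nat. has_rank (homology_group p T) (carrier (homology_group p T)) (bx p)"
    by metis
  from ranks_split[OF a(1) x r(1)] obtain i j t where t: "t 0 = 0"
    "\<forall>p. ba p = t (Suc p) + i p \<and> bx p = i p + j p \<and> br p = j p + t p" by blast
  let ?N = "max N1 N2"
  have "(\<Sum>p\<le>?N. (-1) ^ p * int (bx p)) =
    (\<Sum>p\<le>?N. (-1) ^ p * int (ba p)) + (\<Sum>p\<le>?N. (-1) ^ p * int (br p))"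
    by (rule alternating_sum_exact[OF t]) (use r(2) in auto)
  also have "\<dots> = a + r"
    using alternating_sum_extend[OF a(2), of ?N] alternating_sum_extend[OF r(2), of ?N] a(3) r(3) by simp
  finally have "a + r = (\<Sum>p\<le>?N. (-1) ^ p * int (bx p))" by simp
  moreover have "\<forall>p>?N. bx p = 0"
  proof (intro allI impI)
    fix p assume "p > ?N"
    then have "ba p = 0" "br p = 0" using a(2) r(2) by auto
    then show "bx p = 0" using t(2)[rule_format, of p] by simp
  qed
  ultimately show ?thesis unfolding has_euler_rel_def using x by blast
qed

text \<open>Additivity read backwards. The groups of the subspace have finite rank because they sit
  between the relative group one degree higher and the group of the whole space.\<close>

lemma has_euler_sub:
  assumes "has_euler_rel T S r" "has_euler T x"
  shows "has_euler (subtopology T S) (x - r)"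
proof -
  interpret long_exact "\<lambda>p. homology_group p (subtopology T S)" "\<lambda>p. homology_group p T"
     "\<lambda>p. relative_homology_group p T S"
     "\<lambda>p. hom_induced p (subtopology T S) {} T {} id" "\<lambda>p. hom_induced p T {} T S id"
     "\<lambda>p. hom_boundary p T S" by (rule long_exact_pair)
  from assms(1) obtain br N1 where r: "\<And>p::nat. has_rank (relative_homology_group p T S) (carrier (relative_homology_group p T S)) (br p)"
    "\<forall>p>N1. br p = 0" "r = (\<Sum>p\<le>N1. (-1) ^ p * int (br p))" by (auto simp: has_euler_rel_def)
  from assms(2) obtain bx N2 where x: "\<And>p::nat. has_rank (homology_group p T) (carrier (homology_group p T)) (bx p)"
    "\<forall>p>N2. bx p = 0" "x = (\<Sum>p\<le>N2. (-1) ^ p * int (bx p))" by (auto simp: has_euler_rel_def)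
  have "\<exists>a. has_rank (homology_group p (subtopology T S)) (carrier (homology_group p (subtopology T S))) a" for p :: nat
    by (rule finite_rank_sub[OF x(1)]) (use r(1)[of "Suc p"] in \<open>simp add: add.commute\<close>)
  then obtain ba :: "nat \<Rightarrow> nat" where a: "\<And>p::nat. has_rank (homology_group p (subtopology T S)) (carrier (homology_group p (subtopology T S))) (ba p)"
    by metis
  from ranks_split[OF a x(1) r(1)] obtain i j t where t: "t 0 = 0"
    "\<forall>p. ba p = t (Suc p) + i p \<and> bx p = i p + j p \<and> br p = j p + t p" by blast
  let ?N = "max N1 N2"
  have "(\<Sum>p\<le>?N. (-1) ^ p * int (bx p)) =
    (\<Sum>p\<le>?N. (-1) ^ p * int (ba p)) + (\<Sum>p\<le>?N. (-1) ^ p * int (br p))"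
    by (rule alternating_sum_exact[OF t]) (use r(2) in auto)
  moreover have "(\<Sum>p\<le>?N. (-1) ^ p * int (bx p)) = x" "(\<Sum>p\<le>?N. (-1) ^ p * int (br p)) = r"
    using alternating_sum_extend[OF x(2), of ?N] alternating_sum_extend[OF r(2), of ?N] x(3) r(3) by simp_all
  ultimately have "x - r = (\<Sum>p\<le>?N. (-1) ^ p * int (ba p))" by simp
  moreover have "\<forall>p>?N. ba p = 0"
  proof (intro allI impI)
    fix p assume "p > ?N"
    then have "bx p = 0" "br (Suc p) = 0" using x(2) r(2) by auto
    then show "ba p = 0" using t(2)[rule_format, of p] t(2)[rule_format, of "Suc p"] by simp
  qed
  ultimately show ?thesis unfolding has_euler_rel_def using a by blast
qed

section \<open>Invariance, basic spaces and the contribution of a single point\<close>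

lemma has_euler_rel_iso:
  assumes "\<And>p. relative_homology_group p T S \<cong> relative_homology_group p T' S'" "has_euler_rel T' S' e"
  shows "has_euler_rel T S e"
  using assms(2) has_rank_iso[OF abelian_relative_homology_group abelian_relative_homology_group assms(1)]
  unfolding has_euler_rel_def by blast

lemma has_euler_homotopy:
  "T homotopy_equivalent_space T' \<Longrightarrow> has_euler T' e \<Longrightarrow> has_euler T e"
  by (rule has_euler_rel_iso[of T "{}" T' "{}"]) (auto intro: homotopy_equivalent_space_imp_isomorphic_homology_groups)

lemma has_euler_empty:
  assumes "topspace T = {}" shows "has_euler T 0"
proof -
  have "has_rank (homology_group p T) (carrier (homology_group p T)) 0" for p
    using trivial_homology_group_empty[OF assms, of p]
    by (intro comm_group.has_rank_trivial abelian_homology_group) (auto simp: trivial_group_def)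
  then show ?thesis unfolding has_euler_rel_def by (intro exI[of _ "\<lambda>_. 0"] exI[of _ 0]) auto
qed

lemma has_euler_singleton:
  assumes "topspace T = {x}" shows "has_euler T 1"
proof -
  have "has_rank (homology_group (int p) T) (carrier (homology_group (int p) T)) (if p = 0 then 1 else 0)" for p
  proof (cases "p = 0")
    case True
    show ?thesis
      using has_rank_iso[OF abelian_homology_group abelian_integer_group homology_coefficients[OF assms]
          has_rank_integer_group] True by simp
  next
    case False
    then have "trivial_group (homology_group (int p) T)"
      using homology_dimension_axiom[OF assms] by simp
    then show ?thesis using False
      by (simp, intro comm_group.has_rank_trivial abelian_homology_group) (auto simp: trivial_group_def)
  qed
  then show ?thesis unfolding has_euler_rel_def
    by (intro exI[of _ "\<lambda>p. if p = 0 then 1 else 0"] exI[of _ 0]) auto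
qed

lemma has_euler_contractible:
  assumes "contractible_space T" "topspace T \<noteq> {}" shows "has_euler T 1"
proof -
  from assms obtain a where a: "a \<in> topspace T" "T homotopy_equivalent_space subtopology T {a}"
    unfolding contractible_eq_homotopy_equivalent_singleton_subtopology by auto
  show ?thesis by (rule has_euler_homotopy[OF a(2)], rule has_euler_singleton) (use a in auto)
qed

lemma has_euler_rel_homeo:
  assumes "homeomorphic_maps T T' f g" "f \<in> S \<rightarrow> S'" "g \<in> S' \<rightarrow> S" "has_euler_rel T' S' e"
  shows "has_euler_rel T S e"
proof (rule has_euler_rel_iso[OF _ assms(4)])
  fix p
  show "relative_homology_group p T S \<cong> relative_homology_group p T' S'"
    using homeomorphic_maps_relative_homology_group_isomorphisms[OF assms(1-3)]
    by (meson group_isomorphisms_imp_iso is_isoI)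
qed

lemma has_euler_rel_excision:
  assumes "T closure_of U \<subseteq> T interior_of S" "S \<subseteq> topspace T"
    and "has_euler_rel (subtopology T (topspace T - U)) (S - U) e"
  shows "has_euler_rel T S e"
proof (rule has_euler_rel_iso[OF _ assms(3)])
  fix p
  have "relative_homology_group p (subtopology T (topspace T - U)) (S - U) \<cong> relative_homology_group p T S"
    using homology_excision_axiom[OF assms(1,2), of p] by (auto simp: is_iso_def)
  then show "relative_homology_group p T S \<cong> relative_homology_group p (subtopology T (topspace T - U)) (S - U)"
    by (rule group.iso_sym[OF group_relative_homology_group])
qed

text \<open>\<open>nsphere\<close> consists of coordinate sequences, so an orthonormal basis of the
  complex plane is needed to identify it with the unit circle.\<close>

lemma punctured_ball_homotopy_sphere:
  assumes "r > 0"
  shows "top_of_set (ball (0::complex) r - {0}) homotopy_equivalent_space nsphere 1"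
proof -
  have "rel_frontier (cball (0::complex) (r/2)) homotopy_eqv (ball (0::complex) r - {0})"
    by (rule homotopy_eqv_rel_frontier_punctured_convex)
      (use assms in \<open>auto simp: rel_interior_nonempty_interior rel_frontier_nonempty_interior affine_hull_nonempty_interior\<close>)
  moreover have "rel_frontier (cball (0::complex) (r/2)) = sphere 0 (r/2)"
    using assms by (simp add: rel_frontier_nonempty_interior)
  ultimately have "sphere (0::complex) (r/2) homotopy_eqv (ball (0::complex) r - {0})" by simp
  then have 1: "(ball (0::complex) r - {0}) homotopy_eqv sphere (0::complex) (r/2)"
    by (subst homotopy_equivalent_space_sym)
  have "sphere (0::complex) (r/2) homeomorphic sphere (0::complex) 1"
    using assms by (intro homeomorphic_spheres) auto
  then have 2: "top_of_set (sphere (0::complex) (r/2)) homotopy_equivalent_space top_of_set (sphere (0::complex) 1)"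
    by (simp add: homeomorphic_imp_homotopy_equivalent_space)
  obtain B :: "complex set" where B: "independent B" "pairwise orthogonal B" "card B = 2" "span B = UNIV"
    "\<And>u. u \<in> B \<Longrightarrow> norm u = 1"
    using orthonormal_basis_subspace[of "UNIV :: complex set"]
    by (metis DIM_complex dim_UNIV subspace_UNIV subset_UNIV)
  obtain f g where "homeomorphic_maps (nsphere (2 - 1)) (top_of_set (sphere 0 1 \<inter> span B)) f g"
    using homeomorphic_maps_nsphere_euclidean_sphere[OF B(1-3) _ B(5)] by auto
  then have "nsphere 1 homeomorphic_space top_of_set (sphere (0::complex) 1)"
    unfolding B(4) by (auto simp: homeomorphic_space_def)
  then have "top_of_set (sphere (0::complex) 1) homotopy_equivalent_space nsphere 1"
    by (metis homeomorphic_imp_homotopy_equivalent_space homotopy_equivalent_space_sym)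
  with 1 2 show ?thesis by (meson homotopy_eqv_trans)
qed

text \<open>The disc is contractible, so the pair has the reduced homology of the circle shifted by
  one degree: rank 1 in degree 2 and 0 elsewhere.\<close>

lemma has_euler_rel_ball:
  assumes "r > 0"
  shows "has_euler_rel (top_of_set (ball (0::complex) r)) (ball 0 r - {0}) 1"
proof -
  let ?T = "top_of_set (ball (0::complex) r)" and ?S = "ball (0::complex) r - {0}"
  have sub: "subtopology ?T ?S = top_of_set ?S" by (simp add: subtopology_subtopology Int_absorb1)
  have "complex_of_real (r/2) \<in> topspace ?T \<inter> ?S" using assms by simp
  then have ne: "topspace ?T \<inter> ?S \<noteq> {}" by blast
  have con: "contractible_space ?T" by (simp add: convex_imp_contractible)
  have "relative_homology_group p ?T ?S \<cong> reduced_homology_group (p - 1) (nsphere 1)" for p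
  proof -
    have "reduced_homology_group (p - 1) (subtopology ?T ?S) \<cong> relative_homology_group p ?T ?S"
      using isomorphic_group_reduced_homology_of_contractible[OF con ne, of "p - 1"] by simp
    then have "relative_homology_group p ?T ?S \<cong> reduced_homology_group (p - 1) (top_of_set ?S)"
      unfolding sub by (rule group.iso_sym[OF group_reduced_homology_group])
    moreover have "reduced_homology_group (p - 1) (top_of_set ?S) \<cong> reduced_homology_group (p - 1) (nsphere 1)"
      by (rule homotopy_equivalent_space_imp_isomorphic_reduced_homology_groups[OF punctured_ball_homotopy_sphere[OF assms]])
    ultimately show ?thesis by (rule iso_trans)
  qed
  note iso = this
  have comm: "comm_group (reduced_homology_group p (nsphere 1))" for p
    by (rule group.cyclic_imp_abelian_group[OF group_reduced_homology_group cyclic_reduced_homology_group_nsphere])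
  have rank: "has_rank (reduced_homology_group (int p - 1) (nsphere 1))
      (carrier (reduced_homology_group (int p - 1) (nsphere 1))) (if p = 2 then 1 else 0)" for p
  proof (cases "p = 2")
    case True
    have "reduced_homology_group 1 (nsphere 1) \<cong> integer_group"
      using reduced_homology_group_nsphere(1)[of 1] by simp
    with True show ?thesis
      using has_rank_iso[OF comm abelian_integer_group _ has_rank_integer_group] by simp
  next
    case False
    then have "trivial_group (reduced_homology_group (int p - 1) (nsphere 1))"
      using trivial_reduced_homology_group_nsphere[of "int p - 1" 1] by simp
    then have "has_rank (reduced_homology_group (int p - 1) (nsphere 1))
      (carrier (reduced_homology_group (int p - 1) (nsphere 1))) 0"
      by (intro comm_group.has_rank_trivial[OF comm]) (simp add: trivial_group_def)
    with False show ?thesis by simp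
  qed
  have "has_rank (relative_homology_group p ?T ?S) (carrier (relative_homology_group p ?T ?S)) (if p = 2 then 1 else 0)" for p :: nat
    by (rule has_rank_iso[OF abelian_relative_homology_group comm iso rank])
  then show ?thesis unfolding has_euler_rel_def
    by (intro exI[of _ "\<lambda>p. if p = 2 then 1 else 0"] exI[of _ 2]) (auto simp: numeral_2_eq_2)
qed

text \<open>Excising everything outside a coordinate disc around \<open>x\<close> reduces the pair
  to a disc and a punctured disc. Removing such a point therefore lowers \<chi> by 1.\<close>

lemma has_euler_rel_puncture:
  assumes T1: "closedin T {x}" and open_map: "openin T (f ` ball (0::complex) r)" "r > 0"
    and f: "homeomorphic_map (top_of_set (ball 0 r)) (subtopology T (f ` ball 0 r)) f" and x: "f 0 = x"
  shows "has_euler_rel T (topspace T - {x}) 1"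
proof -
  let ?B = "ball (0::complex) r" and ?N = "f ` ball (0::complex) r"
  have N: "?N \<subseteq> topspace T" using open_map(1) by (rule openin_subset)
  have xN: "x \<in> ?N" using x \<open>r > 0\<close> by (metis centre_in_ball imageI)
  have inj: "inj_on f ?B" using f by (simp add: homeomorphic_map_def)
  from f obtain g where g: "homeomorphic_maps (top_of_set ?B) (subtopology T ?N) f g"
    by (auto simp: homeomorphic_map_maps)
  have fg: "f \<in> (?B - {0}) \<rightarrow> (?N - {x})"
  proof
    fix z assume z: "z \<in> ?B - {0}"
    then have "f z \<noteq> f 0" using inj \<open>r > 0\<close> by (auto simp: inj_on_def)
    with z x show "f z \<in> ?N - {x}" by auto
  qed
  have gf: "g \<in> (?N - {x}) \<rightarrow> (?B - {0})"
  proof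
    fix y assume "y \<in> ?N - {x}"
    then obtain z where "z \<in> ?B" "y = f z" "y \<noteq> x" by blast
    with x have "z \<in> ?B" "y = f z" "z \<noteq> 0" by auto
    then show "g y \<in> ?B - {0}" using g by (auto simp: homeomorphic_maps_def)
  qed
  have "homeomorphic_maps (subtopology T ?N) (top_of_set ?B) g f"
    using g homeomorphic_maps_sym by blast
  from has_euler_rel_homeo[OF this gf fg has_euler_rel_ball[OF \<open>r > 0\<close>]]
  have "has_euler_rel (subtopology T ?N) (?N - {x}) 1" .
  moreover have "topspace T - (topspace T - ?N) = ?N" "(topspace T - {x}) - (topspace T - ?N) = ?N - {x}"
    using N by auto
  ultimately have "has_euler_rel (subtopology T (topspace T - (topspace T - ?N)))
      ((topspace T - {x}) - (topspace T - ?N)) 1" by simp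
  moreover have "T closure_of (topspace T - ?N) = topspace T - ?N"
    by (rule closure_of_closedin, rule closedin_diff[OF closedin_topspace open_map(1)])
  moreover have "T interior_of (topspace T - {x}) = topspace T - {x}"
    using T1 by (simp add: interior_of_openin closedin_def)
  ultimately show ?thesis
    by (intro has_euler_rel_excision[of T "topspace T - ?N"]) (use xN in auto)
qed

lemma has_euler_rel_isolated:
  assumes "closedin T {x}" "openin T {x}"
  shows "has_euler_rel T (topspace T - {x}) 1"
proof -
  have x: "x \<in> topspace T" using assms(2) openin_subset by blast
  have "has_euler (subtopology T {x}) 1" by (rule has_euler_singleton) (use x in auto)
  then have "has_euler_rel (subtopology T (topspace T - (topspace T - {x})))
      ((topspace T - {x}) - (topspace T - {x})) 1"
    using x by (simp add: Diff_Diff_Int)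
  moreover have "T closure_of (topspace T - {x}) = topspace T - {x}"
    by (rule closure_of_closedin, rule closedin_diff[OF closedin_topspace assms(2)])
  moreover have "T interior_of (topspace T - {x}) = topspace T - {x}"
    using assms(1) by (simp add: interior_of_openin closedin_def)
  ultimately show ?thesis
    by (intro has_euler_rel_excision[of T "topspace T - {x}"]) auto
qed

text \<open>In a finite space with closed points every subset is closed, so each point is isolated
  and can be split off.\<close>

lemma has_euler_finite_discrete:
  assumes "finite (topspace T)" "\<And>x. x \<in> topspace T \<Longrightarrow> closedin T {x}"
  shows "has_euler T (int (card (topspace T)))"
  using assms
proof (induction "card (topspace T)" arbitrary: T)
  case 0
  then show ?case by (simp add: has_euler_empty)
next
  case (Suc n)
  then obtain x where x: "x \<in> topspace T" by fastforce
  have closed: "closedin T S" if "S \<subseteq> topspace T" for S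
  proof -
    have "closedin T (\<Union>((\<lambda>x. {x}) ` S))"
      using finite_subset[OF that Suc.prems(1)] that Suc.prems(2) by (intro closedin_Union) auto
    then show ?thesis by simp
  qed
  have "openin T {x}" using closed[of "topspace T - {x}"] x
    by (metis Diff_subset double_diff empty_subsetI insert_subset openin_diff openin_topspace subset_refl)
  then have rel: "has_euler_rel T (topspace T - {x}) 1"
    using Suc.prems x by (intro has_euler_rel_isolated) auto
  let ?S = "subtopology T (topspace T - {x})"
  have top: "topspace ?S = topspace T - {x}" by auto
  have "has_euler ?S (int (card (topspace ?S)))"
  proof (rule Suc.hyps(1))
    show "n = card (topspace ?S)" unfolding top using Suc.hyps(2) x Suc.prems by simp
    show "closedin ?S {y}" if "y \<in> topspace ?S" for y
      using that Suc.prems unfolding top closedin_subtopology by (intro exI[of _ "{y}"]) auto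
  qed (use Suc.prems in auto)
  from has_euler_total[OF rel this] show ?case unfolding top
    using Suc.hyps(2) x Suc.prems by (metis card_Suc_Diff1 add.commute of_nat_Suc)
qed

section \<open>Polynomials in two variables\<close>

abbreviation cf2 :: "complex poly poly \<Rightarrow> nat \<Rightarrow> nat \<Rightarrow> complex" where
  "cf2 f i j \<equiv> coeff (coeff f j) i"

abbreviation irred :: "complex poly poly \<Rightarrow> bool" where
  "irred \<equiv> Factorial_Ring.irreducible"

lemma eval2_1 [simp]: "eval2 1 w = 1"
  and eval2_diff [simp]: "eval2 (f - g) w = eval2 f w - eval2 g w"
  and eval2_power [simp]: "eval2 (f ^ n) w = eval2 f w ^ n"
  by (simp_all add: eval2_def)

lemma eval2_prod_mset: "eval2 (prod_mset A) w = prod_mset (image_mset (\<lambda>f. eval2 f w) A)"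
  by (induction A) auto

text \<open>A polynomial over an infinite domain is determined by its values; this is applied in
  \<open>x\<close> for each fixed \<open>y\<close>, then in \<open>y\<close>. Polynomial identities
  below are verified pointwise.\<close>

lemma eval2_ext:
  assumes "\<And>a b. eval2 f (a, b) = eval2 g (a, b)" shows "f = g"
proof -
  have "poly (f - g) [:b:] = 0" for b
    using assms[of _ b] by (intro poly_all_0_iff_0[THEN iffD1]) (auto simp: eval2_def)
  then have "range (\<lambda>b. [:b:]) \<subseteq> {r. poly (f - g) r = 0}" by auto
  moreover have "infinite (range (\<lambda>b::complex. [:b:]))"
    using finite_imageD[of "\<lambda>b::complex. [:b:]" UNIV] infinite_UNIV_char_0 by (auto simp: inj_on_def)
  ultimately have "f - g = 0" using poly_roots_finite finite_subset by blast
  then show ?thesis by simp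
qed

lemma subst2_add [simp]: "subst2 (f + g) P Q = subst2 f P Q + subst2 g P Q"
  and subst2_mult [simp]: "subst2 (f * g) P Q = subst2 f P Q * subst2 g P Q"
  and subst2_diff [simp]: "subst2 (f - g) P Q = subst2 f P Q - subst2 g P Q"
  and subst2_1 [simp]: "subst2 1 P Q = 1"
  and subst2_0 [simp]: "subst2 0 P Q = 0"
  and subst2_const2 [simp]: "subst2 (const2 c) P Q = const2 c"
  and subst2_varx [simp]: "subst2 varx P Q = P"
  and subst2_vary [simp]: "subst2 vary P Q = Q"
  and subst2_power [simp]: "subst2 (f ^ n) P Q = subst2 f P Q ^ n"
  by (rule eval2_ext; simp add: eval2_subst2)+

lemma subst2_subst2: "subst2 (subst2 f P Q) A B = subst2 f (subst2 P A B) (subst2 Q A B)"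
  by (rule eval2_ext) (simp add: eval2_subst2)

lemma subst2_id [simp]: "subst2 f varx vary = f"
  by (rule eval2_ext) (simp add: eval2_subst2)

lemma subst2_dvd: "f dvd g \<Longrightarrow> subst2 f P Q dvd subst2 g P Q"
  by (auto simp: dvd_def)

lemma pullback_mult [simp]: "pullback q (f * g) = pullback q f * pullback q g"
  and pullback_0 [simp]: "pullback q 0 = 0"
  by (rule eval2_ext; simp add: eval2_pullback)+

subsection \<open>Divisibility by powers of the coordinates\<close>

lemma varx_power: "varx ^ k = [:monom 1 k:]"
  by (induction k) (auto simp: varx_def monom_altdef one_pCons)

lemma vary_power: "vary ^ k = monom 1 k"
  by (simp add: vary_def monom_altdef)

lemma varx_power_dvd_iff: "varx ^ k dvd f \<longleftrightarrow> (\<forall>i<k. \<forall>j. cf2 f i j = 0)"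
  by (auto simp: varx_power const_poly_dvd_iff monom_1_dvd_iff')

lemma vary_power_dvd_iff: "vary ^ k dvd f \<longleftrightarrow> (\<forall>j<k. \<forall>i. cf2 f i j = 0)"
  by (auto simp: vary_power monom_1_dvd_iff' poly_eq_iff)

text \<open>Multiplicity at least \<open>k\<close> at the origin. A predicate, unlike a number, also
  covers the zero polynomial.\<close>

definition ordge :: "nat \<Rightarrow> complex poly poly \<Rightarrow> bool" where
  "ordge k f \<longleftrightarrow> (\<forall>i j. i + j < k \<longrightarrow> cf2 f i j = 0)"

abbreviation blow_x :: "complex poly poly \<Rightarrow> complex poly poly" where
  "blow_x f \<equiv> subst2 f varx (varx * vary)"

abbreviation blow_y :: "complex poly poly \<Rightarrow> complex poly poly" where
  "blow_y f \<equiv> subst2 f (varx * vary) vary"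

abbreviation shift_y :: "complex \<Rightarrow> complex poly poly \<Rightarrow> complex poly poly" where
  "shift_y t f \<equiv> subst2 f varx (const2 t + vary)"

lemma pCons_eq: "pCons c f = [:c:] + vary * f"
  by (simp add: vary_def)

lemma const_pCons_eq: "[:pCons a c:] = const2 a + varx * [:c:]"
  by (simp add: const2_def varx_def)

lemma subst2_pCons: "subst2 (pCons c f) P Q = subst2 [:c:] P Q + Q * subst2 f P Q"
  by (subst pCons_eq) simp

lemma subst2_const_pCons: "subst2 [:pCons a c:] P Q = const2 a + P * subst2 [:c:] P Q"
  by (subst const_pCons_eq) (simp only: subst2_add subst2_mult subst2_const2 subst2_varx)

lemma cf2_varx_mult: "cf2 (varx * f) i j = (case i of 0 \<Rightarrow> 0 | Suc i \<Rightarrow> cf2 f i j)"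
  by (simp add: varx_def coeff_pCons split: nat.split)

lemma cf2_vary_mult: "cf2 (vary * f) i j = (case j of 0 \<Rightarrow> 0 | Suc j \<Rightarrow> cf2 f i j)"
  by (simp add: vary_def coeff_pCons split: nat.split)

lemma subst2_const_varx: "subst2 [:c:] varx Q = [:c:]"
proof (induction c)
  case 0
  then show ?case using subst2_0 by (metis pCons_0_0)
next
  case (pCons a c)
  show ?case unfolding subst2_const_pCons pCons.IH by (rule const_pCons_eq[symmetric])
qed

lemma cf2_blow_x: "cf2 (blow_x f) i j = (if j \<le> i then cf2 f (i - j) j else 0)"
proof (induction f arbitrary: i j)
  case 0
  then show ?case by simp
next
  case (pCons c f)
  show ?case
    by (subst subst2_pCons, unfold subst2_const_varx mult.assoc)
      (cases i; cases j; auto simp: cf2_varx_mult cf2_vary_mult pCons.IH)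
qed

lemma cf2_blow_y_const: "cf2 (blow_y [:c:]) i j = (if i = j then coeff c i else 0)"
proof (induction c arbitrary: i j)
  case 0
  have "blow_y [:0:] = 0" using subst2_0 by (metis pCons_0_0)
  then show ?case by simp
next
  case (pCons a c)
  show ?case
    unfolding subst2_const_pCons mult.assoc
    by (cases i; cases j) (auto simp: cf2_varx_mult cf2_vary_mult pCons.IH const2_def)
qed

lemma cf2_blow_y: "cf2 (blow_y f) i j = (if i \<le> j then cf2 f i (j - i) else 0)"
proof (induction f arbitrary: i j)
  case 0
  then show ?case by simp
next
  case (pCons c f)
  show ?case
    by (subst subst2_pCons, cases j) (auto simp: cf2_vary_mult cf2_blow_y_const pCons.IH Suc_diff_le le_Suc_eq)
qed

text \<open>The substitution gives a monomial of total degree d the exact factor \<open>x^d\<close>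
  and merges no monomials. So the multiplicity along the exceptional curve is the multiplicity at
  the centre.\<close>

lemma varx_dvd_blow_x: "varx ^ k dvd blow_x f \<longleftrightarrow> ordge k f"
proof -
  have "(\<forall>i<k. \<forall>j. cf2 (blow_x f) i j = 0) \<longleftrightarrow> ordge k f"
    unfolding cf2_blow_x ordge_def
  proof (intro iffI allI impI)
    fix i j assume *: "\<forall>i<k. \<forall>j. (if j \<le> i then cf2 f (i - j) j else 0) = 0" "i + j < k"
    then show "cf2 f i j = 0" using *(1)[rule_format, of "i + j" j] by simp
  qed auto
  then show ?thesis by (simp add: varx_power_dvd_iff)
qed

lemma vary_dvd_blow_y: "vary ^ k dvd blow_y f \<longleftrightarrow> ordge k f"
proof -
  have "(\<forall>j<k. \<forall>i. cf2 (blow_y f) i j = 0) \<longleftrightarrow> ordge k f"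
    unfolding cf2_blow_y ordge_def
  proof (intro iffI allI impI)
    fix i j assume *: "\<forall>j<k. \<forall>i. (if i \<le> j then cf2 f i (j - i) else 0) = 0" "i + j < k"
    then show "cf2 f i j = 0" using *(1)[rule_format, of "i + j" i] by simp
  qed auto
  then show ?thesis by (simp add: vary_power_dvd_iff)
qed

text \<open>In this chart the axis \<open>v = 0\<close> is the strict transform of the old axis,
  along which multiplicities do not change.\<close>

lemma vary_dvd_blow_x: "vary ^ k dvd blow_x f \<longleftrightarrow> vary ^ k dvd f"
proof -
  have "(\<forall>j<k. \<forall>i. cf2 (blow_x f) i j = 0) \<longleftrightarrow> (\<forall>j<k. \<forall>i. cf2 f i j = 0)"
    unfolding cf2_blow_x
  proof (intro iffI allI impI)
    fix i j assume *: "\<forall>j<k. \<forall>i. (if j \<le> i then cf2 f (i - j) j else 0) = 0" "j < k"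
    then show "cf2 f i j = 0" using *(1)[rule_format, of j "i + j"] by simp
  qed auto
  then show ?thesis by (simp add: vary_power_dvd_iff)
qed

lemma varx_dvd_blow_y: "varx ^ k dvd blow_y f \<longleftrightarrow> varx ^ k dvd f"
proof -
  have "(\<forall>i<k. \<forall>j. cf2 (blow_y f) i j = 0) \<longleftrightarrow> (\<forall>i<k. \<forall>j. cf2 f i j = 0)"
    unfolding cf2_blow_y
  proof (intro iffI allI impI)
    fix i j assume *: "\<forall>i<k. \<forall>j. (if i \<le> j then cf2 f i (j - i) else 0) = 0" "i < k"
    then show "cf2 f i j = 0" using *(1)[rule_format, of i "i + j"] by simp
  qed auto
  then show ?thesis by (simp add: varx_power_dvd_iff)
qed

lemma shift_y_inverse: "shift_y (- t) (shift_y t f) = f"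
proof -
  have *: "const2 t + (const2 (- t) + vary) = vary" by (simp add: const2_def vary_def)
  show ?thesis by (simp only: subst2_subst2 subst2_varx subst2_vary subst2_add subst2_const2 * subst2_id)
qed

lemma varx_dvd_shift_y: "varx ^ k dvd shift_y t f \<longleftrightarrow> varx ^ k dvd f"
  using subst2_dvd[of "varx ^ k" f varx "const2 t + vary"]
    subst2_dvd[of "varx ^ k" "shift_y t f" varx "const2 (- t) + vary"]
  by (auto simp: shift_y_inverse)

lemma pullback_Slope: "pullback (Slope p t) f = shift_y t (blow_x (pullback p f))"
  by (simp add: subst2_subst2)

lemma blow_x_eq_0_iff [simp]: "blow_x f = 0 \<longleftrightarrow> f = 0"
proof
  assume "blow_x f = 0"
  then have "cf2 f i j = 0" for i j using cf2_blow_x[of f j "i + j"] by simp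
  then show "f = 0" by (simp add: poly_eq_iff)
qed simp

lemma blow_y_eq_0_iff [simp]: "blow_y f = 0 \<longleftrightarrow> f = 0"
proof
  assume "blow_y f = 0"
  then have "cf2 f i j = 0" for i j using cf2_blow_y[of f "i + j" i] by simp
  then show "f = 0" by (simp add: poly_eq_iff)
qed simp

lemma shift_y_eq_0_iff [simp]: "shift_y t f = 0 \<longleftrightarrow> f = 0"
  by (metis shift_y_inverse subst2_0)

lemma translate_inverse:
  "subst2 (subst2 f (const2 a + varx) (const2 b + vary)) (const2 (- a) + varx) (const2 (- b) + vary) = f"
proof -
  have *: "const2 a + (const2 (- a) + varx) = varx" "const2 b + (const2 (- b) + vary) = vary"
    by (simp_all add: const2_def vary_def varx_def)
  show ?thesis by (simp only: subst2_subst2 subst2_varx subst2_vary subst2_add subst2_const2 * subst2_id)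
qed

lemma pullback_eq_0_iff [simp]: "pullback q f = 0 \<longleftrightarrow> f = 0"
proof (induction q)
  case (Proper a b)
  then show ?case using translate_inverse[of f a b] by (metis pullback.simps(1) subst2_0)
next
  case (Slope p t)
  then show ?case unfolding pullback_Slope by simp
qed simp

lemma ordge_0 [simp]: "ordge 0 f"
  by (simp add: ordge_def)

lemma ordge_mono: "ordge k f \<Longrightarrow> l \<le> k \<Longrightarrow> ordge l f"
  by (auto simp: ordge_def)

definition ord2 :: "complex poly poly \<Rightarrow> nat" where
  "ord2 f = (LEAST k. \<not> ordge (Suc k) f)"

lemma ord2:
  assumes "f \<noteq> 0" shows "ordge (ord2 f) f" "\<not> ordge (Suc (ord2 f)) f"
proof -
  from assms obtain i j where "cf2 f i j \<noteq> 0" by (auto simp: poly_eq_iff)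
  then have "\<not> ordge (Suc (i + j)) f" by (auto simp: ordge_def)
  then show "\<not> ordge (Suc (ord2 f)) f" unfolding ord2_def by (rule LeastI)
  show "ordge (ord2 f) f"
  proof (cases "ord2 f")
    case (Suc k)
    then show ?thesis using not_less_Least[of k "\<lambda>k. \<not> ordge (Suc k) f"] by (simp add: ord2_def)
  qed simp
qed

lemma ordge_1_iff: "ordge (Suc 0) f \<longleftrightarrow> eval2 f (0, 0) = 0"
proof -
  have "eval2 f (0, 0) = cf2 f 0 0"
    by (simp add: eval2_def poly_0_coeff_0)
  then show ?thesis by (auto simp: ordge_def)
qed

lemma prime_elem_varx: "prime_elem varx"
proof -
  have "prime_elem [:0, 1 :: complex:]"
    by (rule prime_elem_linear_field_poly) simp
  then show ?thesis unfolding varx_def by (rule lift_prime_elem_poly)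
qed

lemma vary_dvd_iff: "vary dvd f \<longleftrightarrow> coeff f 0 = 0"
  using vary_power_dvd_iff[of 1 f] by (simp add: poly_eq_iff)

lemma prime_elem_vary: "prime_elem vary"
proof (rule prime_elemI)
  show "vary \<noteq> 0" by (simp add: vary_def)
  show "\<not> is_unit vary"
  proof
    assume "is_unit vary"
    then obtain k where "1 = vary * k" by (auto simp: dvd_def)
    then have "eval2 1 (0,0) = eval2 (vary * k) (0, 0)" by simp
    then show False by simp
  qed
qed (auto simp: vary_dvd_iff coeff_mult)

lemma irreducible_varx: "irred varx" and irreducible_vary: "irred vary"
  using prime_elem_varx prime_elem_vary by (simp_all add: prime_elem_imp_irreducible)

lemma eval2_0_left: "eval2 f (0, z) = poly (map_poly (\<lambda>c. poly c 0) f) z"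
  by (induction f) (auto simp: eval2_pCons map_poly_pCons)

lemma varx_dvd_if_infinite:
  assumes "infinite Z" "\<And>z. z \<in> Z \<Longrightarrow> eval2 f (0, z) = 0"
  shows "varx dvd f"
proof -
  have "Z \<subseteq> {z. poly (map_poly (\<lambda>c. poly c 0) f) z = 0}" using assms(2) by (auto simp: eval2_0_left)
  with assms(1) have "map_poly (\<lambda>c. poly c 0) f = 0" using poly_roots_finite finite_subset by blast
  then have "cf2 f 0 j = 0" for j
    by (metis coeff_0 coeff_map_poly poly_0 poly_0_coeff_0)
  then show ?thesis using varx_power_dvd_iff[of 1 f] by simp
qed

lemma vary_dvd_if_infinite:
  assumes "infinite Z" "\<And>z. z \<in> Z \<Longrightarrow> eval2 f (z, 0) = 0"
  shows "vary dvd f"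
proof -
  have "eval2 f (z, 0) = poly (coeff f 0) z" for z
    by (simp add: eval2_def poly_0_coeff_0)
  then have "Z \<subseteq> {z. poly (coeff f 0) z = 0}" using assms(2) by auto
  with assms(1) have "coeff f 0 = 0" using poly_roots_finite finite_subset by blast
  then show ?thesis by (simp add: vary_dvd_iff)
qed

lemma not_varx_dvd: "eval2 f (0, z) \<noteq> 0 \<Longrightarrow> \<not> varx dvd f"
  and not_vary_dvd: "eval2 f (z, 0) \<noteq> 0 \<Longrightarrow> \<not> vary dvd f"
  by (auto simp: dvd_def)

lemma prime_elem_power_dvd_cancel:
  assumes "prime_elem (p :: 'a :: idom)" "\<not> p dvd h" "p ^ k dvd h * g"
  shows "p ^ k dvd g"
  using assms(3)
proof (induction k arbitrary: g)
  case (Suc k)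
  then have "p dvd h * g" by (metis dvd_mult_left power_Suc)
  then obtain g' where g': "g = p * g'" using assms by (auto simp: prime_elem_dvd_mult_iff)
  then have "p * p ^ k dvd p * (h * g')" using Suc.prems by (simp add: mult_ac)
  then have "p ^ k dvd h * g'" using assms(1) by (simp add: prime_elem_def)
  then have "p ^ k dvd g'" by (rule Suc.IH)
  then show ?case unfolding g' power_Suc by (rule mult_dvd_mono[OF dvd_refl])
qed simp

lemma eval2_dvd: "f dvd g \<Longrightarrow> eval2 f w = 0 \<Longrightarrow> eval2 g w = 0"
  by (auto simp: dvd_def)

lemma nonzero_at_0_not_dvd: "eval2 h (0, 0) \<noteq> 0 \<Longrightarrow> eval2 p (0, 0) = 0 \<Longrightarrow> \<not> p dvd h"
  using eval2_dvd by blast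

lemma irreducible_factor_through:
  assumes "f \<noteq> 0" "eval2 f w = 0"
  shows "\<exists>p. irred p \<and> p dvd f \<and> eval2 p w = 0"
proof -
  have "\<exists>A. (\<forall>x. x \<in># A \<longrightarrow> prime_elem x) \<and> normalize (prod_mset A) = normalize f"
    by (rule prime_factorization_exists[OF assms(1)])
  then obtain A where A: "\<And>x. x \<in># A \<Longrightarrow> prime_elem x" "normalize (prod_mset A) = normalize f" by blast
  then have "f dvd prod_mset A" "prod_mset A dvd f" by (metis associatedD1 associatedD2)+
  then have "eval2 (prod_mset A) w = 0" using assms(2) eval2_dvd by blast
  then obtain p where p: "p \<in># A" "eval2 p w = 0" by (auto simp: eval2_prod_mset)
  then have "p dvd f" using \<open>prod_mset A dvd f\<close> by (meson dvd_prod_mset dvd_trans)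
  with p A(1) show ?thesis by (meson prime_elem_imp_irreducible)
qed

lemma irred_imp_prime: "irred p \<Longrightarrow> prime_elem p"
  by (rule Factorial_Ring.irreducible_imp_prime_elem)

lemma irred_dvd_irred:
  assumes "irred p" "irred q" "p dvd q" shows "q dvd p"
proof -
  from assms(3) obtain k where k: "q = p * k" by (auto simp: dvd_def)
  have "is_unit k" using Factorial_Ring.irreducibleD[OF assms(2) k] assms(1) by (auto simp: Factorial_Ring.irreducible_not_unit)
  then obtain l where "k * l = 1" by (metis dvdE)
  then have "p = q * l" using k by (simp add: mult.assoc)
  then show ?thesis by simp
qed

subsection \<open>Ideals and local ideals\<close>

lemmas times_span_induct [consumes 1] = Modules.module.span_induct_alt[OF module_times]

lemma dvd_ideal_gen:
  fixes S :: "'a::comm_ring_1 set"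
  assumes "g \<in> ideal_gen S" "\<And>s. s \<in> S \<Longrightarrow> d dvd s" shows "d dvd g"
  using assms(1) unfolding ideal_gen_def
  by (induction rule: times_span_induct) (auto simp: assms(2) intro!: dvd_add dvd_mult)

lemma ideal_gen_mult: "s \<in> S \<Longrightarrow> h * s \<in> ideal_gen S"
  unfolding ideal_gen_def by (intro Modules.module.span_scale[OF module_times] Modules.module.span_base[OF module_times])

lemma mem_local_ideal: "s \<in> S \<Longrightarrow> s \<in> local_ideal S"
  unfolding local_ideal_def using ideal_gen_mult[of s S 1] by (auto intro!: exI[of _ 1])

text \<open>Denominators are nonzero at the origin, hence not divisible by a prime vanishing there,
  so divisibility can be tested before localizing.\<close>

lemma prime_power_dvd_local_ideal:
  assumes "g \<in> local_ideal S" "\<And>s. s \<in> S \<Longrightarrow> p ^ k dvd s" "prime_elem p" "eval2 p (0, 0) = 0"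
  shows "p ^ k dvd g"
proof -
  from assms(1) obtain h where h: "eval2 h (0, 0) \<noteq> 0" "h * g \<in> ideal_gen S"
    by (auto simp: local_ideal_def)
  have "p ^ k dvd h * g" by (rule dvd_ideal_gen[OF h(2) assms(2)])
  then show ?thesis
    by (rule prime_elem_power_dvd_cancel[OF assms(3) nonzero_at_0_not_dvd[OF h(1) assms(4)]])
qed

text \<open>This computes the multiplicity of a local generator from any generating set, without
  knowing the generator.\<close>

lemma local_ideal_eq_prime_power_dvd_iff:
  assumes "local_ideal {g} = local_ideal S" "prime_elem p" "eval2 p (0, 0) = 0"
  shows "p ^ k dvd g \<longleftrightarrow> (\<forall>s\<in>S. p ^ k dvd s)"
proof
  assume *: "p ^ k dvd g"
  show "\<forall>s\<in>S. p ^ k dvd s"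
  proof
    fix s assume "s \<in> S"
    then have "s \<in> local_ideal {g}" using mem_local_ideal assms(1) by blast
    then show "p ^ k dvd s" by (rule prime_power_dvd_local_ideal) (use * assms in auto)
  qed
next
  assume *: "\<forall>s\<in>S. p ^ k dvd s"
  have "g \<in> local_ideal S" using mem_local_ideal[of g "{g}"] assms(1) by simp
  then show "p ^ k dvd g" by (rule prime_power_dvd_local_ideal) (use * assms in auto)
qed

lemma local_ideal_principal:
  assumes "\<And>s. s \<in> S \<Longrightarrow> d dvd s" "d * h \<in> S" "eval2 h (0, 0) \<noteq> 0"
  shows "local_ideal S = local_ideal {d}"
proof (intro equalityI subsetI)
  fix g assume "g \<in> local_ideal S"
  then obtain k where k: "eval2 k (0, 0) \<noteq> 0" "k * g \<in> ideal_gen S" by (auto simp: local_ideal_def)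
  have "d dvd k * g" by (rule dvd_ideal_gen[OF k(2) assms(1)])
  then obtain m where "k * g = m * d" by (metis dvdE mult.commute)
  then have "k * g \<in> ideal_gen {d}" using ideal_gen_mult[of d "{d}" m] by simp
  with k show "g \<in> local_ideal {d}" by (auto simp: local_ideal_def)
next
  fix g assume "g \<in> local_ideal {d}"
  then obtain k where k: "eval2 k (0, 0) \<noteq> 0" "k * g \<in> ideal_gen {d}" by (auto simp: local_ideal_def)
  have "d dvd k * g" by (rule dvd_ideal_gen[OF k(2)]) simp
  then obtain m where m: "k * g = d * m" by (auto simp: dvd_def)
  have "(h * k) * g = h * (k * g)" by (simp only: mult.assoc)
  also have "\<dots> = m * (d * h)" unfolding m by (simp only: mult_ac)
  finally have "(h * k) * g = m * (d * h)" .
  then have "(h * k) * g \<in> ideal_gen S" using ideal_gen_mult[OF assms(2), of m] by (simp only:)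
  moreover have "eval2 (h * k) (0, 0) \<noteq> 0" using k assms by simp
  ultimately show "g \<in> local_ideal S" unfolding local_ideal_def by blast
qed

lemma local_ideal_vanish:
  assumes "g \<in> local_ideal S" "\<And>s. s \<in> S \<Longrightarrow> eval2 s (0, 0) = 0"
  shows "eval2 g (0, 0) = 0"
proof -
  from assms(1) obtain h where h: "eval2 h (0, 0) \<noteq> 0" "h * g \<in> ideal_gen S"
    by (auto simp: local_ideal_def)
  from h(2) have "eval2 (h * g) (0, 0) = 0" unfolding ideal_gen_def
    by (induction rule: times_span_induct) (auto simp: assms(2))
  with h show ?thesis by simp
qed

text \<open>The local monomial vanishes at \<open>q\<close> but is not 0, because the ideal is not.
  An irreducible factor of it through \<open>q\<close> divides the whole ideal.\<close>

lemma snc_common_factor: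
  assumes snc: "snc_at I q" and f: "f \<in> I" "f \<noteq> 0"
    and vanish: "\<And>f. f \<in> I \<Longrightarrow> eval2 (pullback q f) (0, 0) = 0"
  shows "\<exists>p. irred p \<and> eval2 p (0, 0) = 0 \<and> (\<forall>f\<in>I. p dvd pullback q f)"
proof -
  from snc obtain z1 z2 a b where z: "local_parameters z1 z2"
    "local_ideal (pullback q ` I) = local_ideal {z1 ^ a * z2 ^ b}" by (auto simp: snc_at_def)
  let ?m = "z1 ^ a * z2 ^ b"
  have "?m \<in> local_ideal (pullback q ` I)" using z(2) mem_local_ideal[of ?m "{?m}"] by simp
  then have m0: "eval2 ?m (0, 0) = 0" by (rule local_ideal_vanish) (use vanish in auto)
  have "?m \<noteq> 0"
  proof
    assume "?m = 0"
    have "pullback q f \<in> local_ideal {?m}" using mem_local_ideal[of "pullback q f" "pullback q ` I"] z(2) f by simp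
    then obtain h where "eval2 h (0, 0) \<noteq> 0" "h * pullback q f \<in> ideal_gen {?m}" by (auto simp: local_ideal_def)
    then have h: "h \<noteq> 0" "?m dvd h * pullback q f" using dvd_ideal_gen[of _ "{?m}" ?m] by auto
    from h(2) have "h * pullback q f = 0" unfolding \<open>?m = 0\<close> by simp
    with h(1) f show False by simp
  qed
  then obtain p where p: "irred p" "p dvd ?m" "eval2 p (0, 0) = 0"
    using irreducible_factor_through m0 by blast
  have "p dvd pullback q f" if "f \<in> I" for f
  proof -
    have "pullback q f \<in> local_ideal {?m}"
      using mem_local_ideal[of "pullback q f" "pullback q ` I"] z(2) that by simp
    then have "p ^ 1 dvd pullback q f"
      by (rule prime_power_dvd_local_ideal) (use p irred_imp_prime in auto)
    then show ?thesis by simp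
  qed
  with p show ?thesis by blast
qed

subsection \<open>Zero sets of irreducible polynomials\<close>

lemma prod_mset_degree_0: "(\<And>p. p \<in># A \<Longrightarrow> degree p = 0) \<Longrightarrow> degree (prod_mset A :: complex poly poly) = 0"
proof (induction A)
  case (add x A)
  then have "degree x = 0" "degree (prod_mset A) = 0" by auto
  then show ?case using degree_mult_le[of x "prod_mset A"] by simp
qed simp

lemma irreducible_factor_degree:
  assumes "degree (f :: complex poly poly) > 0"
  shows "\<exists>p. irred p \<and> p dvd f \<and> degree p > 0"
proof -
  from assms have "f \<noteq> 0" by auto
  then have "\<exists>A. (\<forall>x. x \<in># A \<longrightarrow> prime_elem x) \<and> normalize (prod_mset A) = normalize f"
    by (rule prime_factorization_exists)
  then obtain A where A: "\<And>x. x \<in># A \<Longrightarrow> prime_elem x" "normalize (prod_mset A) = normalize f" by blast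
  then have d: "f dvd prod_mset A" "prod_mset A dvd f" by (metis associatedD1 associatedD2)+
  with \<open>f \<noteq> 0\<close> have "prod_mset A \<noteq> 0" by auto
  with d(1) have "degree f \<le> degree (prod_mset A)" by (rule dvd_imp_degree_le)
  with assms have "\<exists>p. p \<in># A \<and> degree p > 0" using prod_mset_degree_0[of A] by fastforce
  then obtain p where p: "p \<in># A" "degree p > 0" by blast
  then have "p dvd f" using d(2) by (meson dvd_prod_mset dvd_trans)
  with p A(1) show ?thesis by (meson prime_elem_imp_irreducible)
qed

text \<open>By pseudo-division, an element of least \<open>y\<close>-degree in the ideal of
  \<open>F\<close> and \<open>g\<close> divides multiples of both by nonzero polynomials in
  \<open>x\<close>. An irreducible factor of positive degree would be common to \<open>F\<close> and
  \<open>g\<close>, so this element is a polynomial in \<open>x\<close> alone.\<close>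

lemma resultant_exists:
  assumes "irred F" "\<not> F dvd g"
  shows "\<exists>c. c \<noteq> 0 \<and> (\<forall>a b. eval2 F (a, b) = 0 \<and> eval2 g (a, b) = 0 \<longrightarrow> poly c a = 0)"
proof -
  define J where "J = {u * F + v * g | u v. True}"
  have J_comb: "q * m + r \<in> J \<Longrightarrow> m \<in> J \<Longrightarrow> r \<in> J" for q m r
  proof -
    assume "q * m + r \<in> J" "m \<in> J"
    then obtain u v u' v' where uv: "q * m + r = u * F + v * g" "m = u' * F + v' * g" by (auto simp: J_def)
    have "r = (q * m + r) - q * m" by simp
    also have "\<dots> = (u * F + v * g) - q * (u' * F + v' * g)" by (simp only: uv(1), simp only: uv(2))
    also have "\<dots> = (u - q * u') * F + (v - q * v') * g" by (simp only: algebra_simps)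
    finally have "r = (u - q * u') * F + (v - q * v') * g" .
    then show "r \<in> J" by (auto simp: J_def)
  qed
  have FJ: "h * F \<in> J" and gJ: "h * g \<in> J" for h
    by (auto simp: J_def intro: exI[of _ h] exI[of _ 0])
  have "F \<noteq> 0" using assms(1) by auto
  moreover have "F \<in> J" using FJ[of 1] by simp
  ultimately obtain m where m: "m \<in> J" "m \<noteq> 0"
    and least: "\<And>m'. m' \<in> J \<Longrightarrow> m' \<noteq> 0 \<Longrightarrow> degree m \<le> degree m'"
    using ex_has_least_nat[of "\<lambda>m. m \<in> J \<and> m \<noteq> 0" F degree] by blast
  have dvd: "\<exists>c. c \<noteq> 0 \<and> m dvd Polynomial.smult c h" if "\<And>k. k * h \<in> J" for h
  proof -
    obtain q r where qr: "pseudo_divmod h m = (q, r)" by fastforce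
    let ?c = "coeff m (degree m) ^ (Suc (degree h) - degree m)"
    from pseudo_divmod[OF m(2) qr] have e: "Polynomial.smult ?c h = m * q + r" and r: "r = 0 \<or> degree r < degree m"
      by auto
    have "Polynomial.smult ?c h = [:?c:] * h" by simp
    then have "q * m + r \<in> J" using that[of "[:?c:]"] e by (simp add: mult.commute)
    then have "r \<in> J" using m(1) by (rule J_comb)
    then have "r = 0" using r least[of r] by fastforce
    with e have "m dvd Polynomial.smult ?c h" by simp
    moreover have "?c \<noteq> 0" using m(2) by simp
    ultimately show ?thesis by blast
  qed
  have "degree m = 0"
  proof (rule ccontr)
    assume "degree m \<noteq> 0"
    then obtain p where p: "irred p" "p dvd m" "degree p > 0" using irreducible_factor_degree[of m] by blast
    \<comment> \<open>Gauss's lemma in disguise: a prime of positive \<open>y\<close>-degree cannot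
      divide the multiplier, which depends on \<open>x\<close> only.\<close>
    have pd: "p dvd h" if "m dvd Polynomial.smult c h" "c \<noteq> 0" for c h
    proof -
      have "p dvd [:c:] * h" using that(1) p(2) dvd_trans by auto
      moreover have "\<not> p dvd [:c:]" using that(2) p(3) dvd_imp_degree_le[of p "[:c:]"] by auto
      ultimately show ?thesis using irred_imp_prime[OF p(1)] by (simp add: prime_elem_dvd_mult_iff del: mult_pCons_left)
    qed
    have "p dvd F" "p dvd g" using dvd[OF FJ] dvd[OF gJ] pd by blast+
    with irred_dvd_irred[OF p(1) assms(1)] assms(2) show False using dvd_trans by blast
  qed
  then obtain c where c: "m = [:c:]" using degree_eq_zeroE by blast
  with m obtain u v where uv: "[:c:] = u * F + v * g" by (auto simp: J_def)
  have "poly c a = 0" if "eval2 F (a, b) = 0" "eval2 g (a, b) = 0" for a b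
  proof -
    have "eval2 [:c:] (a, b) = 0" unfolding uv using that by simp
    then show ?thesis by (simp add: eval2_def)
  qed
  moreover have "c \<noteq> 0" using c m by auto
  ultimately show ?thesis by blast
qed

lemma linear_dvd_if_fibre_zero:
  assumes "poly (map_poly (\<lambda>c. poly c a) f) = (\<lambda>_. 0)"
  shows "[:[:-a, 1:]:] dvd (f :: complex poly poly)"
proof -
  have "map_poly (\<lambda>c. poly c a) f = 0" using assms poly_all_0_iff_0 by metis
  then have "poly (coeff f n) a = 0" for n by (metis coeff_0 coeff_map_poly poly_0)
  then show ?thesis by (simp add: const_poly_dvd_iff poly_eq_0_iff_dvd[symmetric])
qed

lemma eval2_fibre: "eval2 f (a, b) = poly (map_poly (\<lambda>c. poly c a) f) b"
  by (induction f) (auto simp: eval2_pCons map_poly_pCons)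

text \<open>The first coordinates are roots of the eliminant. An infinite fibre over
  \<open>a\<close> would make \<open>x - a\<close> divide both polynomials, and then
  \<open>F\<close>, being associated to it, would divide \<open>g\<close>.\<close>

lemma finite_common_zeros:
  assumes F: "irred F" "\<not> F dvd g"
  shows "finite {w. eval2 F w = 0 \<and> eval2 g w = 0}"
proof -
  let ?Z = "{w. eval2 F w = 0 \<and> eval2 g w = 0}"
  from resultant_exists[OF F] obtain c where c: "c \<noteq> 0"
    "\<And>a b. eval2 F (a, b) = 0 \<Longrightarrow> eval2 g (a, b) = 0 \<Longrightarrow> poly c a = 0" by blast
  have fib: "finite {b. eval2 F (a, b) = 0 \<and> eval2 g (a, b) = 0}" for a
  proof (rule ccontr)
    assume inf: "infinite {b. eval2 F (a, b) = 0 \<and> eval2 g (a, b) = 0}"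
    have "map_poly (\<lambda>c. poly c a) h = 0" if "\<And>b. eval2 F (a, b) = 0 \<and> eval2 g (a, b) = 0 \<Longrightarrow> eval2 h (a, b) = 0" for h
    proof (rule ccontr)
      assume "map_poly (\<lambda>c. poly c a) h \<noteq> 0"
      then have "finite {b. poly (map_poly (\<lambda>c. poly c a) h) b = 0}" by (rule poly_roots_finite)
      moreover have "{b. eval2 F (a, b) = 0 \<and> eval2 g (a, b) = 0} \<subseteq> {b. poly (map_poly (\<lambda>c. poly c a) h) b = 0}"
        using that by (auto simp: eval2_fibre)
      ultimately show False using inf finite_subset by blast
    qed
    then have d: "[:[:-a, 1:]:] dvd F" "[:[:-a, 1:]:] dvd g" by (auto intro!: linear_dvd_if_fibre_zero)
    have "\<not> is_unit [:[:-a, 1 :: complex:]:]" by (simp add: is_unit_const_poly_iff is_unit_poly_iff)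
    moreover from d(1) obtain k where k: "F = [:[:-a, 1:]:] * k" by (auto simp: dvd_def)
    ultimately have "is_unit k" using Factorial_Ring.irreducibleD[OF F(1) k] by blast
    then obtain l where "k * l = 1" by (metis dvdE)
    then have "F * l = [:[:-a, 1:]:]" using k by (simp add: mult.assoc del: mult_pCons_left)
    then have "F dvd [:[:-a, 1:]:]" by (metis dvd_triv_left)
    with d(2) F(2) show False using dvd_trans by blast
  qed
  have "?Z \<subseteq> (\<Union>a\<in>{a. poly c a = 0}. (\<lambda>b. (a, b)) ` {b. eval2 F (a, b) = 0 \<and> eval2 g (a, b) = 0})"
    using c(2) by auto
  moreover have "finite \<dots>" using poly_roots_finite[OF c(1)] fib by auto
  ultimately show ?thesis by (rule finite_subset)
qed

text \<open>If \<open>F\<close> depends on \<open>x\<close> only, a root gives a whole vertical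
  line. Otherwise every fibre outside the roots of the leading coefficient contains a zero.\<close>

lemma infinite_zeros:
  assumes F: "irred F" shows "infinite {w. eval2 F w = 0}"
proof -
  let ?A = "{a. \<exists>b. eval2 F (a, b) = 0}"
  have F0: "F \<noteq> 0" using F by auto
  show ?thesis
  proof (cases "degree F = 0")
    case True
    then obtain c where c: "F = [:c:]" using degree_eq_zeroE by blast
    have "degree c \<noteq> 0"
    proof
      assume "degree c = 0"
      with F0 c have "is_unit F" by (simp add: is_unit_const_poly_iff is_unit_iff_degree)
      with F show False by (simp add: Factorial_Ring.irreducible_def)
    qed
    then obtain a where a: "poly c a = 0" using fundamental_theorem_of_algebra_alt[of c]
      by (metis degree_pCons_0)
    have "range (\<lambda>b. (a, b)) \<subseteq> {w. eval2 F w = 0}" using a c by (auto simp: eval2_def)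
    moreover have "infinite (range (\<lambda>b::complex. (a, b)))"
      using finite_imageD[of "\<lambda>b::complex. (a, b)" UNIV] infinite_UNIV_char_0 by (auto simp: inj_on_def)
    ultimately show ?thesis using finite_subset by blast
  next
    case False
    let ?l = "lead_coeff F"
    have l0: "?l \<noteq> 0" using F0 by simp
    have "\<exists>b. eval2 F (a, b) = 0" if "poly ?l a \<noteq> 0" for a
    proof -
      let ?p = "map_poly (\<lambda>c. poly c a) F"
      have "coeff ?p (degree F) \<noteq> 0" using that by (simp add: coeff_map_poly)
      then have "degree ?p \<ge> degree F" by (rule le_degree)
      with False have "degree ?p \<noteq> 0" by simp
      then obtain b where "poly ?p b = 0" using fundamental_theorem_of_algebra_alt[of ?p]
        by (metis degree_pCons_0)
      then show ?thesis by (auto simp: eval2_fibre)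
    qed
    then have "- {a. poly ?l a = 0} \<subseteq> fst ` {w. eval2 F w = 0}" by force
    moreover have "infinite (- {a. poly ?l a = 0})"
      using poly_roots_finite[OF l0] infinite_UNIV_char_0[where 'a=complex]
      by (metis finite_compl)
    ultimately show ?thesis by (metis finite_imageI finite_subset)
  qed
qed

subsection \<open>The Jacobian determinant\<close>

abbreviation dx2 :: "complex poly poly \<Rightarrow> complex poly poly" where "dx2 f \<equiv> map_poly pderiv f"

lemma dx2_add: "dx2 (f + g) = dx2 f + dx2 g"
  by (rule poly_eqI) (simp add: coeff_map_poly pderiv_add)

lemma pderiv_sum_poly: "pderiv (sum f A) = (\<Sum>x\<in>A. pderiv (f x :: 'b :: idom poly))"
  by (induction A rule: infinite_finite_induct) (auto simp: pderiv_add)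

lemma dx2_mult: "dx2 (f * g) = f * dx2 g + g * dx2 f"
proof -
  have "dx2 (f * g) = f * dx2 g + dx2 f * g"
  proof (rule poly_eqI)
    fix n
    have "coeff (dx2 (f * g)) n = (\<Sum>i\<le>n. coeff f i * pderiv (coeff g (n - i)) + pderiv (coeff f i) * coeff g (n - i))"
      by (simp add: coeff_map_poly coeff_mult pderiv_sum_poly pderiv_mult mult.commute)
    also have "\<dots> = coeff (f * dx2 g + dx2 f * g) n"
      by (simp add: coeff_map_poly coeff_mult sum.distrib)
    finally show "coeff (dx2 (f * g)) n = coeff (f * dx2 g + dx2 f * g) n" .
  qed
  then show ?thesis by (simp only: mult.commute)
qed

text \<open>The chain rule for an arbitrary derivation that kills constants, so that one induction
  serves both partial derivatives.\<close>

lemma subst2_derivation: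
  fixes D :: "complex poly poly \<Rightarrow> complex poly poly"
  assumes add: "\<And>f g. D (f + g) = D f + D g" and mult: "\<And>f g. D (f * g) = f * D g + g * D f"
    and const: "\<And>c. D (const2 c) = 0"
  shows "D (subst2 f P Q) = subst2 (dx2 f) P Q * D P + subst2 (pderiv f) P Q * D Q"
proof -
  have D0: "D 0 = 0" using const[of 0] by (simp add: const2_def)
  have inner: "D (subst2 [:c:] P Q) = subst2 [:pderiv c:] P Q * D P" for c
  proof (induction c)
    case 0
    then show ?case using D0 by simp
  next
    case (pCons a c)
    have "[:pderiv (pCons a c):] = [:c:] + varx * [:pderiv c:]"
      by (simp add: pderiv_pCons varx_def)
    then have *: "subst2 [:pderiv (pCons a c):] P Q = subst2 [:c:] P Q + P * subst2 [:pderiv c:] P Q"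
      by (simp only: subst2_add subst2_mult subst2_varx)
    show ?case unfolding * subst2_const_pCons add mult const pCons.IH
      by (simp only: ring_distribs mult_ac add_0_left add_ac)
  qed
  show ?thesis
  proof (induction f)
    case 0
    then show ?case using D0 by simp
  next
    case (pCons c f)
    have dx: "dx2 (pCons c f) = pCons (pderiv c) (dx2 f)" by (simp add: map_poly_pCons)
    have "pderiv (pCons c f) = f + vary * pderiv f" by (simp add: pderiv_pCons vary_def)
    then have dy: "subst2 (pderiv (pCons c f)) P Q = subst2 f P Q + Q * subst2 (pderiv f) P Q"
      by (simp only: subst2_add subst2_mult subst2_vary)
    show ?case
      unfolding dy dx
      by (subst (1 2) subst2_pCons, unfold add mult inner pCons.IH) (simp only: ring_distribs mult_ac add_ac)
  qed
qed

lemma determinant_product: "(a * p + b * q) * (c * r + d * s) - (a * r + b * s) * (c * p + d * q) =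
      (a * d - b * c) * (p * s - r * q)" for a b c d p q r s :: "'a::comm_ring_1"
  by (simp add: algebra_simps)

lemma jacobian2_subst2:
  "jacobian2 (subst2 P A B) (subst2 Q A B) = subst2 (jacobian2 P Q) A B * jacobian2 A B"
proof -
  have x: "dx2 (subst2 f A B) = subst2 (dx2 f) A B * dx2 A + subst2 (pderiv f) A B * dx2 B" for f
    by (rule subst2_derivation[of dx2], rule dx2_add, rule dx2_mult, simp add: const2_def map_poly_pCons)
  have y: "pderiv (subst2 f A B) = subst2 (dx2 f) A B * pderiv A + subst2 (pderiv f) A B * pderiv B" for f
    by (rule subst2_derivation[of pderiv], rule pderiv_add, rule pderiv_mult, simp add: const2_def pderiv_pCons)
  show ?thesis unfolding jacobian2_def x y subst2_diff subst2_mult by (rule determinant_product)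
qed

definition jac :: "pt \<Rightarrow> complex poly poly" where
  "jac q = jacobian2 (pullback q varx) (pullback q vary)"

lemma jac_Proper: "jac (Proper a b) = 1"
  unfolding jac_def pullback.simps subst2_varx subst2_vary
  by (simp add: jacobian2_def const2_def varx_def vary_def map_poly_pCons pderiv_pCons one_pCons)

lemma jac_Slope: "jac (Slope p t) = shift_y t (blow_x (jac p)) * varx"
proof -
  have "jacobian2 varx (varx * (const2 t + vary)) = varx"
    by (simp add: jacobian2_def const2_def varx_def vary_def map_poly_pCons pderiv_pCons one_pCons)
  then show ?thesis unfolding jac_def pullback.simps jacobian2_subst2
    by (simp add: subst2_subst2)
qed

lemma jac_Vertical: "jac (Vertical p) = blow_y (jac p) * vary"
proof -
  have "jacobian2 (varx * vary) vary = vary"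
    by (simp add: jacobian2_def const2_def varx_def vary_def map_poly_pCons pderiv_pCons one_pCons)
  then show ?thesis unfolding jac_def pullback.simps jacobian2_subst2 by simp
qed

section \<open>Charts and exceptional curves\<close>

text \<open>All points to which \<open>q\<close> is infinitely near, and \<open>q\<close> itself. A
  point carries its own history, which is why a surface can be described by its set of
  centres.\<close>

primrec anc :: "pt \<Rightarrow> pt set" where
  "anc (Proper a b) = {Proper a b}"
| "anc (Slope p t) = insert (Slope p t) (anc p)"
| "anc (Vertical p) = insert (Vertical p) (anc p)"

abbreviation panc :: "pt \<Rightarrow> pt set" where "panc q \<equiv> anc q - {q}"

lemma anc_refl [simp]: "q \<in> anc q"
  by (cases q) auto

lemma anc_size: "p \<in> anc q \<Longrightarrow> size p \<le> size q"
  by (induction q) auto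

lemma anc_size_less: "p \<in> anc q \<Longrightarrow> p \<noteq> q \<Longrightarrow> size p < size q"
  by (cases q) (auto dest!: anc_size)

lemma child_notin_anc [simp]: "Slope p t \<notin> anc p" "Vertical p \<notin> anc p"
  by (auto dest!: anc_size)

lemma child_neq [simp]: "Slope p t \<noteq> p" "Vertical p \<noteq> p" "p \<noteq> Slope p t" "p \<noteq> Vertical p"
  by (metis anc_refl child_notin_anc)+

lemma panc_child [simp]: "panc (Slope p t) = anc p" "panc (Vertical p) = anc p" "panc (Proper a b) = {}"
  by auto

lemma anc_trans: "p \<in> anc q \<Longrightarrow> q \<in> anc r \<Longrightarrow> p \<in> anc r"
  by (induction r) auto

lemma anc_linear: "p \<in> anc r \<Longrightarrow> q \<in> anc r \<Longrightarrow> p \<in> anc q \<or> q \<in> anc p"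
  by (induction r) auto

lemma blow_down_anc: "p \<in> anc q \<Longrightarrow> blow_down p = blow_down q"
  by (induction q) auto

lemma root_anc: "Proper (fst (blow_down q)) (snd (blow_down q)) \<in> anc q"
  by (induction q) auto

definition children :: "pt \<Rightarrow> pt set" where
  "children p = insert (Vertical p) (range (Slope p))"

lemma children_simps [simp]: "Slope p t \<in> children q \<longleftrightarrow> p = q" "Vertical p \<in> children q \<longleftrightarrow> p = q"
  "Proper a b \<notin> children q"
  by (auto simp: children_def)

lemma child_anc: "c \<in> children p \<Longrightarrow> anc c = insert c (anc p)"
  by (auto simp: children_def)

lemma child_blow_down: "c \<in> children p \<Longrightarrow> blow_down c = blow_down p"
  by (auto simp: children_def)

lemma child_not_anc: "c \<in> children p \<Longrightarrow> c \<notin> anc p"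
  by (auto simp: children_def)

lemma anc_child_between:
  assumes "p \<in> anc q" "p \<noteq> q" shows "\<exists>c\<in>children p. c \<in> anc q"
  using assms
proof (induction q)
  case (Slope q t)
  then show ?case by (cases "p = q") (auto simp: children_def)
next
  case (Vertical q)
  then show ?case by (cases "p = q") (auto simp: children_def)
qed auto

text \<open>The chart at \<open>p\<close> describes the surface before \<open>p\<close> is blown up,
  so its only point over \<open>p\<close> is \<open>p\<close> itself.\<close>

lemma chart_anc: "p \<in> anc (chart p w) \<Longrightarrow> w = (0, 0)"
proof (induction p arbitrary: w)
  case (Proper a b)
  then show ?case by (cases w) auto
next
  case (Slope p t)
  obtain u v where w: "w = (u, v)" by fastforce
  show ?case
  proof (cases "u = 0")
    case True
    with Slope.prems w show ?thesis by auto
  next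
    case False
    with Slope.prems w have "Slope p t \<in> anc (chart p (u, u * (t + v)))" by simp
    then have "p \<in> anc (chart p (u, u * (t + v)))" by (rule anc_trans[rotated]) auto
    from Slope.IH[OF this] False show ?thesis by simp
  qed
next
  case (Vertical p)
  obtain u v where w: "w = (u, v)" by fastforce
  show ?case
  proof (cases "v = 0")
    case True
    with Vertical.prems w show ?thesis by (auto split: if_splits)
  next
    case False
    with Vertical.prems w have "Vertical p \<in> anc (chart p (u * v, v))" by simp
    then have "p \<in> anc (chart p (u * v, v))" by (rule anc_trans[rotated]) auto
    from Vertical.IH[OF this] False show ?thesis by simp
  qed
qed

lemma panc_chart: "panc (chart q w) \<subseteq> panc q"
proof (induction q arbitrary: w)
  case (Proper a b)
  then show ?case by (cases w) auto
next
  case (Slope p t)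
  obtain u v where w: "w = (u, v)" by fastforce
  show ?case using Slope.IH[of "(u, u * (t + v))"] w by (cases "u = 0") auto
next
  case (Vertical p)
  obtain u v where w: "w = (u, v)" by fastforce
  show ?case using Vertical.IH[of "(u * v, v)"] w by (cases "v = 0") auto
qed

lemma chart_inj: "chart q w = chart q w' \<Longrightarrow> w = w'"
proof (induction q arbitrary: w w')
  case (Proper a b)
  then show ?case by (cases w; cases w') auto
next
  case (Slope p t)
  obtain u v u' v' where w: "w = (u, v)" "w' = (u', v')" by fastforce
  have no: "chart p (a, b) \<noteq> Slope p s" if "a \<noteq> 0" for a b s
    using chart_anc[of p "(a, b)"] that by auto
  have eq: "(u, u * (t + v)) = (u', u' * (t + v'))" if "u \<noteq> 0" "u' \<noteq> 0"
    by (rule Slope.IH) (use Slope.prems w that in auto)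
  show ?case using Slope.prems w no[of u] no[of u', symmetric] eq
    by (auto split: if_splits)
next
  case (Vertical p)
  obtain u v u' v' where w: "w = (u, v)" "w' = (u', v')" by fastforce
  have no: "chart p (a, b) \<noteq> Slope p s" "chart p (a, b) \<noteq> Vertical p" if "b \<noteq> 0" for a b s
    using chart_anc[of p "(a, b)"] that by auto
  have eq: "(u * v, v) = (u' * v', v')" if "v \<noteq> 0" "v' \<noteq> 0"
    by (rule Vertical.IH) (use Vertical.prems w that in auto)
  show ?case using Vertical.prems w no[of v] no[of v', symmetric] eq
    by (auto split: if_splits)
qed

text \<open>\<open>ax1 q\<close> and \<open>ax2 q\<close> are the points whose exceptional curves are the axes \<open>u = 0\<close> and
  \<open>v = 0\<close> of the chart centred at \<open>q\<close>, if any.\<close>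

primrec ax1 :: "pt \<Rightarrow> pt option" where
  "ax1 (Proper a b) = None"
| "ax1 (Slope p t) = Some p"
| "ax1 (Vertical p) = ax1 p"

primrec ax2 :: "pt \<Rightarrow> pt option" where
  "ax2 (Proper a b) = None"
| "ax2 (Slope p t) = (if t = 0 then ax2 p else None)"
| "ax2 (Vertical p) = Some p"

text \<open>The exceptional curve over \<open>p\<close> together with its strict transforms in all
  later surfaces. Intersecting with \<open>X\<close> selects the points present there.\<close>

definition exc :: "pt \<Rightarrow> pt set" where
  "exc p = {q. ax1 q = Some p \<or> ax2 q = Some p}"

lemma ax_panc: "ax1 q = Some p \<Longrightarrow> p \<in> panc q" "ax2 q = Some p \<Longrightarrow> p \<in> panc q"
proof -
  have "(ax1 q = Some p \<longrightarrow> p \<in> panc q) \<and> (ax2 q = Some p \<longrightarrow> p \<in> panc q)"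
    by (induction q) auto
  then show "ax1 q = Some p \<Longrightarrow> p \<in> panc q" "ax2 q = Some p \<Longrightarrow> p \<in> panc q" by auto
qed

lemma exc_panc: "q \<in> exc p \<Longrightarrow> p \<in> panc q"
  using ax_panc by (auto simp: exc_def)

lemma exc_blow_down: "q \<in> exc p \<Longrightarrow> blow_down q = blow_down p"
  using exc_panc blow_down_anc by fastforce

lemma children_subset_exc: "children p \<subseteq> exc p"
  by (auto simp: children_def exc_def)

lemma not_Proper_exc: "(\<forall>p. q \<notin> exc p) \<longleftrightarrow> (\<exists>a b. q = Proper a b)"
  by (cases q) (auto simp: exc_def)

lemma chart_notin_exc_self [simp]: "chart p w \<notin> exc p"
  using exc_panc chart_anc by fastforce

lemma chart_axis: "(ax1 q = Some p \<longrightarrow> (chart q w \<in> exc p \<longleftrightarrow> fst w = 0)) \<and>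
   (ax2 q = Some p \<longrightarrow> (chart q w \<in> exc p \<longleftrightarrow> snd w = 0))"
proof (induction q arbitrary: w)
  case (Slope q t)
  obtain u v where w: "w = (u, v)" by fastforce
  have "(chart (Slope q t) w \<in> exc q \<longleftrightarrow> u = 0)"
    by (simp add: w) (simp add: exc_def)
  moreover have "(chart (Slope q t) w \<in> exc p \<longleftrightarrow> v = 0)" if "t = 0" "ax2 q = Some p"
  proof -
    have "p \<noteq> q" using that ax_panc by blast
    then show ?thesis using Slope.IH[of "(u, u * v)"] that by (simp add: w) (auto simp: exc_def)
  qed
  ultimately show ?case using w by auto
next
  case (Vertical q)
  obtain u v where w: "w = (u, v)" by fastforce
  have "(chart (Vertical q) w \<in> exc q \<longleftrightarrow> v = 0)"
    by (simp add: w) (simp add: exc_def)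
  moreover have "(chart (Vertical q) w \<in> exc p \<longleftrightarrow> u = 0)" if "ax1 q = Some p"
  proof -
    have "p \<noteq> q" using that ax_panc by blast
    then show ?thesis using Vertical.IH[of "(u * v, v)"] that by (simp add: w) (auto simp: exc_def)
  qed
  ultimately show ?case using w by auto
qed auto

lemma chart_exc1: "ax1 q = Some p \<Longrightarrow> chart q w \<in> exc p \<longleftrightarrow> fst w = 0"
  and chart_exc2: "ax2 q = Some p \<Longrightarrow> chart q w \<in> exc p \<longleftrightarrow> snd w = 0"
  using chart_axis by blast+

lemma ax1_neq_ax2: "ax1 q = Some p \<Longrightarrow> ax2 q \<noteq> Some p"
  using chart_exc1[of q p "(1, 0)"] chart_exc2[of q p "(1, 0)"] by auto

text \<open>After the blow-up of \<open>q\<close>, the axis \<open>v = 0\<close> appears only in the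
  slope charts and the axis \<open>u = 0\<close> only in the vertical one. A curve that misses
  \<open>q\<close> keeps its equation, pulled back.\<close>

lemma exc_equation: "\<exists>e. \<forall>w. chart q w \<in> exc p \<longleftrightarrow> eval2 e w = 0"
proof (induction q)
  case (Proper a b)
  have "chart (Proper a b) w \<notin> exc p" for w by (cases w) (simp add: exc_def)
  then show ?case by (intro exI[of _ 1]) simp
next
  case (Slope q t)
  from Slope obtain e where e: "\<And>w. chart q w \<in> exc p \<longleftrightarrow> eval2 e w = 0" by blast
  consider "p = q" | "p \<noteq> q" "ax2 q = Some p" | "p \<noteq> q" "ax1 q = Some p" "ax2 q \<noteq> Some p"
    | "p \<noteq> q" "ax1 q \<noteq> Some p" "ax2 q \<noteq> Some p" by blast
  then show ?case
  proof cases
    case 1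
    then show ?thesis using chart_exc1[of "Slope q t" p] by (intro exI[of _ varx]) simp
  next
    case 2
    have "chart (Slope q t) (u, v) \<in> exc p \<longleftrightarrow> t + v = 0" for u v
      using 2 chart_exc2[of q p "(u, u * (t + v))"] by (cases "u = 0") (auto simp: exc_def)
    then show ?thesis by (intro exI[of _ "const2 t + vary"]) simp
  next
    case 3
    have "chart (Slope q t) (u, v) \<notin> exc p" for u v
      using 3 chart_exc1[of q p "(u, u * (t + v))"] by (cases "u = 0") (auto simp: exc_def)
    then show ?thesis by (intro exI[of _ 1]) simp
  next
    case 4
    then have "eval2 e (0, 0) \<noteq> 0" using e[of "(0, 0)"] by (simp add: exc_def)
    then have "chart (Slope q t) (u, v) \<in> exc p \<longleftrightarrow> eval2 e (u, u * (t + v)) = 0" for u v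
      using 4 e[of "(u, u * (t + v))"] by (cases "u = 0") (auto simp: exc_def)
    then show ?thesis
      by (intro exI[of _ "subst2 e varx (varx * (const2 t + vary))"]) (simp add: eval2_subst2)
  qed
next
  case (Vertical q)
  from Vertical obtain e where e: "\<And>w. chart q w \<in> exc p \<longleftrightarrow> eval2 e w = 0" by blast
  consider "p = q" | "p \<noteq> q" "ax1 q = Some p" | "p \<noteq> q" "ax2 q = Some p" "ax1 q \<noteq> Some p"
    | "p \<noteq> q" "ax1 q \<noteq> Some p" "ax2 q \<noteq> Some p" by blast
  then show ?case
  proof cases
    case 1
    then show ?thesis using chart_exc2[of "Vertical q" p] by (intro exI[of _ vary]) simp
  next
    case 2
    then show ?thesis using chart_exc1[of "Vertical q" p] by (intro exI[of _ varx]) simp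
  next
    case 3
    have "chart (Vertical q) (u, v) \<notin> exc p" for u v
      using 3 chart_exc2[of q p "(u * v, v)"] by (cases "v = 0"; cases "u = 0") (auto simp: exc_def)
    then show ?thesis by (intro exI[of _ 1]) simp
  next
    case 4
    then have "eval2 e (0, 0) \<noteq> 0" using e[of "(0, 0)"] by (simp add: exc_def)
    then have "chart (Vertical q) (u, v) \<in> exc p \<longleftrightarrow> eval2 e (u * v, v) = 0" for u v
      using 4 e[of "(u * v, v)"] by (cases "v = 0"; cases "u = 0") (auto simp: exc_def)
    then show ?thesis
      by (intro exI[of _ "subst2 e (varx * vary) vary"]) (simp add: eval2_subst2)
  qed
qed

text \<open>Blowing up a point of the curve removes at most that one slope from the axis, and the
  vertical chart loses slope 0. Finitely many blow-ups thus lose finitely many slopes.\<close>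

lemma finite_off_axis:
  "(ax1 q = Some p \<longrightarrow> finite {t. Slope p t \<notin> range (\<lambda>z. chart q (0, z))}) \<and>
   (ax2 q = Some p \<longrightarrow> finite {t. Slope p t \<notin> range (\<lambda>z. chart q (z, 0))})"
proof (induction q)
  case (Slope q t)
  have fin: "finite {s. Slope p s = q}" by (cases q) auto
  have "Slope q s \<in> range (\<lambda>z. chart (Slope q t) (0, z))" for s
    by (rule range_eqI[of _ _ "s - t"]) simp
  moreover have "finite {s. Slope p s \<notin> range (\<lambda>z. chart (Slope q 0) (z, 0))}" if "ax2 q = Some p"
  proof (rule finite_subset)
    show "{s. Slope p s \<notin> range (\<lambda>z. chart (Slope q 0) (z, 0))} \<subseteq>
        {s. Slope p s \<notin> range (\<lambda>z. chart q (z, 0))} \<union> {s. Slope p s = q}"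
    proof (rule subsetI, rule ccontr)
      fix s assume s: "s \<in> {s. Slope p s \<notin> range (\<lambda>z. chart (Slope q 0) (z, 0))}"
        "s \<notin> {s. Slope p s \<notin> range (\<lambda>z. chart q (z, 0))} \<union> {s. Slope p s = q}"
      then obtain z where z: "Slope p s = chart q (z, 0)" by auto
      then have "z \<noteq> 0" using s(2) by auto
      then have "chart (Slope q 0) (z, 0) = Slope p s" using z by simp
      with s(1) show False by (metis (no_types, lifting) mem_Collect_eq rangeI)
    qed
  qed (use Slope that fin in auto)
  ultimately show ?case by auto
next
  case (Vertical q)
  have fin: "finite {s. Slope p s = q}" by (cases q) auto
  have "{s. Slope q s \<notin> range (\<lambda>z. chart (Vertical q) (z, 0))} \<subseteq> {0}"
  proof (rule subsetI, rule ccontr)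
    fix s assume s: "s \<in> {s. Slope q s \<notin> range (\<lambda>z. chart (Vertical q) (z, 0))}" "s \<notin> {0}"
    then have "chart (Vertical q) (1 / s, 0) = Slope q s" by simp
    with s(1) show False by (metis (no_types, lifting) mem_Collect_eq rangeI)
  qed
  then have "finite {s. Slope q s \<notin> range (\<lambda>z. chart (Vertical q) (z, 0))}"
    by (rule finite_subset) simp
  moreover have "finite {s. Slope p s \<notin> range (\<lambda>z. chart (Vertical q) (0, z))}" if "ax1 q = Some p"
  proof (rule finite_subset)
    show "{s. Slope p s \<notin> range (\<lambda>z. chart (Vertical q) (0, z))} \<subseteq>
        {s. Slope p s \<notin> range (\<lambda>z. chart q (0, z))} \<union> {s. Slope p s = q}"
    proof (rule subsetI, rule ccontr)
      fix s assume s: "s \<in> {s. Slope p s \<notin> range (\<lambda>z. chart (Vertical q) (0, z))}"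
        "s \<notin> {s. Slope p s \<notin> range (\<lambda>z. chart q (0, z))} \<union> {s. Slope p s = q}"
      then obtain z where z: "Slope p s = chart q (0, z)" by auto
      then have "z \<noteq> 0" using s(2) by auto
      then have "chart (Vertical q) (0, z) = Slope p s" using z by simp
      with s(1) show False by (metis (no_types, lifting) mem_Collect_eq rangeI)
    qed
  qed (use Vertical that fin in auto)
  ultimately show ?case by auto
qed auto

lemma finite_off_axis1: "ax1 q = Some p \<Longrightarrow> finite {t. Slope p t \<notin> range (\<lambda>z. chart q (0, z))}"
  and finite_off_axis2: "ax2 q = Some p \<Longrightarrow> finite {t. Slope p t \<notin> range (\<lambda>z. chart q (z, 0))}"
  using finite_off_axis by blast+

section \<open>Iterated blow-ups\<close>

text \<open>The result of blowing up the centres \<open>B\<close>, described without their order.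
  Recording only the set of centres turns statements about iterated blow-ups into statements about
  predecessors.\<close>

definition surf :: "(complex \<times> complex) set \<Rightarrow> pt set \<Rightarrow> pt set" where
  "surf U B = {q. q \<notin> B \<and> panc q \<subseteq> B \<and> blow_down q \<in> U}"

definition blow_centres :: "(complex \<times> complex) set \<Rightarrow> pt set \<Rightarrow> bool" where
  "blow_centres U B \<longleftrightarrow> finite B \<and> (\<forall>b\<in>B. blow_down b \<in> U \<and> anc b \<subseteq> B)"

lemma surf_insert:
  assumes B: "blow_centres U B" and p: "p \<in> surf U B"
  shows "blow_centres U (insert p B)" "surf U (insert p B) = blow_up p (surf U B)"
proof -
  show "blow_centres U (insert p B)"
    using B p by (auto simp: blow_centres_def surf_def)
  have bu: "blow_up p (surf U B) = (surf U B - {p}) \<union> children p"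
    by (auto simp: blow_up_def children_def)
  have closed: "anc b \<subseteq> B" if "b \<in> B" for b using B that by (auto simp: blow_centres_def)
  have "q \<in> surf U (insert p B) \<longleftrightarrow> q \<in> (surf U B - {p}) \<union> children p" for q
  proof (cases "p \<in> panc q")
    case False
    then have "q \<notin> children p" by (auto simp: children_def)
    with False show ?thesis by (auto simp: surf_def)
  next
    case True
    have pB: "p \<notin> B" "panc p \<subseteq> B" "blow_down p \<in> U" using p by (auto simp: surf_def)
    from True have nq: "q \<notin> surf U B" using pB by (auto simp: surf_def)
    \<comment> \<open>The child of \<open>p\<close> through which \<open>q\<close> descends is no
      centre, because centres are closed under predecessors and \<open>p\<close> is not yet one. So
      a point of the new surface over \<open>p\<close> can only be that child.\<close>
    from True obtain c where c: "c \<in> children p" "c \<in> anc q" using anc_child_between by blast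
    have cB: "c \<notin> B" using closed[of c] pB child_anc[OF c(1)] anc_refl[of p] by blast
    have "c \<noteq> p" using c(1) child_not_anc by fastforce
    show ?thesis
    proof
      assume "q \<in> surf U (insert p B)"
      then have "c = q" using c cB \<open>c \<noteq> p\<close> by (auto simp: surf_def)
      with c show "q \<in> (surf U B - {p}) \<union> children p" by simp
    next
      assume "q \<in> (surf U B - {p}) \<union> children p"
      then have q: "q \<in> children p" using nq by simp
      have "q \<notin> B" using closed[of q] pB child_anc[OF q] anc_refl[of p] by blast
      moreover have "q \<noteq> p" using True by auto
      moreover have "panc q \<subseteq> insert p B" using child_anc[OF q] pB by auto
      ultimately show "q \<in> surf U (insert p B)"
        using child_blow_down[OF q] pB by (simp add: surf_def)
    qed
  qed
  then show "surf U (insert p B) = blow_up p (surf U B)" unfolding bu by blast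
qed

lemma surf_empty: "surf U {} = (\<lambda>(a, b). Proper a b) ` U"
proof -
  have "q \<in> surf U {} \<longleftrightarrow> q \<in> (\<lambda>(a, b). Proper a b) ` U" for q
  proof (cases q)
    case (Proper a b)
    then show ?thesis by (auto simp: surf_def)
  next
    case (Slope p t)
    have "anc p \<noteq> {}" by (metis anc_refl empty_iff)
    then show ?thesis using Slope by (auto simp: surf_def)
  next
    case (Vertical p)
    have "anc p \<noteq> {}" by (metis anc_refl empty_iff)
    then show ?thesis using Vertical by (auto simp: surf_def)
  qed
  then show ?thesis by blast
qed

lemma iterated_blow_up_surf:
  "iterated_blow_up U X \<Longrightarrow> \<exists>B. blow_centres U B \<and> X = surf U B"
proof (induction rule: iterated_blow_up.induct)
  case plane
  then show ?case by (intro exI[of _ "{}"]) (simp add: surf_empty blow_centres_def)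
next
  case (blow_up X p)
  then obtain B where "blow_centres U B" "X = surf U B" by blast
  with surf_insert[of U B p] blow_up show ?case by (intro exI[of _ "insert p B"]) auto
qed

lemma continuous_eval2: "continuous_on UNIV (eval2 f)"
proof (induction f)
  case 0
  then show ?case by (simp add: eval2_def)
next
  case (pCons c f)
  have "eval2 (pCons c f) = (\<lambda>w. poly c (fst w) + snd w * eval2 f w)" by (rule ext) (simp add: eval2_pCons)
  then show ?case by (simp, intro continuous_intros pCons.IH)
qed

text \<open>A coordinate that is nonzero at \<open>w\<close> stays nonzero nearby and can be divided
  by, which gives the transition map. Its continuity is what makes chart images open.\<close>

lemma chart_transition:
  "\<exists>\<phi>. \<phi> (0, 0) = w \<and> isCont \<phi> (0, 0) \<and>
     eventually (\<lambda>w'. chart (chart q w) w' = chart q (\<phi> w')) (nhds (0, 0))"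
proof (induction q arbitrary: w)
  case (Proper a b)
  obtain u v where w: "w = (u, v)" by fastforce
  show ?case
    by (intro exI[of _ "\<lambda>w'. (u + fst w', v + snd w')"]) (auto simp: w add.assoc intro!: continuous_intros always_eventually)
next
  case (Slope p t)
  obtain u v where w: "w = (u, v)" by fastforce
  show ?case
  proof (cases "u = 0")
    case True
    then show ?thesis
      by (intro exI[of _ "\<lambda>w'. (u + fst w', v + snd w')"])
        (auto simp: w add.assoc intro!: continuous_intros always_eventually)
  next
    case False
    from Slope[of "(u, u * (t + v))"] obtain \<phi> where \<phi>: "\<phi> (0, 0) = (u, u * (t + v))" "isCont \<phi> (0, 0)"
      "eventually (\<lambda>w'. chart (chart p (u, u * (t + v))) w' = chart p (\<phi> w')) (nhds (0, 0))" by blast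
    let ?\<psi> = "\<lambda>w'. (fst (\<phi> w'), snd (\<phi> w') / fst (\<phi> w') - t)"
    have "isCont (\<lambda>w'. fst (\<phi> w')) (0, 0)" by (intro continuous_intros \<phi>)
    then have "eventually (\<lambda>w'. fst (\<phi> w') \<noteq> 0) (nhds (0, 0))"
      using False \<phi>(1) continuous_at_avoid[of "(0,0)" "\<lambda>w'. fst (\<phi> w')" 0]
      by (auto simp: eventually_nhds_metric dist_commute)
    with \<phi>(3) have "eventually (\<lambda>w'. chart (chart (Slope p t) w) w' = chart (Slope p t) (?\<psi> w')) (nhds (0, 0))"
    proof eventually_elim
      case (elim w')
      then have "(fst (\<phi> w'), fst (\<phi> w') * (t + (snd (\<phi> w') / fst (\<phi> w') - t))) = \<phi> w'" by simp
      with elim False show ?case by (simp add: w)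
    qed
    moreover have "isCont ?\<psi> (0, 0)" using \<phi> False by (intro continuous_intros) auto
    moreover have "?\<psi> (0, 0) = w" using \<phi>(1) False by (simp add: w)
    ultimately show ?thesis by (intro exI[of _ ?\<psi>]) blast
  qed
next
  case (Vertical p)
  obtain u v where w: "w = (u, v)" by fastforce
  consider "v = 0" "u = 0" | "v = 0" "u \<noteq> 0" | "v \<noteq> 0" by blast
  then show ?case
  proof cases
    case 1
    then show ?thesis by (intro exI[of _ "\<lambda>w'. w'"]) (auto simp: w intro!: always_eventually)
  next
    case 2
    let ?\<psi> = "\<lambda>w'. (1 / (1 / u + snd w'), fst w' * (1 / u + snd w')) :: complex \<times> complex"
    have "isCont (\<lambda>w'::complex \<times> complex. 1 / u + snd w') (0, 0)" by (intro continuous_intros)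
    then have "eventually (\<lambda>w'::complex \<times> complex. 1 / u + snd w' \<noteq> 0) (nhds (0, 0))"
      using 2 continuous_at_avoid[of "(0,0)" "\<lambda>w'. 1 / u + snd w'" 0]
      by (auto simp: eventually_nhds_metric dist_commute)
    then have "eventually (\<lambda>w'. chart (chart (Vertical p) w) w' = chart (Vertical p) (?\<psi> w')) (nhds (0, 0))"
    proof eventually_elim
      case (elim w')
      obtain a b where w': "w' = (a, b)" by fastforce
      show ?case using elim 2 by (cases "a = 0") (simp_all add: w w')
    qed
    moreover have "isCont ?\<psi> (0, 0)" using 2 by (intro continuous_intros) auto
    ultimately show ?thesis using 2 by (intro exI[of _ ?\<psi>]) (simp add: w)
  next
    case 3
    from Vertical[of "(u * v, v)"] obtain \<phi> where \<phi>: "\<phi> (0, 0) = (u * v, v)" "isCont \<phi> (0, 0)"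
      "eventually (\<lambda>w'. chart (chart p (u * v, v)) w' = chart p (\<phi> w')) (nhds (0, 0))" by blast
    let ?\<psi> = "\<lambda>w'. (fst (\<phi> w') / snd (\<phi> w'), snd (\<phi> w'))"
    have "isCont (\<lambda>w'. snd (\<phi> w')) (0, 0)" by (intro continuous_intros \<phi>)
    then have "eventually (\<lambda>w'. snd (\<phi> w') \<noteq> 0) (nhds (0, 0))"
      using 3 \<phi>(1) continuous_at_avoid[of "(0,0)" "\<lambda>w'. snd (\<phi> w')" 0]
      by (auto simp: eventually_nhds_metric dist_commute)
    with \<phi>(3) have "eventually (\<lambda>w'. chart (chart (Vertical p) w) w' = chart (Vertical p) (?\<psi> w')) (nhds (0, 0))"
    proof eventually_elim
      case (elim w')
      then have "(fst (\<phi> w') / snd (\<phi> w') * snd (\<phi> w'), snd (\<phi> w')) = \<phi> w'" by simp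
      with elim 3 show ?case by (simp add: w)
    qed
    moreover have "isCont ?\<psi> (0, 0)" using \<phi> 3 by (intro continuous_intros) auto
    moreover have "?\<psi> (0, 0) = w" using \<phi>(1) 3 by (simp add: w)
    ultimately show ?thesis by (intro exI[of _ ?\<psi>]) blast
  qed
qed

locale blown_up_surface =
  fixes U :: "(complex \<times> complex) set" and B X :: "pt set"
  assumes U: "zariski_open_plane U" and B: "blow_centres U B" and X: "X = surf U B"
begin

lemma finite_B: "finite B" and anc_B: "b \<in> B \<Longrightarrow> anc b \<subseteq> B" and B_U: "b \<in> B \<Longrightarrow> blow_down b \<in> U"
  using B by (auto simp: blow_centres_def)

lemma X_iff: "q \<in> X \<longleftrightarrow> q \<notin> B \<and> panc q \<subseteq> B \<and> blow_down q \<in> U"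
  by (simp add: X surf_def)

text \<open>Near \<open>q\<close> the finitely many centres and the closed complement of
  \<open>U\<close> are avoided, and points of the chart at \<open>q\<close> have no proper
  predecessors other than those of \<open>q\<close>.\<close>

lemma eventually_chart_in_X:
  assumes "q \<in> X" shows "eventually (\<lambda>w. chart q w \<in> X) (nhds (0, 0))"
proof -
  have fin: "finite {w. chart q w \<in> B}"
    using finite_vimageI[OF finite_B, of "chart q"] chart_inj by (auto simp: inj_on_def vimage_def)
  have "(0, 0) \<notin> {w. chart q w \<in> B}" using assms by (simp add: X_iff)
  then have "eventually (\<lambda>w. w \<notin> {w. chart q w \<in> B}) (nhds (0, 0))"
    using open_Compl[OF finite_imp_closed[OF fin]] eventually_nhds_in_open by fastforce
  moreover have "eventually (\<lambda>w. blow_down (chart q w) \<in> U) (nhds (0, 0))"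
  proof -
    from U obtain P where P: "U = {w. \<exists>f\<in>P. eval2 f w \<noteq> 0}" by (auto simp: zariski_open_plane_def)
    with assms obtain f where f: "f \<in> P" "eval2 f (blow_down q) \<noteq> 0" by (auto simp: X_iff)
    have "open (eval2 (pullback q f) -` (- {0}))"
      by (rule open_vimage) (auto intro: continuous_eval2)
    moreover have "(0, 0) \<in> eval2 (pullback q f) -` (- {0})" using f by (simp add: eval2_pullback)
    ultimately have "eventually (\<lambda>w. w \<in> eval2 (pullback q f) -` (- {0})) (nhds (0, 0))"
      by (rule eventually_nhds_in_open)
    then show ?thesis by eventually_elim (use f in \<open>auto simp: P eval2_pullback\<close>)
  qed
  ultimately show ?thesis
  proof eventually_elim
    case (elim w)
    then show ?case using panc_chart[of q w] assms by (auto simp: X_iff)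
  qed
qed

lemma infinite_axis:
  assumes "q \<in> X"
  shows "infinite {z. chart q (0, z) \<in> X}" "infinite {z. chart q (z, 0) \<in> X}"
proof -
  from eventually_chart_in_X[OF assms] obtain e where e: "e > 0"
    "\<And>w. dist w (0, 0) < e \<Longrightarrow> chart q w \<in> X" by (auto simp: eventually_nhds_metric)
  have sub: "ball 0 e \<subseteq> {z. chart q (0, z) \<in> X}" "ball 0 e \<subseteq> {z. chart q (z, 0) \<in> X}"
    using e(2) by (auto simp: dist_Pair_Pair dist_norm)
  have "infinite (ball (0::complex) e)" using e(1) uncountable_ball countable_finite by blast
  with sub show "infinite {z. chart q (0, z) \<in> X}" "infinite {z. chart q (z, 0) \<in> X}"
    using finite_subset by blast+
qed

end

section \<open>Euler characteristics of punctured exceptional curves\<close>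

lemma eventually_isCont:
  "isCont f x \<Longrightarrow> eventually P (nhds (f x)) \<Longrightarrow> eventually (\<lambda>y. P (f y)) (nhds x)"
proof -
  assume "isCont f x" "eventually P (nhds (f x))"
  then have "filterlim f (nhds (f x)) (nhds x)" "eventually P (nhds (f x))"
    using tendsto_at_iff_tendsto_nhds[of f x] by (simp_all add: isCont_def)
  then show "eventually (\<lambda>y. P (f y)) (nhds x)" unfolding filterlim_iff by blast
qed

lemma open_iff_eventually: "open A \<longleftrightarrow> (\<forall>x\<in>A. eventually (\<lambda>y. y \<in> A) (nhds x))"
proof
  assume "\<forall>x\<in>A. eventually (\<lambda>y. y \<in> A) (nhds x)"
  then have "\<forall>x\<in>A. \<exists>T. open T \<and> x \<in> T \<and> T \<subseteq> A" unfolding eventually_nhds by (meson subsetI)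
  then show "open A" by (subst open_subopen)
qed (blast intro: eventually_nhds_in_open)

context blown_up_surface
begin

abbreviation etop :: "pt topology" where "etop \<equiv> euclidean_top X"

lemma topspace_etop [simp]: "topspace etop = X"
proof
  show "topspace etop \<subseteq> X" using openin_euclidean_top[of X "topspace etop"] by auto
  have "openin etop X" using eventually_chart_in_X by (auto simp: openin_euclidean_top)
  then show "X \<subseteq> topspace etop" by (rule openin_subset)
qed

lemma closedin_etop_singleton:
  assumes "q \<in> X" shows "closedin etop {q}"
proof -
  have "openin etop (X - {q})"
    unfolding openin_euclidean_top
  proof (intro conjI ballI)
    fix r assume r: "r \<in> X - {q}"
    have "finite {w. chart r w = q}"
      using finite_vimageI[of "{q}" "chart r"] chart_inj by (auto simp: inj_on_def vimage_def)
    then have "open (- {w. chart r w = q})" by (simp add: finite_imp_closed open_Compl)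
    moreover have "(0, 0) \<in> - {w. chart r w = q}" using r by simp
    ultimately have "eventually (\<lambda>w. w \<in> - {w. chart r w = q}) (nhds (0, 0))"
      by (rule eventually_nhds_in_open)
    with eventually_chart_in_X[of r] r show "eventually (\<lambda>w. chart r w \<in> X - {q}) (nhds (0, 0))"
      by (simp add: eventually_conj_iff)
  qed auto
  with assms show ?thesis by (simp add: closedin_def)
qed

lemma openin_etop_chart_image:
  assumes "open A" shows "openin etop (chart q ` A \<inter> X)"
  unfolding openin_euclidean_top
proof (intro conjI ballI)
  fix r assume r: "r \<in> chart q ` A \<inter> X"
  then obtain w where w: "w \<in> A" "r = chart q w" by blast
  from chart_transition[of w q] obtain \<phi> where \<phi>: "\<phi> (0, 0) = w" "isCont \<phi> (0, 0)"
    "eventually (\<lambda>w'. chart (chart q w) w' = chart q (\<phi> w')) (nhds (0, 0))" by blast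
  have "eventually (\<lambda>y. y \<in> A) (nhds (\<phi> (0, 0)))"
    using assms w(1) \<phi>(1) by (intro eventually_nhds_in_open) auto
  from eventually_isCont[OF \<phi>(2) this] have "eventually (\<lambda>w'. \<phi> w' \<in> A) (nhds (0, 0))" .
  moreover have "eventually (\<lambda>w. chart r w \<in> X) (nhds (0, 0))" using eventually_chart_in_X r by simp
  ultimately show "eventually (\<lambda>w'. chart r w' \<in> chart q ` A \<inter> X) (nhds (0, 0))"
    using \<phi>(3) by eventually_elim (simp add: w(2))
qed auto

end

text \<open>A projective line with finitely many points removed. By \<open>sub\<close> the removed
  points include all later centres on it, so the rest survives in \<open>X\<close>.\<close>

locale punctured_curve = blown_up_surface +
  fixes p :: pt and F :: "pt set"
  assumes p: "p \<in> B" and F: "finite F" "F \<subseteq> children p" and sub: "children p - F \<subseteq> X"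
begin

abbreviation "C \<equiv> children p - F"
abbreviation "M \<equiv> subtopology etop C"
abbreviation "vert \<equiv> \<lambda>z. chart (Vertical p) (z, 0)"

lemma topspace_M [simp]: "topspace M = C"
  using sub by auto

lemma inj_vert: "inj vert"
  by (auto simp: inj_on_def dest: chart_inj)

lemma vert_in_children: "vert z \<in> children p"
  by simp

lemma eventually_not_F:
  fixes f :: "complex \<Rightarrow> pt"
  assumes "inj f" "f z \<notin> F" shows "eventually (\<lambda>z. f z \<notin> F) (nhds z)"
proof -
  have "finite (f -` F)" using F(1) assms(1) by (rule finite_vimageI)
  then have "open (- (f -` F))" by (simp add: finite_imp_closed open_Compl)
  moreover have "z \<in> - (f -` F)" using assms(2) by simp
  ultimately have "eventually (\<lambda>z. z \<in> - (f -` F)) (nhds z)" by (rule eventually_nhds_in_open)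
  then show ?thesis by simp
qed

lemma eventually_inverse:
  fixes z :: complex
  assumes "eventually P (nhds (1 / z))" "z \<noteq> 0"
  shows "eventually (\<lambda>x. P (1 / x)) (nhds z)"
proof -
  have "isCont (\<lambda>x. 1 / x) z" using assms(2) by (intro continuous_intros) auto
  from eventually_isCont[OF this assms(1)] show ?thesis .
qed

lemma eventually_nonzero: "(z::complex) \<noteq> 0 \<Longrightarrow> eventually (\<lambda>x. x \<noteq> 0) (nhds z)"
  using eventually_nhds_in_open[of "- {0}" z] by (simp add: open_Compl)

text \<open>The ambient charts induce on the line the two coordinates t and 1/t of the Riemann
  sphere. From here on the ambient surface can be forgotten.\<close>

lemma openin_M_iff:
  assumes "V \<subseteq> C"
  shows "openin M V \<longleftrightarrow> (\<forall>t. Slope p t \<in> V \<longrightarrow> eventually (\<lambda>z. Slope p z \<in> V) (nhds t)) \<and>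
    (Vertical p \<in> V \<longrightarrow> eventually (\<lambda>z. vert z \<in> V) (nhds 0))" (is "_ \<longleftrightarrow> ?S \<and> ?V")
proof
  assume "openin M V"
  then obtain W where W: "openin etop W" "V = W \<inter> C" by (auto simp: openin_subtopology)
  show "?S \<and> ?V"
  proof (intro conjI allI impI)
    fix t assume t: "Slope p t \<in> V"
    then have "eventually (\<lambda>w. chart (Slope p t) w \<in> W) (nhds (0, 0))"
      using W by (auto simp: openin_euclidean_top)
    then have "eventually (\<lambda>w. chart (Slope p t) w \<in> W) (nhds ((\<lambda>z. (0, z - t)) t))" by simp
    then have "eventually (\<lambda>z. chart (Slope p t) (0, z - t) \<in> W) (nhds t)"
      by (intro eventually_isCont[where f = "\<lambda>z. (0, z - t)" and x = t] continuous_intros)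
    moreover have "eventually (\<lambda>z. Slope p z \<notin> F) (nhds t)"
      by (rule eventually_not_F) (use t W in \<open>auto simp: inj_on_def\<close>)
    ultimately show "eventually (\<lambda>z. Slope p z \<in> V) (nhds t)"
      by eventually_elim (simp add: W)
  next
    assume t: "Vertical p \<in> V"
    then have "eventually (\<lambda>w. chart (Vertical p) w \<in> W) (nhds (0, 0))"
      using W by (auto simp: openin_euclidean_top)
    then have "eventually (\<lambda>w. chart (Vertical p) w \<in> W) (nhds ((\<lambda>z. (z, 0)) 0))" by simp
    then have "eventually (\<lambda>z. vert z \<in> W) (nhds 0)"
      by (intro eventually_isCont[where f = "\<lambda>z. (z, 0)" and x = 0] continuous_intros)
    moreover have "eventually (\<lambda>z. vert z \<notin> F) (nhds 0)"
      by (rule eventually_not_F[OF inj_vert]) (use t W in auto)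
    ultimately show "eventually (\<lambda>z. vert z \<in> V) (nhds 0)"
      by eventually_elim (use vert_in_children W in blast)
  qed
next
  assume *: "?S \<and> ?V"
  let ?A = "{z. Slope p z \<in> V}" and ?A' = "{z. vert z \<in> V}"
  have A: "open ?A" using * by (simp add: open_iff_eventually)
  have "eventually (\<lambda>z. vert z \<in> V) (nhds z)" if z: "vert z \<in> V" for z
  proof (cases "z = 0")
    case False
    with z * have "eventually (\<lambda>z. Slope p z \<in> V) (nhds (1 / z))" by simp
    then have "eventually (\<lambda>x. Slope p (1 / x) \<in> V) (nhds z)" using False by (rule eventually_inverse)
    with eventually_nonzero[OF False] show ?thesis by eventually_elim simp
  qed (use * z in simp)
  then have A': "open ?A'" by (simp only: open_iff_eventually mem_Collect_eq) blast
  \<comment> \<open>Both pieces are thickened by the whole second coordinate of an ambient chart.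
    Off its axis such a chart leaves the exceptional curve, so intersecting with \<open>C\<close>
    returns \<open>V\<close>.\<close>
  let ?W = "(chart (Slope p 0) ` (UNIV \<times> ?A) \<inter> X) \<union> (chart (Vertical p) ` (?A' \<times> UNIV) \<inter> X)"
  have "openin etop ?W"
    by (intro openin_Un openin_etop_chart_image open_Times A A' open_UNIV)
  moreover have "?W \<inter> C = V"
  proof
    show "?W \<inter> C \<subseteq> V"
    proof
      fix x assume x: "x \<in> ?W \<inter> C"
      then consider u z where "Slope p z \<in> V" "x = chart (Slope p 0) (u, z)"
        | z v where "vert z \<in> V" "x = chart (Vertical p) (z, v)" by auto
      then show "x \<in> V"
      proof cases
        case 1
        have "u = 0"
        proof (rule ccontr)
          assume "u \<noteq> 0"
          with 1 have "x = chart p (u, u * z)" by simp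
          moreover have "x \<in> exc p" using x children_subset_exc by blast
          ultimately show False by simp
        qed
        with 1 show ?thesis by simp
      next
        case 2
        have "v = 0"
        proof (rule ccontr)
          assume "v \<noteq> 0"
          with 2 have "x = chart p (z * v, v)" by simp
          moreover have "x \<in> exc p" using x children_subset_exc by blast
          ultimately show False by simp
        qed
        with 2 show ?thesis by simp
      qed
    qed
    show "V \<subseteq> ?W \<inter> C"
    proof
      fix x assume x: "x \<in> V"
      then have xC: "x \<in> C" "x \<in> X" using assms sub by auto
      then consider t where "x = Slope p t" | "x = Vertical p" by (auto simp: children_def)
      then show "x \<in> ?W \<inter> C"
      proof cases
        case 1
        then have "x = chart (Slope p 0) (0, t)" by simp
        with x xC 1 show ?thesis by blast
      next
        case 2
        then have "x = chart (Vertical p) (0, 0)" by simp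
        with x xC 2 show ?thesis by (intro IntI UnI2 rev_image_eqI[of "(0, 0)"]) auto
      qed
    qed
  qed
  ultimately show "openin M V" unfolding openin_subtopology by blast
qed

lemma homeomorphic_map_open_image:
  fixes f :: "complex \<Rightarrow> pt"
  assumes A: "open A" and inj: "inj f" and fA: "f ` A \<subseteq> C"
    and op: "\<And>Q. open Q \<Longrightarrow> Q \<subseteq> A \<Longrightarrow> openin M (f ` Q)"
    and cont: "\<And>V. openin M V \<Longrightarrow> open {z. f z \<in> V}"
  shows "homeomorphic_map (top_of_set A) (subtopology M (f ` A)) f"
proof (rule bijective_open_imp_homeomorphic_map)
  have top: "topspace (subtopology M (f ` A)) = f ` A" using fA sub by auto
  show "continuous_map (top_of_set A) (subtopology M (f ` A)) f"
    unfolding continuous_map_def top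
  proof (intro conjI allI impI)
    show "f \<in> topspace (top_of_set A) \<rightarrow> f ` A" by auto
    fix V assume "openin (subtopology M (f ` A)) V"
    then obtain W where W: "openin M W" "V = W \<inter> f ` A" by (auto simp only: openin_subtopology)
    have "{x \<in> topspace (top_of_set A). f x \<in> V} = A \<inter> {z. f z \<in> W}" using W by auto
    with cont[OF W(1)] show "openin (top_of_set A) {x \<in> topspace (top_of_set A). f x \<in> V}"
      by (simp add: openin_open_Int)
  qed
  show "open_map (top_of_set A) (subtopology M (f ` A)) f"
    unfolding open_map_def
  proof (intro allI impI)
    fix Q assume "openin (top_of_set A) Q"
    then have "open Q" "Q \<subseteq> A" using A by (simp_all add: openin_open_eq)
    with op have "openin M (f ` Q)" by blast
    moreover have "f ` Q = f ` Q \<inter> f ` A" using \<open>Q \<subseteq> A\<close> by blast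
    ultimately show "openin (subtopology M (f ` A)) (f ` Q)" by (subst openin_subtopology) blast
  qed
qed (use fA inj sub in \<open>auto simp: inj_on_def\<close>)

lemma open_slope_preimage: "openin M V \<Longrightarrow> open {z. Slope p z \<in> V}"
  using openin_M_iff[of V] openin_subset[of M V] by (simp add: open_iff_eventually)

lemma open_vert_preimage:
  assumes "openin M V" shows "open {z. vert z \<in> V}"
  unfolding open_iff_eventually
proof
  have V: "V \<subseteq> C" using openin_subset[OF assms] by simp
  fix z assume z: "z \<in> {z. vert z \<in> V}"
  have "eventually (\<lambda>z. vert z \<in> V) (nhds z)"
  proof (cases "z = 0")
    case False
    then have "vert z = Slope p (1 / z)" by simp
    with z have "eventually (\<lambda>z. Slope p z \<in> V) (nhds (1 / z))" using assms openin_M_iff[OF V] by simp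
    then have "eventually (\<lambda>x. Slope p (1 / x) \<in> V) (nhds z)" using False by (rule eventually_inverse)
    with eventually_nonzero[OF False] show ?thesis by eventually_elim simp
  qed (use assms z openin_M_iff[OF V] in simp)
  then show "eventually (\<lambda>z. z \<in> {z. vert z \<in> V}) (nhds z)" by simp
qed

lemma openin_M_slope_image:
  assumes "open Q" "Slope p ` Q \<subseteq> C" shows "openin M (Slope p ` Q)"
  unfolding openin_M_iff[OF assms(2)]
proof (intro conjI allI impI)
  fix t assume "Slope p t \<in> Slope p ` Q"
  then have "t \<in> Q" by auto
  with assms(1) have "eventually (\<lambda>z. z \<in> Q) (nhds t)" by (rule eventually_nhds_in_open)
  then show "eventually (\<lambda>z. Slope p z \<in> Slope p ` Q) (nhds t)" by eventually_elim simp
qed auto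

lemma openin_M_vert_image:
  assumes "open Q" "vert ` Q \<subseteq> C" shows "openin M (vert ` Q)"
  unfolding openin_M_iff[OF assms(2)]
proof (intro conjI allI impI)
  fix t assume t: "Slope p t \<in> vert ` Q"
  then obtain z where z: "z \<in> Q" "vert z = Slope p t" by auto
  then have "z \<noteq> 0" by auto
  with z have t: "t = 1 / z" "t \<noteq> 0" by auto
  have "eventually (\<lambda>z. z \<in> Q) (nhds (1 / t))" using assms(1) z t by (intro eventually_nhds_in_open) auto
  then have "eventually (\<lambda>x. 1 / x \<in> Q) (nhds t)" using t(2) by (rule eventually_inverse)
  with eventually_nonzero[OF t(2)] show "eventually (\<lambda>z. Slope p z \<in> vert ` Q) (nhds t)"
  proof eventually_elim
    case (elim x)
    then have "Slope p x = vert (1 / x)" by simp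
    with elim show ?case by blast
  qed
next
  assume "Vertical p \<in> vert ` Q"
  then obtain z where z: "z \<in> Q" "vert z = Vertical p" by auto
  then have "z = 0" by (auto split: if_splits)
  with assms(1) z have "eventually (\<lambda>z. z \<in> Q) (nhds 0)" by (intro eventually_nhds_in_open) auto
  then show "eventually (\<lambda>z. vert z \<in> vert ` Q) (nhds 0)" by eventually_elim blast
qed

lemma has_euler_affine:
  assumes "Vertical p \<in> F" "has_euler (top_of_set (- {t. Slope p t \<in> F})) e"
  shows "has_euler M e"
proof -
  let ?A = "- {t. Slope p t \<in> F}"
  have "finite {t. Slope p t \<in> F}"
    using finite_vimageI[OF F(1), of "Slope p"] by (auto simp: inj_on_def vimage_def)
  then have A: "open ?A" by (simp add: finite_imp_closed open_Compl)
  have im: "Slope p ` ?A = C" using assms(1) by (auto simp: children_def)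
  have "homeomorphic_map (top_of_set ?A) (subtopology M (Slope p ` ?A)) (Slope p)"
  proof (rule homeomorphic_map_open_image[OF A])
    show "openin M (Slope p ` Q)" if "open Q" "Q \<subseteq> ?A" for Q
      by (rule openin_M_slope_image) (use that im in blast)+
  qed (use open_slope_preimage im in \<open>auto simp: inj_on_def\<close>)
  then have "homeomorphic_map (top_of_set ?A) M (Slope p)" unfolding im by (simp add: subtopology_subtopology)
  then have "top_of_set ?A homeomorphic_space M" by (rule homeomorphic_map_imp_homeomorphic_space)
  then have "M homotopy_equivalent_space top_of_set ?A"
    by (metis homeomorphic_imp_homotopy_equivalent_space homotopy_equivalent_space_sym)
  from has_euler_homotopy[OF this assms(2)] show ?thesis .
qed

lemma has_euler_rel_vertical:
  assumes "Vertical p \<notin> F" shows "has_euler_rel M (topspace M - {Vertical p}) 1"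
proof -
  have "eventually (\<lambda>z. vert z \<notin> F) (nhds 0)"
    by (rule eventually_not_F[OF inj_vert]) (use assms in auto)
  then obtain r where r: "r > 0" "\<And>z. z \<in> ball 0 r \<Longrightarrow> vert z \<notin> F"
    by (auto simp: eventually_nhds_metric dist_commute)
  have im: "vert ` ball 0 r \<subseteq> C" using r(2) vert_in_children by blast
  show ?thesis
  proof (rule has_euler_rel_puncture[of M "Vertical p" vert r])
    have "Vertical p \<in> C" using assms by simp
    then have "closedin etop {Vertical p}" using sub by (intro closedin_etop_singleton) auto
    then show "closedin M {Vertical p}" using \<open>Vertical p \<in> C\<close> sub
      by (auto simp: closedin_subtopology intro!: exI[of _ "{Vertical p}"])
    show "openin M (vert ` ball 0 r)" by (rule openin_M_vert_image[OF open_ball im])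
    show "homeomorphic_map (top_of_set (ball 0 r)) (subtopology M (vert ` ball 0 r)) vert"
    proof (rule homeomorphic_map_open_image[OF open_ball inj_vert im])
      show "openin M (vert ` Q)" if "open Q" "Q \<subseteq> ball 0 r" for Q
        by (rule openin_M_vert_image) (use that im in blast)+
    qed (rule open_vert_preimage)
  qed (use r in auto)
qed

end

lemma has_euler_rel_plane:
  assumes "finite (T :: complex set)" "t \<notin> T"
  shows "has_euler_rel (top_of_set (- T)) (topspace (top_of_set (- T)) - {t}) 1"
proof -
  have op: "open (- T)" using assms(1) by (simp add: finite_imp_closed open_Compl)
  moreover have "t \<in> - T" using assms(2) by simp
  ultimately obtain r where r: "r > 0" "ball t r \<subseteq> - T" by (meson open_contains_ball)
  let ?f = "\<lambda>z. t + z"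
  have im: "?f ` ball 0 r = ball t r" by (simp add: image_add_ball)
  show ?thesis
  proof (rule has_euler_rel_puncture[of _ t ?f r])
    show "closedin (top_of_set (- T)) {t}" using assms(2)
      by (intro closed_subset) auto
    show "openin (top_of_set (- T)) (?f ` ball 0 r)" unfolding im using r op
      by (simp add: openin_open_eq)
    have eq: "subtopology (top_of_set (- T)) (?f ` ball 0 r) = top_of_set (ball t r)"
      unfolding im using r by (simp add: subtopology_subtopology Int_absorb1)
    have "homeomorphic_maps (top_of_set (ball 0 r)) (top_of_set (ball t r)) ?f (\<lambda>z. z - t)"
      unfolding homeomorphic_maps_def by (auto simp: continuous_map_in_subtopology dist_norm intro!: continuous_intros)
    then show "homeomorphic_map (top_of_set (ball 0 r)) (subtopology (top_of_set (- T)) (?f ` ball 0 r)) ?f"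
      unfolding eq homeomorphic_map_maps by blast
  qed (use r in auto)
qed

text \<open>The plane is contractible, and each puncture lowers \<chi> by 1.\<close>

lemma has_euler_plane_minus_finite:
  assumes "finite (T :: complex set)" shows "has_euler (top_of_set (- T)) (1 - int (card T))"
  using assms
proof (induction T rule: finite_induct)
  case empty
  have "contractible_space (top_of_set (UNIV :: complex set))"
    by (metis contractible_space_top_of_set convex_imp_contractible convex_UNIV)
  then show ?case using has_euler_contractible[of "top_of_set (UNIV :: complex set)"] by simp
next
  case (insert t T)
  have "subtopology (top_of_set (- T)) (topspace (top_of_set (- T)) - {t}) = top_of_set (- insert t T)"
    by (simp add: subtopology_subtopology Int_absorb1 Diff_subset) (metis Compl_insert)
  with has_euler_sub[OF has_euler_rel_plane[OF insert(1,2)] insert.IH] insert show ?case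
    by (simp add: algebra_simps)
qed

context punctured_curve
begin

text \<open>If the point at infinity is present, it is removed as well and its relative contribution
  1 is added back. What remains is a punctured plane.\<close>

lemma has_euler_curve: "has_euler M (2 - int (card F))"
proof -
  have aff: "has_euler (subtopology etop (children p - F')) (2 - int (card F'))"
    if F': "finite F'" "F' \<subseteq> children p" "F \<subseteq> F'" "Vertical p \<in> F'" for F'
  proof -
    interpret A: punctured_curve U B X p F'
      by unfold_locales (use p that sub in auto)
    let ?T = "{t. Slope p t \<in> F'}"
    have fin: "finite ?T"
      using finite_vimageI[OF F'(1), of "Slope p"] by (auto simp: inj_on_def vimage_def)
    have "F' = insert (Vertical p) (Slope p ` ?T)" using F' by (auto simp: children_def)
    then have "card F' = Suc (card ?T)"
      using fin by (metis (no_types, lifting) card_image card_insert_disjoint finite_imageI image_iff inj_onI pt.distinct(5) pt.inject(2))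
    with A.has_euler_affine[OF F'(4) has_euler_plane_minus_finite[OF fin]] show ?thesis by simp
  qed
  show ?thesis
  proof (cases "Vertical p \<in> F")
    case True
    then show ?thesis using aff[of F] F by simp
  next
    case False
    have "C \<inter> (topspace M - {Vertical p}) = children p - insert (Vertical p) F"
      unfolding topspace_M by blast
    then have "subtopology M (topspace M - {Vertical p}) = subtopology etop (children p - insert (Vertical p) F)"
      by (simp only: subtopology_subtopology)
    moreover have "has_euler (subtopology etop (children p - insert (Vertical p) F)) (2 - int (card (insert (Vertical p) F)))"
      by (rule aff) (use F in auto)
    ultimately have "has_euler M (2 - int (card (insert (Vertical p) F)) + 1)"
      
      by (metis has_euler_total[OF has_euler_rel_vertical[OF False]])
    then show ?thesis using False F by simp
  qed
qed

end

section \<open>Strict transforms\<close>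

text \<open>Dividing by the full multiplicity at each step leaves no exceptional axis as a factor,
  which is what distinguishes the strict from the total transform.\<close>

primrec strict :: "pt \<Rightarrow> complex poly poly \<Rightarrow> complex poly poly" where
  "strict (Proper a b) F = pullback (Proper a b) F"
| "strict (Slope p t) F = shift_y t (blow_x (strict p F) div varx ^ ord2 (strict p F))"
| "strict (Vertical p) F = blow_y (strict p F) div vary ^ ord2 (strict p F)"

lemma strict_nonzero: "F \<noteq> 0 \<Longrightarrow> strict q F \<noteq> 0"
proof (induction q)
  case (Proper a b)
  then show ?case by (simp only: strict.simps pullback_eq_0_iff not_False_eq_True)
next
  case (Slope p t)
  then have 0: "strict p F \<noteq> 0" by simp
  then have "varx ^ ord2 (strict p F) dvd blow_x (strict p F)" by (simp add: varx_dvd_blow_x ord2)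
  then have "blow_x (strict p F) div varx ^ ord2 (strict p F) \<noteq> 0"
    using 0 by (metis blow_x_eq_0_iff dvd_mult_div_cancel mult_zero_right)
  then show ?case by simp
next
  case (Vertical p)
  then have 0: "strict p F \<noteq> 0" by simp
  then have "vary ^ ord2 (strict p F) dvd blow_y (strict p F)" by (simp add: vary_dvd_blow_y ord2)
  then have "blow_y (strict p F) div vary ^ ord2 (strict p F) \<noteq> 0"
    using 0 by (metis blow_y_eq_0_iff dvd_mult_div_cancel mult_zero_right)
  then show ?case by simp
qed

lemma strict_blow_x:
  "F \<noteq> 0 \<Longrightarrow> varx ^ ord2 (strict p F) * (blow_x (strict p F) div varx ^ ord2 (strict p F)) = blow_x (strict p F)"
  using strict_nonzero[of F p] by (intro dvd_mult_div_cancel) (simp add: varx_dvd_blow_x ord2)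

lemma strict_blow_y:
  "F \<noteq> 0 \<Longrightarrow> vary ^ ord2 (strict p F) * (blow_y (strict p F) div vary ^ ord2 (strict p F)) = blow_y (strict p F)"
  using strict_nonzero[of F p] by (intro dvd_mult_div_cancel) (simp add: vary_dvd_blow_y ord2)

lemma continuous_zero_extend:
  fixes f :: "complex \<Rightarrow> complex"
  assumes "isCont f 0" "\<And>y. y \<noteq> 0 \<Longrightarrow> f y = 0" shows "f 0 = 0"
proof -
  have "(f \<longlongrightarrow> f 0) (at 0)" using assms(1) by (simp add: isCont_def)
  moreover have "(f \<longlongrightarrow> 0) (at 0)"
    by (rule tendsto_eventually) (auto simp: eventually_at_filter assms(2))
  ultimately show ?thesis using tendsto_unique by (metis trivial_limit_at)
qed

lemma isCont_eval2: "isCont f x \<Longrightarrow> isCont (\<lambda>x. eval2 F (f x)) x"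
proof -
  assume f: "isCont f x"
  have "isCont (eval2 F) (f x)"
    using continuous_eval2[of F] continuous_on_eq_continuous_at[OF open_UNIV] by blast
  with f show ?thesis by (rule isCont_o2)
qed

text \<open>Where the two charts of a blow-up overlap, \<open>(u v)\<^sup>m Hx (u v, 1 / u) = v\<^sup>m Hy (u, v)\<close> for the
  strict transforms \<open>Hx\<close> and \<open>Hy\<close> of a curve of multiplicity \<open>m\<close>; cancel \<open>v\<^sup>m\<close> and let \<open>v\<close> tend to 0.\<close>

lemma strict_overlap:
  assumes Hx: "varx ^ m * Hx = blow_x F" and Hy: "vary ^ m * Hy = blow_y F" and u: "u \<noteq> 0"
  shows "eval2 Hy (u, 0) = u ^ m * eval2 Hx (0, 1 / u)"
proof -
  let ?f = "\<lambda>y. eval2 Hy (u, y) - u ^ m * eval2 Hx (u * y, 1 / u)"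
  have "?f y = 0" if y: "y \<noteq> 0" for y
  proof -
    have "y ^ m * eval2 Hy (u, y) = eval2 F (u * y, y)"
      using arg_cong[OF Hy, of "\<lambda>h. eval2 h (u, y)"] by (simp add: eval2_subst2)
    moreover have "(u * y) ^ m * eval2 Hx (u * y, 1 / u) = eval2 F (u * y, y)"
      using arg_cong[OF Hx, of "\<lambda>h. eval2 h (u * y, 1 / u)"] u by (simp add: eval2_subst2)
    ultimately have "y ^ m * eval2 Hy (u, y) = (u * y) ^ m * eval2 Hx (u * y, 1 / u)" by (rule trans[OF _ sym])
    also have "\<dots> = y ^ m * (u ^ m * eval2 Hx (u * y, 1 / u))" by (simp add: power_mult_distrib)
    finally show ?thesis using y by (metis mult_cancel_left power_not_zero right_minus_eq)
  qed
  moreover have "isCont ?f 0" by (intro continuous_intros isCont_eval2)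
  ultimately have "?f 0 = 0" by (intro continuous_zero_extend[of ?f])
  then show ?thesis by simp
qed

text \<open>The local strict transforms agree on zeros where charts overlap, so they define one
  curve on the surface. Off the new exceptional curve only a nonzero power was divided out; on it
  the overlap formula compares the two charts.\<close>

lemma strict_chart:
  assumes F: "F \<noteq> 0"
  shows "eval2 (strict q F) w = 0 \<longleftrightarrow> eval2 (strict (chart q w) F) (0, 0) = 0"
proof (induction q arbitrary: w)
  case (Proper a b)
  show ?case by (cases w) (simp add: eval2_subst2)
next
  case (Slope p t)
  obtain u v where w: "w = (u, v)" by fastforce
  let ?H = "blow_x (strict p F) div varx ^ ord2 (strict p F)"
  show ?case
  proof (cases "u = 0")
    case True
    then show ?thesis by (simp add: w eval2_subst2)
  next
    case False
    have "u ^ ord2 (strict p F) * eval2 ?H (u, t + v) = eval2 (strict p F) (u, u * (t + v))"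
      using arg_cong[OF strict_blow_x[OF F, of p], of "\<lambda>h. eval2 h (u, t + v)"] by (simp add: eval2_subst2)
    with False have "eval2 ?H (u, t + v) = 0 \<longleftrightarrow> eval2 (strict p F) (u, u * (t + v)) = 0" by auto
    with False Slope.IH[of "(u, u * (t + v))"] show ?thesis by (simp add: w eval2_subst2)
  qed
next
  case (Vertical p)
  obtain u v where w: "w = (u, v)" by fastforce
  let ?H = "blow_y (strict p F) div vary ^ ord2 (strict p F)"
  consider "v = 0" "u = 0" | "v = 0" "u \<noteq> 0" | "v \<noteq> 0" by blast
  then show ?case
  proof cases
    case 1
    then show ?thesis by (simp add: w)
  next
    case 2
    with strict_overlap[OF strict_blow_x[OF F, of p] strict_blow_y[OF F, of p], of u] show ?thesis
      by (simp add: w eval2_subst2)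
  next
    case 3
    have "v ^ ord2 (strict p F) * eval2 ?H (u, v) = eval2 (strict p F) (u * v, v)"
      using arg_cong[OF strict_blow_y[OF F, of p], of "\<lambda>h. eval2 h (u, v)"] by (simp add: eval2_subst2)
    with 3 have "eval2 ?H (u, v) = 0 \<longleftrightarrow> eval2 (strict p F) (u * v, v) = 0" by auto
    with 3 Vertical.IH[of "(u * v, v)"] show ?thesis by (simp add: w)
  qed
qed

lemma shift_y_0 [simp]: "shift_y 0 f = f"
proof -
  have "const2 0 + vary = vary" by (simp add: const2_def)
  then show ?thesis by (simp only: subst2_id)
qed

text \<open>A further factor of the new axis would contradict the maximality of \<open>ord2\<close>;
  divisibility by an old axis would descend to the centre.\<close>

lemma strict_not_dvd:
  assumes F: "F \<noteq> 0"
  shows "(ax1 q \<noteq> None \<longrightarrow> \<not> varx dvd strict q F) \<and> (ax2 q \<noteq> None \<longrightarrow> \<not> vary dvd strict q F)"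
proof (induction q)
  case (Slope p t)
  let ?o = "ord2 (strict p F)"
  let ?H = "blow_x (strict p F) div varx ^ ?o"
  have H: "varx ^ ?o * ?H = blow_x (strict p F)" by (rule strict_blow_x[OF F])
  have "\<not> varx dvd ?H"
  proof
    assume "varx dvd ?H"
    then have "varx ^ ?o * varx dvd varx ^ ?o * ?H" by (rule mult_dvd_mono[OF dvd_refl])
    then have "varx ^ Suc ?o dvd blow_x (strict p F)" unfolding H by (simp add: mult.commute)
    with ord2(2)[OF strict_nonzero[OF F, of p]] show False by (simp only: varx_dvd_blow_x)
  qed
  then have 1: "\<not> varx dvd strict (Slope p t) F" using varx_dvd_shift_y[where k = 1 and f = ?H and t = t] by simp
  have 2: "\<not> vary dvd strict (Slope p t) F" if "t = 0" "ax2 p \<noteq> None"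
  proof
    assume "vary dvd strict (Slope p t) F"
    then have "vary dvd ?H" using that by simp
    then have "vary dvd varx ^ ?o * ?H" by (rule dvd_mult)
    then have "vary dvd blow_x (strict p F)" unfolding H .
    with vary_dvd_blow_x[of 1 "strict p F"] Slope that show False by simp
  qed
  show ?case using 1 2 by (metis ax2.simps(2))
next
  case (Vertical p)
  let ?o = "ord2 (strict p F)"
  let ?H = "blow_y (strict p F) div vary ^ ?o"
  have H: "vary ^ ?o * ?H = blow_y (strict p F)" by (rule strict_blow_y[OF F])
  have 1: "\<not> vary dvd ?H"
  proof
    assume "vary dvd ?H"
    then have "vary ^ ?o * vary dvd vary ^ ?o * ?H" by (rule mult_dvd_mono[OF dvd_refl])
    then have "vary ^ Suc ?o dvd blow_y (strict p F)" unfolding H by (simp add: mult.commute)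
    with ord2(2)[OF strict_nonzero[OF F, of p]] show False by (simp only: vary_dvd_blow_y)
  qed
  have 2: "\<not> varx dvd ?H" if "ax1 p \<noteq> None"
  proof
    assume "varx dvd ?H"
    then have "varx dvd vary ^ ?o * ?H" by (rule dvd_mult)
    then have "varx dvd blow_y (strict p F)" unfolding H .
    with varx_dvd_blow_y[of 1 "strict p F"] Vertical that show False by simp
  qed
  show ?case using 1 2 by simp
qed simp

lemma strict_dvd_pullback:
  assumes F: "F \<noteq> 0" shows "strict q F dvd pullback q F"
proof (induction q)
  case (Slope p t)
  have "blow_x (strict p F) div varx ^ ord2 (strict p F) dvd blow_x (strict p F)"
    using strict_blow_x[OF F, of p] by (metis dvd_triv_right)
  also have "\<dots> dvd blow_x (pullback p F)" using Slope by (rule subst2_dvd)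
  finally show ?case unfolding pullback_Slope strict.simps by (rule subst2_dvd)
next
  case (Vertical p)
  have "blow_y (strict p F) div vary ^ ord2 (strict p F) dvd blow_y (strict p F)"
    using strict_blow_y[OF F, of p] by (metis dvd_triv_right)
  also have "\<dots> dvd blow_y (pullback p F)" using Vertical by (rule subst2_dvd)
  finally show ?case by simp
qed simp

section \<open>Irreducible components of the total transform\<close>

lemma irreducible_closed_subset:
  assumes "irreducible_closed T C" "closedin T A" "closedin T B" "C \<subseteq> A \<union> B"
  shows "C \<subseteq> A \<or> C \<subseteq> B"
proof -
  have C: "closedin T C" using assms(1) by (simp add: irreducible_closed_def)
  have "closedin T (C \<inter> A)" "closedin T (C \<inter> B)" "C = (C \<inter> A) \<union> (C \<inter> B)"
    using C assms by (auto intro: closedin_Int)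
  then have "C = C \<inter> A \<or> C = C \<inter> B" using assms(1) unfolding irreducible_closed_def by meson
  then show ?thesis by blast
qed

lemma irreducible_closed_Union:
  assumes "irreducible_closed T C" "finite \<F>" "\<And>A. A \<in> \<F> \<Longrightarrow> closedin T A" "C \<subseteq> \<Union>\<F>"
  shows "\<exists>A\<in>\<F>. C \<subseteq> A"
  using assms(2-4)
proof (induction \<F> rule: finite_induct)
  case empty
  with assms(1) show ?case by (auto simp: irreducible_closed_def)
next
  case (insert A \<F>)
  have "closedin T (\<Union>\<F>)" by (rule closedin_Union) (use insert in auto)
  then have "C \<subseteq> A \<or> C \<subseteq> \<Union>\<F>" using irreducible_closed_subset[OF assms(1), of A "\<Union>\<F>"] insert by auto
  with insert show ?case by auto
qed

context blown_up_surface
begin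

abbreviation ztop :: "pt topology" where "ztop \<equiv> zariski_top X"
abbreviation excX :: "pt \<Rightarrow> pt set" where "excX p \<equiv> exc p \<inter> X"

lemma topspace_ztop [simp]: "topspace ztop = X"
proof
  show "topspace ztop \<subseteq> X" using openin_zariski_top[of X "topspace ztop"] by auto
  have "openin ztop X" unfolding openin_zariski_top by (auto intro!: exI[of _ "{1}"])
  then show "X \<subseteq> topspace ztop" by (rule openin_subset)
qed

lemma closedin_ztop_iff:
  "closedin ztop S \<longleftrightarrow> S \<subseteq> X \<and>
     (\<forall>q\<in>X. \<exists>P. \<forall>w. chart q w \<in> X \<longrightarrow> (chart q w \<in> S \<longleftrightarrow> (\<forall>f\<in>P. eval2 f w = 0)))"
proof -
  have "(\<forall>w. chart q w \<in> X \<longrightarrow> (chart q w \<in> X - S \<longleftrightarrow> (\<exists>f\<in>P. eval2 f w \<noteq> 0))) \<longleftrightarrow>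
      (\<forall>w. chart q w \<in> X \<longrightarrow> (chart q w \<in> S \<longleftrightarrow> (\<forall>f\<in>P. eval2 f w = 0)))" for q P
    by blast
  then show ?thesis unfolding closedin_def openin_zariski_top topspace_ztop by simp
qed

lemma closedin_zero_set:
  assumes "S \<subseteq> X" "\<And>q. q \<in> X \<Longrightarrow> \<exists>e. \<forall>w. chart q w \<in> X \<longrightarrow> (chart q w \<in> S \<longleftrightarrow> eval2 e w = 0)"
  shows "closedin ztop S"
  unfolding closedin_ztop_iff
proof (intro conjI ballI)
  fix q assume "q \<in> X"
  from assms(2)[OF this] obtain e where "\<forall>w. chart q w \<in> X \<longrightarrow> (chart q w \<in> S \<longleftrightarrow> eval2 e w = 0)" by blast
  then show "\<exists>P. \<forall>w. chart q w \<in> X \<longrightarrow> (chart q w \<in> S \<longleftrightarrow> (\<forall>f\<in>P. eval2 f w = 0))"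
    by (intro exI[of _ "{e}"]) simp
qed fact

lemma closedin_excX: "closedin ztop (excX p)"
proof (rule closedin_zero_set)
  fix q
  from exc_equation[of q p] obtain e where "\<forall>w. chart q w \<in> exc p \<longleftrightarrow> eval2 e w = 0" by blast
  then show "\<exists>e. \<forall>w. chart q w \<in> X \<longrightarrow> (chart q w \<in> excX p \<longleftrightarrow> eval2 e w = 0)"
    by (intro exI[of _ e]) blast
qed blast

lemma child_in_exc [simp]: "Slope p t \<in> exc p" "Vertical p \<in> exc p"
  using children_subset_exc[of p] by auto

lemma closedin_total: "closedin ztop {q \<in> X. blow_down q \<in> Supp I}"
  unfolding closedin_ztop_iff
proof (intro conjI ballI)
  fix q assume "q \<in> X"
  show "\<exists>P. \<forall>w. chart q w \<in> X \<longrightarrow> (chart q w \<in> {q \<in> X. blow_down q \<in> Supp I} \<longleftrightarrow> (\<forall>f\<in>P. eval2 f w = 0))"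
    by (intro exI[of _ "pullback q ` I"]) (simp add: Supp_def eval2_pullback)
qed auto

lemma closedin_ztop_singleton:
  assumes "r \<in> X" shows "closedin ztop {r}"
  unfolding closedin_ztop_iff
proof (intro conjI ballI)
  fix q assume "q \<in> X"
  show "\<exists>P. \<forall>w. chart q w \<in> X \<longrightarrow> (chart q w \<in> {r} \<longleftrightarrow> (\<forall>f\<in>P. eval2 f w = 0))"
  proof (cases "\<exists>w. chart q w = r")
    case True
    then obtain a b where ab: "chart q (a, b) = r" by auto
    have "chart q w = r \<longleftrightarrow> fst w = a \<and> snd w = b" for w
      using ab chart_inj[of q w "(a, b)"] by (cases w) auto
    then show ?thesis by (intro exI[of _ "{varx - const2 a, vary - const2 b}"]) simp
  next
    case False
    then show ?thesis by (intro exI[of _ "{1}"]) auto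
  qed
qed (use assms in auto)

text \<open>An identity principle: infinitely many directions at \<open>p\<close> give infinitely
  many points on an axis through each point \<open>q\<close> of the curve, so the local equations of
  \<open>A\<close> vanish on the whole axis.\<close>

lemma closed_contains_exc:
  assumes A: "closedin ztop A" and inf: "infinite {t. Slope p t \<in> A}"
  shows "excX p \<subseteq> A"
proof
  fix q assume q: "q \<in> excX p"
  then have qX: "q \<in> X" by simp
  from A qX obtain P where P: "\<And>w. chart q w \<in> X \<Longrightarrow> chart q w \<in> A \<longleftrightarrow> (\<forall>f\<in>P. eval2 f w = 0)"
    unfolding closedin_ztop_iff by meson
  have AX: "A \<subseteq> X" using A by (simp add: closedin_ztop_iff)
  have main: "infinite {z. g z \<in> A}" if g: "finite {t. Slope p t \<notin> range g}" for g :: "complex \<Rightarrow> pt"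
  proof
    assume "finite {z. g z \<in> A}"
    then have "finite (g ` {z. g z \<in> A})" by simp
    moreover have "Slope p ` ({t. Slope p t \<in> A} - {t. Slope p t \<notin> range g}) \<subseteq> g ` {z. g z \<in> A}" by auto
    ultimately have "finite (Slope p ` ({t. Slope p t \<in> A} - {t. Slope p t \<notin> range g}))"
      using finite_subset by blast
    then have "finite ({t. Slope p t \<in> A} - {t. Slope p t \<notin> range g})"
      by (rule finite_imageD) (auto simp: inj_on_def)
    with g inf show False by simp
  qed
  from q have "ax1 q = Some p \<or> ax2 q = Some p" by (simp add: exc_def)
  then have "eval2 f (0, 0) = 0" if f: "f \<in> P" for f
  proof
    assume "ax1 q = Some p"
    from main[OF finite_off_axis1[OF this]] have "infinite {z. chart q (0, z) \<in> A}" .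
    then have "varx dvd f" by (rule varx_dvd_if_infinite) (use P f AX in blast)
    then show ?thesis by (rule eval2_dvd) simp
  next
    assume "ax2 q = Some p"
    from main[OF finite_off_axis2[OF this]] have "infinite {z. chart q (z, 0) \<in> A}" .
    then have "vary dvd f" by (rule vary_dvd_if_infinite) (use P f AX in blast)
    then show ?thesis by (rule eval2_dvd) simp
  qed
  then show "q \<in> A" using P[of "(0, 0)"] qX by simp
qed

lemma children_in_X: "p \<in> B \<Longrightarrow> c \<in> children p \<Longrightarrow> c \<in> X \<longleftrightarrow> c \<notin> B"
  using child_anc[of c p] child_not_anc[of c p] child_blow_down[of c p] anc_B[of p] B_U[of p]
  by (auto simp: X_iff)

lemma finite_slopes_B: "finite {t. Slope p t \<in> B}"
  using finite_vimageI[OF finite_B, of "Slope p"] by (auto simp: inj_on_def vimage_def)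

lemma infinite_slopes:
  assumes "p \<in> B" shows "infinite {t. Slope p t \<in> X}"
proof -
  have "{t. Slope p t \<in> X} = - {t. Slope p t \<in> B}"
    using children_in_X[OF assms] by auto
  then show ?thesis using finite_slopes_B infinite_UNIV_char_0[where 'a=complex] by (metis finite_compl)
qed

lemma slope_in_X:
  assumes "p \<in> B" shows "\<exists>t. t \<noteq> 0 \<and> Slope p t \<in> X"
proof (rule ccontr)
  assume "\<not> ?thesis"
  then have "{t. Slope p t \<in> X} \<subseteq> {0}" by auto
  with infinite_slopes[OF assms] show False using finite_subset by blast
qed

lemma irreducible_excX:
  assumes "p \<in> B" shows "irreducible_closed ztop (excX p)"
  unfolding irreducible_closed_def
proof (intro conjI allI impI)
  show "closedin ztop (excX p)" by (rule closedin_excX)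
  from slope_in_X[OF assms] show "excX p \<noteq> {}" using child_in_exc by blast
  fix A A' assume A: "closedin ztop A \<and> closedin ztop A' \<and> excX p = A \<union> A'"
  have "{t. Slope p t \<in> X} \<subseteq> {t. Slope p t \<in> A} \<union> {t. Slope p t \<in> A'}"
    using A children_subset_exc[of p] by (auto simp: children_def)
  then have "infinite {t. Slope p t \<in> A} \<or> infinite {t. Slope p t \<in> A'}"
    using infinite_slopes[OF assms] by (meson finite_Un finite_subset)
  then have "excX p \<subseteq> A \<or> excX p \<subseteq> A'" using A closed_contains_exc by blast
  then show "excX p = A \<or> excX p = A'" using A by blast
qed

lemma excX_subset_imp_eq:
  assumes "p \<in> B" "excX p \<subseteq> exc p'" shows "p = p'"
proof -
  from slope_in_X[OF assms(1)] obtain t where t: "t \<noteq> 0" "Slope p t \<in> X" by blast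
  then have "Slope p t \<in> exc p'" using assms(2) child_in_exc by blast
  with t show ?thesis by (auto simp: exc_def)
qed

lemma X_exc_or_Proper: "q \<in> X \<Longrightarrow> (\<exists>p\<in>B. q \<in> exc p) \<or> (\<exists>a b. q = Proper a b)"
  using not_Proper_exc[of q] exc_panc[of q] unfolding X_iff by blast

lemma exc_B: "q \<in> X \<Longrightarrow> q \<in> exc p \<Longrightarrow> p \<in> B"
  using exc_panc[of q p] unfolding X_iff by blast

definition St :: "complex poly poly \<Rightarrow> pt set" where
  "St F = {q \<in> X. eval2 (strict q F) (0, 0) = 0}"

lemma closedin_St: "F \<noteq> 0 \<Longrightarrow> closedin ztop (St F)"
proof (rule closedin_zero_set)
  fix q assume F: "F \<noteq> 0"
  have "chart q w \<in> St F \<longleftrightarrow> eval2 (strict q F) w = 0" if "chart q w \<in> X" for w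
    unfolding St_def strict_chart[OF F, of q w] using that by simp
  then show "\<exists>e. \<forall>w. chart q w \<in> X \<longrightarrow> (chart q w \<in> St F \<longleftrightarrow> eval2 e w = 0)"
    by (intro exI[of _ "strict q F"]) blast
qed (auto simp: St_def)

lemma Proper_in_St: "Proper a b \<in> St F \<longleftrightarrow> Proper a b \<in> X \<and> eval2 F (a, b) = 0"
  by (auto simp: St_def eval2_subst2)

lemma excX_not_subset_St:
  assumes "p \<in> B" "F \<noteq> 0" shows "\<not> excX p \<subseteq> St F"
proof
  assume sub: "excX p \<subseteq> St F"
  from slope_in_X[OF assms(1)] obtain t where t: "Slope p t \<in> X" by blast
  have "varx dvd strict (Slope p t) F"
  proof (rule varx_dvd_if_infinite[OF infinite_axis(1)[OF t]])
    fix z assume "z \<in> {z. chart (Slope p t) (0, z) \<in> X}"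
    then have "chart (Slope p t) (0, z) \<in> excX p" by simp
    with sub show "eval2 (strict (Slope p t) F) (0, z) = 0"
      using strict_chart[OF assms(2), of "Slope p t" "(0, z)"] unfolding St_def by blast
  qed
  with strict_not_dvd[OF assms(2), of "Slope p t"] show False by simp
qed

text \<open>The zeros of \<open>f\<close> on \<open>X\<close> are covered by the exceptional curves
  and the strict transforms of the prime factors of \<open>f\<close>. An irreducible set lies in one
  of these finitely many closed sets.\<close>

lemma irreducible_in_zero_set:
  assumes D: "irreducible_closed ztop D" "\<And>p. p \<in> B \<Longrightarrow> \<not> D \<subseteq> exc p"
    and f: "f \<noteq> 0" "\<And>q. q \<in> D \<Longrightarrow> eval2 f (blow_down q) = 0"
  shows "\<exists>F. irred F \<and> F dvd f \<and> D \<subseteq> St F"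
proof -
  have "\<exists>A. (\<forall>x. x \<in># A \<longrightarrow> prime_elem x) \<and> normalize (prod_mset A) = normalize f"
    by (rule prime_factorization_exists[OF f(1)])
  then obtain A where A: "\<And>x. x \<in># A \<Longrightarrow> prime_elem x" "normalize (prod_mset A) = normalize f" by blast
  then have dvd: "f dvd prod_mset A" "prod_mset A dvd f" by (metis associatedD1 associatedD2)+
  let ?\<F> = "St ` set_mset A \<union> excX ` B"
  have DX: "D \<subseteq> X" using D(1) by (auto simp: irreducible_closed_def closedin_ztop_iff)
  have nz: "x \<noteq> 0" if "x \<in># A" for x using A(1)[OF that] by auto
  have "D \<subseteq> \<Union>?\<F>"
  proof
    fix q assume q: "q \<in> D"
    have "eval2 (prod_mset A) (blow_down q) = 0" using f(2)[OF q] dvd(1) eval2_dvd by blast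
    then obtain F where F: "F \<in># A" "eval2 F (blow_down q) = 0" by (auto simp: eval2_prod_mset)
    from q DX have qX: "q \<in> X" by blast
    from X_exc_or_Proper[OF qX] show "q \<in> \<Union>?\<F>"
    proof
      assume "\<exists>a b. q = Proper a b"
      then obtain a b where ab: "q = Proper a b" by blast
      with F qX have "q \<in> St F" by (simp only: Proper_in_St blow_down.simps simp_thms)
      with F(1) show ?thesis by blast
    qed (use qX in blast)
  qed
  moreover have "closedin ztop S" if "S \<in> ?\<F>" for S
    using that nz closedin_St closedin_excX by auto
  ultimately obtain S where S: "S \<in> ?\<F>" "D \<subseteq> S"
    using irreducible_closed_Union[OF D(1), of ?\<F>] finite_B by auto
  then obtain F where F: "F \<in># A" "D \<subseteq> St F" using D(2) by auto
  moreover have "irred F" using A(1)[OF F(1)] by (rule prime_elem_imp_irreducible)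
  moreover have "F dvd f" using dvd_trans[OF dvd_prod_mset[OF F(1)] dvd(2)] .
  ultimately show ?thesis by blast
qed

lemma irred_translate:
  assumes "irred F" shows "irred (pullback (Proper a b) F)"
proof -
  let ?t = "pullback (Proper a b)"
  let ?i = "\<lambda>f. subst2 f (const2 (- a) + varx) (const2 (- b) + vary)"
  have it: "?i (?t f) = f" for f unfolding pullback.simps by (rule translate_inverse)
  have unit: "is_unit f" if u: "is_unit (?i f)" for f
  proof -
    have "?t (?i f) = f"
    proof (rule eval2_ext)
      fix x y
      show "eval2 (?t (?i f)) (x, y) = eval2 f (x, y)" by (simp add: eval2_subst2)
    qed
    moreover have "?t (?i f) dvd ?t 1" unfolding pullback.simps by (rule subst2_dvd[OF u])
    ultimately show ?thesis by simp
  qed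
  show ?thesis
  proof (rule Factorial_Ring.irreducibleI)
    show "?t F \<noteq> 0" using assms by (metis Factorial_Ring.irreducible_def pullback_eq_0_iff)
    show "\<not> is_unit (?t F)"
    proof
      assume "is_unit (?t F)"
      then have "?i (?t F) dvd ?i 1" by (rule subst2_dvd)
      then have "is_unit F" by (simp only: it subst2_1)
      with assms show False by (simp add: Factorial_Ring.irreducible_def)
    qed
    fix x y assume "?t F = x * y"
    then have "?i (?t F) = ?i x * ?i y" by simp
    then have "F = ?i x * ?i y" by (simp only: it)
    then have "is_unit (?i x) \<or> is_unit (?i y)" by (rule Factorial_Ring.irreducibleD[OF assms])
    then show "is_unit x \<or> is_unit y" using unit by blast
  qed
qed

text \<open>If all equations of \<open>D\<close> at a proper point are multiples of
  \<open>F\<close>, then \<open>D\<close> contains all proper zeros of \<open>F\<close>. Otherwise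
  one of them cuts the curve in finitely many points, and irreducibility leaves a single
  point.\<close>

lemma nonexceptional_curve:
  assumes D: "irreducible_closed ztop D" "\<And>p. p \<in> B \<Longrightarrow> \<not> D \<subseteq> exc p"
    and F: "irred F" "D \<subseteq> St F"
  shows "\<exists>a b. Proper a b \<in> D \<and>
    (D = {Proper a b} \<or> (\<forall>x y. Proper x y \<in> X \<longrightarrow> (Proper x y \<in> D \<longleftrightarrow> eval2 F (x, y) = 0)))"
proof -
  have DX: "D \<subseteq> X" and closed: "closedin ztop D" using D(1) by (auto simp: irreducible_closed_def closedin_ztop_iff)
  have "\<not> D \<subseteq> \<Union>(excX ` B)"
    using irreducible_closed_Union[OF D(1), of "excX ` B"] finite_B closedin_excX D(2) by blast
  then obtain r where r: "r \<in> D" "r \<notin> \<Union>(excX ` B)" by blast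
  then have rX: "r \<in> X" using DX by blast
  with r(2) have "\<not> (\<exists>p\<in>B. r \<in> exc p)" by blast
  with X_exc_or_Proper[OF rX] r(1) obtain a b where ab: "Proper a b \<in> D" by blast
  let ?q = "Proper a b"
  have "?q \<in> X" using ab DX by blast
  with closed obtain P where P: "\<And>w. chart ?q w \<in> X \<Longrightarrow> chart ?q w \<in> D \<longleftrightarrow> (\<forall>f\<in>P. eval2 f w = 0)"
    unfolding closedin_ztop_iff by meson
  have P': "Proper x y \<in> D \<longleftrightarrow> (\<forall>f\<in>P. eval2 f (x - a, y - b) = 0)" if "Proper x y \<in> X" for x y
    using P[of "(x - a, y - b)"] that by simp
  have FP: "eval2 (pullback ?q F) (x - a, y - b) = eval2 F (x, y)" for x y
    by (simp add: eval2_subst2)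
  show ?thesis
  proof (cases "\<forall>f\<in>P. pullback ?q F dvd f")
    case True
    have "Proper x y \<in> D \<longleftrightarrow> eval2 F (x, y) = 0" if xy: "Proper x y \<in> X" for x y
    proof
      assume "Proper x y \<in> D"
      then show "eval2 F (x, y) = 0" using F(2) Proper_in_St by blast
    next
      assume "eval2 F (x, y) = 0"
      then have "eval2 (pullback ?q F) (x - a, y - b) = 0" by (simp only: FP)
      then show "Proper x y \<in> D" unfolding P'[OF xy] using True eval2_dvd by blast
    qed
    with ab show ?thesis by blast
  next
    case False
    then obtain f where f: "f \<in> P" "\<not> pullback ?q F dvd f" by blast
    let ?Z = "{w. eval2 (pullback ?q F) w = 0 \<and> eval2 f w = 0}"
    have fin: "finite ?Z" by (rule finite_common_zeros[OF irred_translate[OF F(1)] f(2)])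
    let ?N = "chart ?q ` ?Z \<inter> D"
    let ?\<F> = "(\<lambda>x. {x}) ` ?N \<union> excX ` B"
    have "D \<subseteq> \<Union>?\<F>"
    proof
      fix r assume r: "r \<in> D"
      then have rX: "r \<in> X" using DX by blast
      from X_exc_or_Proper[OF rX] show "r \<in> \<Union>?\<F>"
      proof
        assume "\<exists>x y. r = Proper x y"
        then obtain x y where xy: "r = Proper x y" by blast
        have "eval2 F (x, y) = 0" using F(2) r Proper_in_St xy by blast
        then have "eval2 (pullback ?q F) (x - a, y - b) = 0" by (simp only: FP)
        moreover have "eval2 f (x - a, y - b) = 0" using P' rX r xy f(1) by blast
        moreover have "r = chart ?q (x - a, y - b)" using xy by simp
        ultimately have "r \<in> ?N" using r by blast
        then show ?thesis by blast
      qed (use rX in blast)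
    qed
    moreover have "closedin ztop S" if "S \<in> ?\<F>" for S
      using that closedin_ztop_singleton closedin_excX DX by auto
    moreover have "finite ?\<F>" using fin finite_B by simp
    ultimately obtain S where "S \<in> ?\<F>" "D \<subseteq> S" using irreducible_closed_Union[OF D(1), of ?\<F>] by blast
    then obtain x where "D \<subseteq> {x}" using D(2) by blast
    with ab have "D = {Proper a b}" by blast
    with ab show ?thesis by blast
  qed
qed

end

locale blown_up_ideal = blown_up_surface +
  fixes I :: "complex poly poly set" and f0 :: "complex poly poly"
  assumes f0: "f0 \<in> I" "f0 \<noteq> 0"
begin

abbreviation "T \<equiv> total_components X I"
abbreviation "Z \<equiv> {q \<in> X. blow_down q \<in> Supp I}"

lemma component_iff: "E \<in> T \<longleftrightarrow> irreducible_closed ztop E \<and> E \<subseteq> Z \<and>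
    (\<forall>D. irreducible_closed ztop D \<and> E \<subseteq> D \<and> D \<subseteq> Z \<longrightarrow> D = E)"
  by (simp add: total_components_def irreducible_components_def)

lemma component_max: "E \<in> T \<Longrightarrow> irreducible_closed ztop D \<Longrightarrow> E \<subseteq> D \<Longrightarrow> D \<subseteq> Z \<Longrightarrow> D = E"
  unfolding component_iff by blast

lemma component_subset: "E \<in> T \<Longrightarrow> E \<subseteq> X"
  unfolding component_iff by blast

lemma component_closed: "E \<in> T \<Longrightarrow> closedin ztop E"
  unfolding component_iff irreducible_closed_def by blast

text \<open>For maximality: a larger irreducible set of common zeros lies in an exceptional curve,
  which must be the same one, or in a strict transform, which cannot contain
  \<open>excX p\<close>.\<close>

lemma excX_component:
  assumes p: "p \<in> B" "blow_down p \<in> Supp I" shows "excX p \<in> T"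
  unfolding component_iff
proof (intro conjI allI impI)
  show "irreducible_closed ztop (excX p)" by (rule irreducible_excX[OF p(1)])
  show "excX p \<subseteq> Z" using p(2) exc_blow_down by fastforce
  fix D assume D: "irreducible_closed ztop D \<and> excX p \<subseteq> D \<and> D \<subseteq> Z"
  show "D = excX p"
  proof (cases "\<exists>p'\<in>B. D \<subseteq> exc p'")
    case True
    then obtain p' where p': "p' \<in> B" "D \<subseteq> exc p'" by blast
    with D have "p = p'" by (intro excX_subset_imp_eq[OF p(1)]) blast
    with p' D show ?thesis by auto
  next
    case False
    have "\<exists>F. irred F \<and> F dvd f0 \<and> D \<subseteq> St F"
      by (rule irreducible_in_zero_set) (use D False f0 in \<open>auto simp: Supp_def\<close>)
    then obtain F where F: "irred F" "D \<subseteq> St F" by blast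
    then have "excX p \<subseteq> St F" "F \<noteq> 0" using D by auto
    with excX_not_subset_St[OF p(1)] show ?thesis by blast
  qed
qed

lemma component_cases:
  assumes E: "E \<in> T"
  shows "(\<exists>p\<in>B. blow_down p \<in> Supp I \<and> E = excX p) \<or> (\<forall>p\<in>B. \<not> E \<subseteq> exc p)"
proof (cases "\<exists>p\<in>B. E \<subseteq> exc p")
  case True
  then obtain p where p: "p \<in> B" "E \<subseteq> exc p" by blast
  from E have irr: "irreducible_closed ztop E" and EZ: "E \<subseteq> Z" by (auto simp: component_iff)
  from irr obtain q where q: "q \<in> E" by (auto simp: irreducible_closed_def)
  then have "q \<in> exc p" using p by blast
  then have "blow_down p \<in> Supp I" using exc_blow_down[of q p] subsetD[OF EZ q] by simp
  moreover from this have "excX p \<in> T" by (rule excX_component[OF p(1)])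
  then have "excX p = E"
    using p EZ by (intro component_max[OF E]) (auto simp: component_iff)
  ultimately show ?thesis using p by blast
qed blast

lemma component_eq_excX:
  assumes "E \<in> T" "p \<in> B" "infinite {t. Slope p t \<in> E}" shows "E = excX p"
proof -
  have sub: "excX p \<subseteq> E" by (rule closed_contains_exc[OF component_closed[OF assms(1)] assms(3)])
  from slope_in_X[OF assms(2)] obtain t where t: "Slope p t \<in> X" by blast
  then have "Slope p t \<in> E" using sub child_in_exc by blast
  then have "blow_down p \<in> Supp I" using assms(1) by (force simp: component_iff)
  then have "excX p \<in> T" by (rule excX_component[OF assms(2)])
  then show ?thesis using sub assms(1) by (intro component_max) (auto simp: component_iff)
qed

text \<open>Infinitely many slopes at \<open>p\<close> in \<open>E\<close> would give the whole
  curve. All other points of the curve are vertical directions or slopes 0 at one of the finitely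
  many centres.\<close>

lemma finite_inter_exc:
  assumes "E \<in> T" "p \<in> B" "E \<noteq> excX p" shows "finite (E \<inter> exc p)"
proof -
  have "finite {t. Slope p t \<in> E}" using component_eq_excX[OF assms(1,2)] assms(3) by blast
  moreover have "E \<inter> exc p \<subseteq> Slope p ` {t. Slope p t \<in> E} \<union> Vertical ` B \<union> (\<lambda>b. Slope b 0) ` B"
  proof
    fix q assume q: "q \<in> E \<inter> exc p"
    then have "q \<in> X" using component_subset[OF assms(1)] by blast
    then have anc: "panc q \<subseteq> B" by (simp add: X_iff)
    show "q \<in> Slope p ` {t. Slope p t \<in> E} \<union> Vertical ` B \<union> (\<lambda>b. Slope b 0) ` B"
    proof (cases q)
      case (Slope b t)
      then have "b \<in> B" using anc by auto
      then show ?thesis using q Slope by (auto simp: exc_def split: if_splits)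
    next
      case (Vertical b)
      then have "b \<in> B" using anc by auto
      then show ?thesis using Vertical by auto
    qed (use q in \<open>simp add: exc_def\<close>)
  qed
  ultimately show ?thesis using finite_B finite_subset by (metis (no_types, lifting) finite_UnI finite_imageI)
qed

end

section \<open>Numerical data\<close>

text \<open>The multiplicities of the two axes of the chart centred at \<open>q\<close> in the Jacobian divisor.\<close>

primrec jac_mult :: "pt \<Rightarrow> nat \<times> nat" where
  "jac_mult (Proper a b) = (0, 0)"
| "jac_mult (Slope p t) = (Suc (fst (jac_mult p) + snd (jac_mult p)), if t = 0 then snd (jac_mult p) else 0)"
| "jac_mult (Vertical p) = (fst (jac_mult p), Suc (fst (jac_mult p) + snd (jac_mult p)))"

text \<open>The new curve has the sum of the two multiplicities plus 1 in the Jacobian divisor, and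
  \<nu> is one more than that.\<close>

definition nu :: "pt \<Rightarrow> nat" where
  "nu p = fst (jac_mult p) + snd (jac_mult p) + 2"

text \<open>A missing axis behaves like a curve with \<nu> = 1, which keeps later formulas uniform
  in the number of exceptional curves through \<open>q\<close>.\<close>

lemma jac_mult_ax1: "Suc (fst (jac_mult q)) = (case ax1 q of None \<Rightarrow> 1 | Some p \<Rightarrow> nu p)"
  and jac_mult_ax2: "Suc (snd (jac_mult q)) = (case ax2 q of None \<Rightarrow> 1 | Some p \<Rightarrow> nu p)"
proof -
  have "Suc (fst (jac_mult q)) = (case ax1 q of None \<Rightarrow> 1 | Some p \<Rightarrow> nu p) \<and>
      Suc (snd (jac_mult q)) = (case ax2 q of None \<Rightarrow> 1 | Some p \<Rightarrow> nu p)"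
    by (induction q) (auto simp: nu_def)
  then show "Suc (fst (jac_mult q)) = (case ax1 q of None \<Rightarrow> 1 | Some p \<Rightarrow> nu p)"
    "Suc (snd (jac_mult q)) = (case ax2 q of None \<Rightarrow> 1 | Some p \<Rightarrow> nu p)" by blast+
qed

definition monomial_at :: "nat \<Rightarrow> nat \<Rightarrow> complex poly poly \<Rightarrow> bool" where
  "monomial_at a b f \<longleftrightarrow> (\<exists>g. f = varx ^ a * vary ^ b * g \<and> eval2 g (0, 0) \<noteq> 0)"

lemma monomial_at_Slope:
  assumes "monomial_at a b f"
  shows "monomial_at (a + b) (if t = 0 then b else 0) (shift_y t (blow_x f))"
proof -
  from assms obtain g where g: "f = varx ^ a * vary ^ b * g" "eval2 g (0, 0) \<noteq> 0"
    by (auto simp: monomial_at_def)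
  have eq: "shift_y t (blow_x f) = varx ^ (a + b) * (const2 t + vary) ^ b * shift_y t (blow_x g)"
    by (simp add: g(1) power_mult_distrib power_add mult_ac)
  have g0: "eval2 (shift_y t (blow_x g)) (0, 0) \<noteq> 0" using g(2) by (simp add: eval2_subst2)
  show ?thesis
  proof (cases "t = 0")
    case True
    have "const2 t + vary = vary" using True by (simp add: const2_def)
    then show ?thesis using True g0 unfolding monomial_at_def eq by auto
  next
    case False
    have "shift_y t (blow_x f) = varx ^ (a + b) * vary ^ 0 * ((const2 t + vary) ^ b * shift_y t (blow_x g))"
      unfolding eq by (simp add: mult.assoc)
    moreover have "eval2 ((const2 t + vary) ^ b * shift_y t (blow_x g)) (0, 0) \<noteq> 0"
      using False g0 by (simp del: subst2_mult)
    ultimately show ?thesis using False unfolding monomial_at_def by auto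
  qed
qed

lemma monomial_at_Vertical:
  assumes "monomial_at a b f" shows "monomial_at a (a + b) (blow_y f)"
proof -
  from assms obtain g where g: "f = varx ^ a * vary ^ b * g" "eval2 g (0, 0) \<noteq> 0"
    by (auto simp: monomial_at_def)
  have "blow_y f = varx ^ a * vary ^ (a + b) * blow_y g"
    by (simp add: g(1) power_mult_distrib power_add mult_ac)
  moreover have "eval2 (blow_y g) (0, 0) \<noteq> 0" using g(2) by (simp add: eval2_subst2)
  ultimately show ?thesis unfolding monomial_at_def by blast
qed

lemma monomial_at_mult_varx: "monomial_at a b f \<Longrightarrow> monomial_at (Suc a) b (f * varx)"
  and monomial_at_mult_vary: "monomial_at a b f \<Longrightarrow> monomial_at a (Suc b) (f * vary)"
proof -
  have eq: "varx ^ a * vary ^ b * g * varx = varx ^ Suc a * vary ^ b * g"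
    "varx ^ a * vary ^ b * g * vary = varx ^ a * vary ^ Suc b * g" for g
    by (simp_all add: mult_ac)
  show "monomial_at a b f \<Longrightarrow> monomial_at (Suc a) b (f * varx)"
    "monomial_at a b f \<Longrightarrow> monomial_at a (Suc b) (f * vary)"
    unfolding monomial_at_def using eq by blast+
qed

lemma monomial_at_jac: "monomial_at (fst (jac_mult q)) (snd (jac_mult q)) (jac q)"
proof (induction q)
  case (Proper a b)
  then show ?case unfolding jac_Proper monomial_at_def by (intro exI[of _ 1]) simp
next
  case (Slope p t)
  then show ?case using monomial_at_mult_varx[OF monomial_at_Slope[OF Slope, of t]] by (simp add: jac_Slope)
next
  case (Vertical p)
  then show ?case using monomial_at_mult_vary[OF monomial_at_Vertical[OF Vertical]] by (simp add: jac_Vertical)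
qed

lemma not_varx_dvd_vary_power: "\<not> varx dvd vary ^ k"
  using prime_elem_dvd_power[OF prime_elem_varx, of vary k] not_varx_dvd[of vary 1] by auto

lemma not_vary_dvd_varx_power: "\<not> vary dvd varx ^ k"
  using prime_elem_dvd_power[OF prime_elem_vary, of varx k] not_vary_dvd[of varx 1] by auto

lemma monomial_at_mult:
  assumes "monomial_at a b f"
  shows "varx ^ a dvd f" "\<not> varx ^ Suc a dvd f" "vary ^ b dvd f" "\<not> vary ^ Suc b dvd f"
proof -
  from assms obtain g where g: "f = varx ^ a * vary ^ b * g" "eval2 g (0, 0) \<noteq> 0"
    by (auto simp: monomial_at_def)
  have ndx: "\<not> varx dvd g" and ndy: "\<not> vary dvd g" using not_varx_dvd not_vary_dvd g(2) by blast+
  show "varx ^ a dvd f" "vary ^ b dvd f" unfolding g(1) by (simp_all add: mult.assoc)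
  show "\<not> varx ^ Suc a dvd f"
  proof
    assume "varx ^ Suc a dvd f"
    then have "varx ^ a * varx dvd varx ^ a * (vary ^ b * g)" unfolding g(1) by (simp add: mult.commute mult.assoc)
    then have "varx dvd vary ^ b * g" using prime_elem_varx by (simp add: prime_elem_def)
    then show False using prime_elem_varx ndx not_varx_dvd_vary_power by (simp add: prime_elem_dvd_mult_iff)
  qed
  show "\<not> vary ^ Suc b dvd f"
  proof
    assume "vary ^ Suc b dvd f"
    then have "vary ^ b * vary dvd vary ^ b * (varx ^ a * g)" unfolding g(1) by (simp add: mult_ac)
    then have "vary dvd varx ^ a * g" using prime_elem_vary by (simp add: prime_elem_def)
    then show False using prime_elem_vary ndy not_vary_dvd_varx_power by (simp add: prime_elem_dvd_mult_iff)
  qed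
qed

text \<open>The multiplicity along the curve over \<open>p\<close> can be measured at any later
  point of the curve and always equals the multiplicity at \<open>p\<close>.\<close>

lemma pullback_dvd_ax:
  "(ax1 q = Some p \<longrightarrow> (varx ^ k dvd pullback q f \<longleftrightarrow> ordge k (pullback p f))) \<and>
   (ax2 q = Some p \<longrightarrow> (vary ^ k dvd pullback q f \<longleftrightarrow> ordge k (pullback p f)))"
proof (induction q)
  case (Slope q t)
  have "varx ^ k dvd pullback (Slope q t) f \<longleftrightarrow> ordge k (pullback q f)"
    unfolding pullback_Slope varx_dvd_shift_y varx_dvd_blow_x ..
  moreover have "vary ^ k dvd pullback (Slope q 0) f \<longleftrightarrow> vary ^ k dvd pullback q f"
    unfolding pullback_Slope shift_y_0 vary_dvd_blow_x ..
  ultimately show ?case using Slope by (auto simp del: pullback.simps)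
next
  case (Vertical q)
  have "vary ^ k dvd pullback (Vertical q) f \<longleftrightarrow> ordge k (pullback q f)"
    unfolding pullback.simps vary_dvd_blow_y ..
  moreover have "varx ^ k dvd pullback (Vertical q) f \<longleftrightarrow> varx ^ k dvd pullback q f"
    unfolding pullback.simps varx_dvd_blow_y ..
  ultimately show ?case using Vertical by (auto simp del: pullback.simps)
qed simp

lemma pullback_dvd_ax1: "ax1 q = Some p \<Longrightarrow> varx ^ k dvd pullback q f \<longleftrightarrow> ordge k (pullback p f)"
  and pullback_dvd_ax2: "ax2 q = Some p \<Longrightarrow> vary ^ k dvd pullback q f \<longleftrightarrow> ordge k (pullback p f)"
  using pullback_dvd_ax by blast+

lemma power_dvd_associated:
  fixes e z g :: "'a :: comm_semiring_1"
  assumes "e dvd z" "z dvd e" shows "e ^ k dvd g \<longleftrightarrow> z ^ k dvd g"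
  using dvd_power_same[OF assms(1), of k] dvd_power_same[OF assms(2), of k] dvd_trans by blast

text \<open>\<open>divisor_mult\<close> is a definite description: besides the agreement of all
  local multiplicities, one local equation has to be exhibited to make the value unique.\<close>

lemma divisor_mult_eqI:
  assumes "\<And>q e g. q \<in> E \<Longrightarrow> curve_equation X E q e \<Longrightarrow> D q g \<Longrightarrow> multiplicity e g = n"
    and "q \<in> E" "curve_equation X E q e" "D q g"
  shows "divisor_mult X D E = n"
  unfolding divisor_mult_def
proof (rule the_equality)
  show "\<forall>q\<in>E. \<forall>e g. curve_equation X E q e \<and> D q g \<longrightarrow> multiplicity e g = n" using assms(1) by blast
  fix m assume "\<forall>q\<in>E. \<forall>e g. curve_equation X E q e \<and> D q g \<longrightarrow> multiplicity e g = m"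
  then have "multiplicity e g = m" using assms(2-4) by blast
  then show "m = n" using assms(1)[OF assms(2-4)] by simp
qed

context blown_up_surface
begin

text \<open>The equation vanishes at infinitely many points of an axis, so the coordinate divides
  it, and irreducibility makes the two associated.\<close>

lemma exc_curve_equation:
  assumes p: "p \<in> B" and q: "q \<in> excX p" and e: "curve_equation X (excX p) q e"
  shows "(ax1 q = Some p \<and> e dvd varx \<and> varx dvd e) \<or> (ax2 q = Some p \<and> e dvd vary \<and> vary dvd e)"
proof -
  from e have irr: "irred e" and z: "\<And>w. chart q w \<in> X \<Longrightarrow> chart q w \<in> excX p \<longleftrightarrow> eval2 e w = 0"
    by (auto simp: curve_equation_def simp del: split_paired_All)
  have qX: "q \<in> X" using q by blast
  from q have "ax1 q = Some p \<or> ax2 q = Some p" by (simp add: exc_def)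
  then show ?thesis
  proof
    assume a: "ax1 q = Some p"
    have "varx dvd e"
    proof (rule varx_dvd_if_infinite[OF infinite_axis(1)[OF qX]])
      fix x assume "x \<in> {z. chart q (0, z) \<in> X}"
      then show "eval2 e (0, x) = 0" using z[of "(0, x)"] chart_exc1[OF a, of "(0, x)"] by simp
    qed
    then show ?thesis using a irred_dvd_irred[OF irreducible_varx irr] by blast
  next
    assume a: "ax2 q = Some p"
    have "vary dvd e"
    proof (rule vary_dvd_if_infinite[OF infinite_axis(2)[OF qX]])
      fix x assume "x \<in> {z. chart q (z, 0) \<in> X}"
      then show "eval2 e (x, 0) = 0" using z[of "(x, 0)"] chart_exc2[OF a, of "(x, 0)"] by simp
    qed
    then show ?thesis using a irred_dvd_irred[OF irreducible_vary irr] by blast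
  qed
qed

lemma curve_equation_slope:
  "curve_equation X (excX p) (Slope p t) varx"
  unfolding curve_equation_def using irreducible_varx chart_exc1[of "Slope p t" p] by simp

lemma num_nu_excX:
  assumes p: "p \<in> B" shows "num_nu X (excX p) = nu p"
proof -
  from slope_in_X[OF p] obtain t where t: "Slope p t \<in> X" by blast
  have "divisor_mult X form_divisor (excX p) = nu p - 1"
  proof (rule divisor_mult_eqI)
    show "Slope p t \<in> excX p" using t by simp
    show "curve_equation X (excX p) (Slope p t) varx" by (rule curve_equation_slope)
    show "form_divisor (Slope p t) (jac (Slope p t))" by (simp add: form_divisor_def jac_def)
    fix q e g assume q: "q \<in> excX p" "curve_equation X (excX p) q e" "form_divisor q g"
    have g: "g = jac q" using q(3) by (simp add: form_divisor_def jac_def)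
    note m = monomial_at_mult[OF monomial_at_jac[of q]]
    from exc_curve_equation[OF p q(1,2)] show "multiplicity e g = nu p - 1"
    proof (elim disjE conjE)
      assume a: "ax1 q = Some p" "e dvd varx" "varx dvd e"
      have "fst (jac_mult q) = nu p - 1" using jac_mult_ax1[of q] a(1) by simp
      then show ?thesis unfolding g using m(1,2)
        by (intro multiplicity_eqI) (simp_all only: power_dvd_associated[OF a(2,3)] not_False_eq_True)
    next
      assume a: "ax2 q = Some p" "e dvd vary" "vary dvd e"
      have "snd (jac_mult q) = nu p - 1" using jac_mult_ax2[of q] a(1) by simp
      then show ?thesis unfolding g using m(3,4)
        by (intro multiplicity_eqI) (simp_all only: power_dvd_associated[OF a(2,3)] not_False_eq_True)
    qed
  qed
  then show ?thesis by (simp add: num_nu_def nu_def)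
qed

end

context blown_up_ideal
begin

text \<open>The least multiplicity at \<open>p\<close> of a member of the pulled back ideal. By the
  blow-up formula this is N of the curve over \<open>p\<close>.\<close>

definition NE :: "pt \<Rightarrow> nat" where
  "NE p = (LEAST k. \<exists>f\<in>I. \<not> ordge (Suc k) (pullback p f))"

lemma NE: "f \<in> I \<Longrightarrow> ordge (NE p) (pullback p f)" "\<exists>f\<in>I. \<not> ordge (Suc (NE p)) (pullback p f)"
proof -
  have "\<not> ordge (Suc (ord2 (pullback p f0))) (pullback p f0)" using f0 by (intro ord2) simp
  then have "\<exists>k. \<exists>f\<in>I. \<not> ordge (Suc k) (pullback p f)" using f0(1) by blast
  then show "\<exists>f\<in>I. \<not> ordge (Suc (NE p)) (pullback p f)" unfolding NE_def by (rule LeastI_ex)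
  show "ordge (NE p) (pullback p f)" if f: "f \<in> I"
  proof (cases "NE p")
    case (Suc k)
    then have "k < (LEAST k. \<exists>f\<in>I. \<not> ordge (Suc k) (pullback p f))" by (simp add: NE_def)
    from not_less_Least[OF this] f Suc show ?thesis by auto
  qed simp
qed

lemma num_N_excX:
  assumes p: "p \<in> B" and snc: "\<And>q. q \<in> X \<Longrightarrow> snc_at I q"
  shows "num_N X I (excX p) = NE p"
proof -
  from slope_in_X[OF p] obtain t where t: "Slope p t \<in> X" by blast
  \<comment> \<open>Normal crossings provide a local generator, hence the witness that the definite
    description requires.\<close>
  from snc[OF t] obtain z1 z2 a b where
    "local_ideal (pullback (Slope p t) ` I) = local_ideal {z1 ^ a * z2 ^ b}" by (auto simp: snc_at_def)
  then have div: "ideal_divisor I (Slope p t) (z1 ^ a * z2 ^ b)" by (simp add: ideal_divisor_def)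
  show ?thesis unfolding num_N_def
  proof (rule divisor_mult_eqI)
    show "Slope p t \<in> excX p" using t by simp
    show "curve_equation X (excX p) (Slope p t) varx" by (rule curve_equation_slope)
    show "ideal_divisor I (Slope p t) (z1 ^ a * z2 ^ b)" by (rule div)
    fix q e g assume q: "q \<in> excX p" "curve_equation X (excX p) q e" "ideal_divisor I q g"
    from q(3) have g: "local_ideal {g} = local_ideal (pullback q ` I)" by (simp add: ideal_divisor_def)
    from exc_curve_equation[OF p q(1,2)] show "multiplicity e g = NE p"
    proof (elim disjE conjE)
      assume a: "ax1 q = Some p" "e dvd varx" "varx dvd e"
      have "varx ^ k dvd g \<longleftrightarrow> (\<forall>f\<in>I. ordge k (pullback p f))" for k
        unfolding local_ideal_eq_prime_power_dvd_iff[OF g prime_elem_varx, simplified]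
        using pullback_dvd_ax1[OF a(1)] by simp
      then have "varx ^ NE p dvd g" "\<not> varx ^ Suc (NE p) dvd g" using NE[where p = p] by blast+
      then show ?thesis by (intro multiplicity_eqI) (simp_all only: power_dvd_associated[OF a(2,3)] not_False_eq_True)
    next
      assume a: "ax2 q = Some p" "e dvd vary" "vary dvd e"
      have "vary ^ k dvd g \<longleftrightarrow> (\<forall>f\<in>I. ordge k (pullback p f))" for k
        unfolding local_ideal_eq_prime_power_dvd_iff[OF g prime_elem_vary, simplified]
        using pullback_dvd_ax2[OF a(1)] by simp
      then have "vary ^ NE p dvd g" "\<not> vary ^ Suc (NE p) dvd g" using NE[where p = p] by blast+
      then show ?thesis by (intro multiplicity_eqI) (simp_all only: power_dvd_associated[OF a(2,3)] not_False_eq_True)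
    qed
  qed
qed

text \<open>The Jacobian is everywhere a monomial in exceptional axes times a unit. If a local
  equation of \<open>E\<close> divided it, that equation would be an axis, and \<open>E\<close>
  would share infinitely many points with an exceptional curve.\<close>

lemma nonexceptional_num_nu:
  assumes E: "E \<in> T" and nonexc: "\<And>p. p \<in> B \<Longrightarrow> \<not> E \<subseteq> exc p" and nosing: "\<And>a b. E \<noteq> {Proper a b}"
  shows "num_nu X E = 1"
proof -
  have irr: "irreducible_closed ztop E" and EZ: "E \<subseteq> Z" using E by (auto simp: component_iff)
  have "\<exists>F. irred F \<and> F dvd f0 \<and> E \<subseteq> St F"
    by (rule irreducible_in_zero_set[OF irr nonexc f0(2)]) (use EZ f0 in \<open>auto simp: Supp_def\<close>)
  then obtain F where F: "irred F" "E \<subseteq> St F" by blast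
  from nonexceptional_curve[OF irr nonexc F] nosing obtain a b where ab: "Proper a b \<in> E"
    and FE: "\<And>x y. Proper x y \<in> X \<Longrightarrow> Proper x y \<in> E \<longleftrightarrow> eval2 F (x, y) = 0" by blast
  have ce: "curve_equation X E (Proper a b) (pullback (Proper a b) F)"
    unfolding curve_equation_def
  proof (intro conjI allI impI)
    show "irred (pullback (Proper a b) F)" by (rule irred_translate[OF F(1)])
    fix w assume w: "chart (Proper a b) w \<in> X"
    obtain u v where uv: "w = (u, v)" by fastforce
    show "chart (Proper a b) w \<in> E \<longleftrightarrow> eval2 (pullback (Proper a b) F) w = 0"
      using FE[of "a + u" "b + v"] w by (simp add: uv eval2_subst2)
  qed
  have "divisor_mult X form_divisor E = 0"
  proof (rule divisor_mult_eqI[OF _ ab ce])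
    show "form_divisor (Proper a b) (jac (Proper a b))" by (simp add: form_divisor_def jac_def)
    fix q e g assume q: "q \<in> E" "curve_equation X E q e" "form_divisor q g"
    have g: "g = jac q" using q(3) by (simp add: form_divisor_def jac_def)
    from q(2) have irr_e: "irred e" and z: "\<And>w. chart q w \<in> X \<Longrightarrow> chart q w \<in> E \<longleftrightarrow> eval2 e w = 0"
      by (auto simp: curve_equation_def simp del: split_paired_All)
    have qX: "q \<in> X" using q(1) component_subset[OF E] by blast
    have e0: "eval2 e (0, 0) = 0" using z[of "(0, 0)"] qX q(1) by simp
    have no: False if ax: "q \<in> exc p" and S: "infinite S" "\<And>x. x \<in> S \<Longrightarrow> chart q (k x) \<in> E \<inter> exc p" "inj k"
      for p S and k :: "complex \<Rightarrow> complex \<times> complex"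
    proof -
      have "p \<in> B" by (rule exc_B[OF qX ax])
      then have "E \<noteq> excX p" using nonexc by blast
      then have "finite (E \<inter> exc p)" by (rule finite_inter_exc[OF E \<open>p \<in> B\<close>])
      then have "finite ((\<lambda>x. chart q (k x)) ` S)" by (rule finite_subset[rotated]) (use S(2) in blast)
      then have "finite S" by (rule finite_imageD) (use S(3) chart_inj in \<open>auto simp: inj_on_def inj_def\<close>)
      with S(1) show False by blast
    qed
    have "\<not> e dvd jac q"
    proof
      assume dvd: "e dvd jac q"
      from monomial_at_jac[of q] obtain h where
        h: "jac q = varx ^ fst (jac_mult q) * vary ^ snd (jac_mult q) * h" "eval2 h (0, 0) \<noteq> 0"
        by (auto simp: monomial_at_def)
      note pe = irred_imp_prime[OF irr_e]
      from dvd h(1) have "e dvd varx ^ fst (jac_mult q) \<or> e dvd vary ^ snd (jac_mult q) \<or> e dvd h"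
        using pe by (simp add: prime_elem_dvd_mult_iff)
      moreover have "\<not> e dvd h" using nonzero_at_0_not_dvd[OF h(2) e0] .
      ultimately consider "e dvd varx ^ fst (jac_mult q)" | "e dvd vary ^ snd (jac_mult q)" by blast
      then show False
      proof cases
        case 1
        then have d: "e dvd varx" using prime_elem_dvd_power[OF pe] by blast
        have "fst (jac_mult q) \<noteq> 0"
        proof
          assume "fst (jac_mult q) = 0"
          with 1 have "is_unit e" by simp
          with irr_e show False by (simp add: Factorial_Ring.irreducible_def)
        qed
        then obtain p where p: "ax1 q = Some p" using jac_mult_ax1[of q] by (cases "ax1 q") auto
        have "varx dvd e" using irred_dvd_irred[OF irr_e irreducible_varx d] .
        show False
        proof (rule no[of p "{z. chart q (0, z) \<in> X}" "\<lambda>z. (0, z)"])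
          fix x assume "x \<in> {z. chart q (0, z) \<in> X}"
          moreover have "eval2 e (0, x) = 0" using \<open>varx dvd e\<close> by (rule eval2_dvd) simp
          ultimately show "chart q (0, x) \<in> E \<inter> exc p"
            using z[of "(0, x)"] chart_exc1[OF p, of "(0, x)"] by simp
        qed (use p infinite_axis(1)[OF qX] in \<open>auto simp: exc_def inj_def\<close>)
      next
        case 2
        then have d: "e dvd vary" using prime_elem_dvd_power[OF pe] by blast
        have "snd (jac_mult q) \<noteq> 0"
        proof
          assume "snd (jac_mult q) = 0"
          with 2 have "is_unit e" by simp
          with irr_e show False by (simp add: Factorial_Ring.irreducible_def)
        qed
        then obtain p where p: "ax2 q = Some p" using jac_mult_ax2[of q] by (cases "ax2 q") auto
        have "vary dvd e" using irred_dvd_irred[OF irr_e irreducible_vary d] .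
        show False
        proof (rule no[of p "{z. chart q (z, 0) \<in> X}" "\<lambda>z. (z, 0)"])
          fix x assume "x \<in> {z. chart q (z, 0) \<in> X}"
          moreover have "eval2 e (x, 0) = 0" using \<open>vary dvd e\<close> by (rule eval2_dvd) simp
          ultimately show "chart q (x, 0) \<in> E \<inter> exc p"
            using z[of "(x, 0)"] chart_exc2[OF p, of "(x, 0)"] by simp
        qed (use p infinite_axis(2)[OF qX] in \<open>auto simp: exc_def inj_def\<close>)
      qed
    qed
    then show "multiplicity e g = 0" unfolding g by (rule not_dvd_imp_multiplicity_0)
  qed
  then show ?thesis by (simp add: num_nu_def)
qed

text \<open>By the normal crossings hypothesis a common zero of the ideal lies on a curve of common zeros.\<close>

lemma origin_not_component:
  assumes orig: "(0, 0) \<in> Supp I" "Proper 0 0 \<in> X" and snc: "snc_at I (Proper 0 0)"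
  shows "{Proper 0 0} \<notin> T"
proof
  assume comp: "{Proper 0 0} \<in> T"
  let ?o = "Proper 0 0"
  have pb: "pullback ?o f = f" for f by (rule eval2_ext) (simp add: eval2_subst2)
  have "\<exists>P. irred P \<and> eval2 P (0, 0) = 0 \<and> (\<forall>f\<in>I. P dvd pullback ?o f)"
    by (rule snc_common_factor[OF snc f0]) (use orig(1) in \<open>simp add: pb Supp_def del: pullback.simps\<close>)
  then obtain P where P: "irred P" "eval2 P (0, 0) = 0" "\<And>f. f \<in> I \<Longrightarrow> P dvd f" unfolding pb by blast
  let ?V = "{q \<in> X. \<exists>a b. q = Proper a b \<and> eval2 P (a, b) = 0}"
  let ?pt = "\<lambda>(a, b). Proper a b"
  have inj: "inj ?pt" by (auto simp: inj_def)
  \<comment> \<open>The curve \<open>P = 0\<close> is infinite. It loses only the finitely many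
    centres and the points outside \<open>U\<close>, which are finitely many because
    \<open>P\<close> does not divide an equation that is nonzero at the origin.\<close>
  have infV: "infinite ?V"
  proof
    assume "finite ?V"
    then have 1: "finite (?pt -` ?V)" by (rule finite_vimageI[OF _ inj])
    have 2: "finite (?pt -` B)" by (rule finite_vimageI[OF finite_B inj])
    from U obtain Q where Q: "U = {w. \<exists>f\<in>Q. eval2 f w \<noteq> 0}" by (auto simp: zariski_open_plane_def)
    have "(0, 0) \<in> U" using orig(2) by (simp add: X_iff)
    then obtain f where f: "f \<in> Q" "eval2 f (0, 0) \<noteq> 0" using Q by blast
    have 3: "finite {w. eval2 P w = 0 \<and> eval2 f w = 0}"
      by (rule finite_common_zeros[OF P(1) nonzero_at_0_not_dvd[OF f(2) P(2)]])
    have "{w. eval2 P w = 0} \<subseteq> ?pt -` ?V \<union> ?pt -` B \<union> {w. eval2 P w = 0 \<and> eval2 f w = 0}"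
      using f(1) by (auto simp: X_iff Q)
    then have "finite {w. eval2 P w = 0}" using 1 2 3 by (meson finite_UnI finite_subset)
    with infinite_zeros[OF P(1)] show False by blast
  qed
  let ?D = "ztop closure_of ?V"
  have VX: "?V \<subseteq> topspace ztop" by auto
  have VD: "?V \<subseteq> ?D" by (rule closure_of_subset[OF VX])
  have "?V \<subseteq> Z" using P(3) eval2_dvd by (fastforce simp: Supp_def)
  then have DZ: "?D \<subseteq> Z" by (rule closure_of_minimal[OF _ closedin_total])
  have oV: "?o \<in> ?V" using orig(2) P(2) by auto
  \<comment> \<open>Identity principle on \<open>P = 0\<close>: an equation with infinitely many
    zeros on it is divisible by \<open>P\<close>. This makes the closure of \<open>?V\<close>
    irreducible.\<close>
  have contains: "?V \<subseteq> A" if A: "closedin ztop A" "infinite (?V \<inter> A)" for A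
  proof -
    from A(1) orig(2) obtain R where R: "\<And>w. chart ?o w \<in> X \<Longrightarrow> chart ?o w \<in> A \<longleftrightarrow> (\<forall>f\<in>R. eval2 f w = 0)"
      unfolding closedin_ztop_iff by meson
    have R': "Proper a b \<in> A \<longleftrightarrow> (\<forall>f\<in>R. eval2 f (a, b) = 0)" if "Proper a b \<in> X" for a b
      using R[of "(a, b)"] that by simp
    have "P dvd f" if f: "f \<in> R" for f
    proof (rule ccontr)
      assume "\<not> P dvd f"
      then have "finite {w. eval2 P w = 0 \<and> eval2 f w = 0}" by (rule finite_common_zeros[OF P(1)])
      then have "finite (?pt ` {w. eval2 P w = 0 \<and> eval2 f w = 0})" by simp
      moreover have "?V \<inter> A \<subseteq> ?pt ` {w. eval2 P w = 0 \<and> eval2 f w = 0}"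
        using R' f by (auto intro!: rev_image_eqI)
      ultimately show False using A(2) finite_subset by blast
    qed
    then show ?thesis using R' eval2_dvd by blast
  qed
  have "irreducible_closed ztop ?D"
    unfolding irreducible_closed_def
  proof (intro conjI allI impI)
    show "?D \<noteq> {}" using oV VD by blast
    fix A A' assume A: "closedin ztop A \<and> closedin ztop A' \<and> ?D = A \<union> A'"
    then have V_eq: "?V = (?V \<inter> A) \<union> (?V \<inter> A')" using VD by blast
    have "infinite (?V \<inter> A) \<or> infinite (?V \<inter> A')"
    proof (rule ccontr)
      assume "\<not> ?thesis"
      then have "finite ((?V \<inter> A) \<union> (?V \<inter> A'))" by blast
      with infV show False unfolding V_eq[symmetric] by blast
    qed
    then have "?V \<subseteq> A \<or> ?V \<subseteq> A'" using contains A by blast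
    then have "?D \<subseteq> A \<or> ?D \<subseteq> A'" using A closure_of_minimal by blast
    then show "?D = A \<or> ?D = A'" using A by blast
  qed simp
  then have "?D = {?o}" using oV VD DZ by (intro component_max[OF comp]) auto
  then have "finite ?V" using finite_subset[OF VD] by simp
  with infV show False by blast
qed

end

section \<open>The zeta function as a sum over the tree of blow-ups\<close>

locale principalized = blown_up_ideal +
  assumes snc: "q \<in> X \<Longrightarrow> snc_at I q" and origin: "(0, 0) \<in> Supp I" "(0, 0) \<in> U"
begin

definition through :: "pt \<Rightarrow> pt set set" where
  "through q = {E \<in> T. q \<in> E}"

definition factor :: "complex \<Rightarrow> pt set \<Rightarrow> complex" where
  "factor s E = 1 / (of_nat (num_nu X E) + s * of_nat (num_N X I E))"

definition denom :: "complex \<Rightarrow> pt \<Rightarrow> complex" where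
  "denom s p = of_nat (nu p) + s * of_nat (NE p)"

definition leaf_weight :: "complex \<Rightarrow> pt \<Rightarrow> complex" where
  "leaf_weight s q = (\<Prod>E\<in>through q. factor s E)"

definition B0 :: "pt set" where "B0 = {b \<in> B. blow_down b = (0, 0)}"

text \<open>The crossings over the origin. Points on one component only are accounted for by the
  Euler characteristic of their line.\<close>

definition L :: "pt set" where "L = {q \<in> X. blow_down q = (0, 0) \<and> 2 \<le> card (through q)}"

text \<open>The points at which the line over \<open>p\<close> has to be punctured: later centres
  and crossings.\<close>

definition special :: "pt \<Rightarrow> pt set" where
  "special p = {c \<in> children p. c \<in> B \<or> 2 \<le> card (through c)}"

text \<open>A centre contributes its punctured line, with \<chi> = 2 - k for k punctures; a
  surviving crossing contributes a point with \<chi> = 1.\<close>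

definition weight :: "complex \<Rightarrow> pt \<Rightarrow> complex" where
  "weight s q = (if q \<in> B then of_int (2 - int (card (special q))) / denom s q else leaf_weight s q)"

definition tree_sum :: "complex \<Rightarrow> pt \<Rightarrow> complex" where
  "tree_sum s q = (\<Sum>r | r \<in> B0 \<union> L \<and> q \<in> anc r. weight s r)"

lemma factor_excX: "p \<in> B \<Longrightarrow> factor s (excX p) = 1 / denom s p"
  by (simp add: factor_def denom_def num_nu_excX num_N_excX snc)

lemma B0_component: "p \<in> B0 \<Longrightarrow> excX p \<in> T"
  using excX_component origin by (auto simp: B0_def)

lemma excX_inj: "inj_on excX B"
  by (rule inj_onI) (metis Int_lower1 excX_subset_imp_eq)

definition euler_stratum :: "pt set set \<Rightarrow> int" where
  "euler_stratum J = euler_char (subtopology etop {q \<in> X. blow_down q = (0, 0) \<and> through q = J})"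

lemma zeta_of_eq: "zeta_of X I s = (\<Sum>J\<in>Pow T. of_int (euler_stratum J) * (\<Prod>E\<in>J. factor s E))"
  unfolding zeta_of_def
proof (rule sum.cong[OF refl])
  fix J assume "J \<in> Pow T"
  then have "stratum X T J \<inter> {q. blow_down q = (0, 0)} = {q \<in> X. blow_down q = (0, 0) \<and> through q = J}"
    unfolding stratum_def through_def by blast
  then show "of_int (euler_char (subtopology etop (stratum X T J \<inter> {q. blow_down q = (0, 0)}))) *
      (\<Prod>E\<in>J. 1 / (of_nat (num_nu X E) + s * of_nat (num_N X I E))) =
    of_int (euler_stratum J) * (\<Prod>E\<in>J. factor s E)"
    unfolding euler_stratum_def factor_def by simp
qed

lemma euler_stratum_finite:
  assumes "finite {q \<in> X. blow_down q = (0, 0) \<and> through q = J}"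
  shows "euler_stratum J = int (card {q \<in> X. blow_down q = (0, 0) \<and> through q = J})"
proof -
  let ?S = "{q \<in> X. blow_down q = (0, 0) \<and> through q = J}"
  have top: "topspace (subtopology etop ?S) = ?S" by auto
  have "closedin (subtopology etop ?S) {q}" if q: "q \<in> ?S" for q
  proof -
    have "closedin etop {q}" using q by (intro closedin_etop_singleton) simp
    then show ?thesis using q unfolding closedin_subtopology by (intro exI[of _ "{q}"]) blast
  qed
  then have "has_euler (subtopology etop ?S) (int (card ?S))"
    using has_euler_finite_discrete[of "subtopology etop ?S"] assms unfolding top by blast
  then show ?thesis unfolding euler_stratum_def by (rule has_euler_imp_euler_char)
qed

text \<open>A sum over an infinite index set is 0 by convention, so that only finite sets of
  components remain to be computed with.\<close>

lemma zeta_of_infinite: "infinite T \<Longrightarrow> zeta_of X I s = 0"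
  unfolding zeta_of_def by (simp add: finite_Pow_iff)

text \<open>The fibre over the origin is then a single point, and the only stratum meeting it is
  that of the components through it.\<close>

lemma zeta_of_not_blown_up:
  assumes fin: "finite T" and o: "Proper 0 0 \<notin> B"
  shows "zeta_of X I s = leaf_weight s (Proper 0 0)"
proof -
  let ?o = "Proper 0 0"
  have oX: "?o \<in> X" using o origin by (simp add: X_iff)
  have only: "q = ?o" if q: "q \<in> X" "blow_down q = (0, 0)" for q
  proof (rule ccontr)
    assume "q \<noteq> ?o"
    moreover have "?o \<in> anc q" using root_anc[of q] q by simp
    ultimately have "?o \<in> panc q" by blast
    with q o show False unfolding X_iff by blast
  qed
  have S: "{q \<in> X. blow_down q = (0, 0) \<and> through q = J} = (if J = through ?o then {?o} else {})" for J
  proof -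
    have "q \<in> {q \<in> X. blow_down q = (0, 0) \<and> through q = J} \<longleftrightarrow> q = ?o \<and> J = through ?o" for q
      using only[of q] oX by auto
    then show ?thesis by (simp add: set_eq_iff)
  qed
  have e: "euler_stratum J = (if J = through ?o then 1 else 0)" for J
    using euler_stratum_finite[of J] unfolding S by simp
  have "zeta_of X I s = (\<Sum>J\<in>Pow T. if J = through ?o then leaf_weight s ?o else 0)"
    unfolding zeta_of_eq e leaf_weight_def by (intro sum.cong) auto
  also have "\<dots> = leaf_weight s ?o" using fin by (simp add: sum.delta through_def)
  finally show ?thesis .
qed

end

locale origin_blown_up = principalized +
  assumes finite_T: "finite T" and origin_B: "Proper 0 0 \<in> B"
begin

lemma finite_through: "finite (through q)"
  using finite_T by (simp add: through_def)

lemma over_origin_exc: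
  assumes "q \<in> X" "blow_down q = (0, 0)" shows "\<exists>p\<in>B0. q \<in> exc p"
proof -
  have "q \<notin> B" using assms(1) by (simp add: X_iff)
  then have "\<not> (\<exists>a b. q = Proper a b)" using assms(2) origin_B by auto
  then obtain p where p: "p \<in> B" "q \<in> exc p" using X_exc_or_Proper[OF assms(1)] by blast
  then have "p \<in> B0" using exc_blow_down[of q p] assms(2) by (simp add: B0_def)
  with p show ?thesis by blast
qed

lemma finite_B0: "finite B0"
  using finite_B by (simp add: B0_def)

text \<open>At a crossing a second component meets an exceptional curve over the origin, and
  distinct components of this kind meet in finitely many points.\<close>

lemma finite_L: "finite L"
proof (rule finite_subset)
  show "L \<subseteq> (\<Union>p\<in>B0. \<Union>E\<in>T - {excX p}. E \<inter> exc p)"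
  proof
    fix q assume q: "q \<in> L"
    then have qX: "q \<in> X" "blow_down q = (0, 0)" "2 \<le> card (through q)" by (auto simp: L_def)
    from over_origin_exc[OF qX(1,2)] obtain p where p: "p \<in> B0" "q \<in> exc p" by blast
    have "\<not> through q \<subseteq> {excX p}"
    proof
      assume "through q \<subseteq> {excX p}"
      then have "card (through q) \<le> card {excX p}" by (intro card_mono) auto
      with qX(3) show False by simp
    qed
    then show "q \<in> (\<Union>p\<in>B0. \<Union>E\<in>T - {excX p}. E \<inter> exc p)" using p by (auto simp: through_def)
  qed
  have "finite (E \<inter> exc p)" if "p \<in> B0" "E \<in> T - {excX p}" for p E
    using that by (intro finite_inter_exc) (auto simp: B0_def)
  then show "finite (\<Union>p\<in>B0. \<Union>E\<in>T - {excX p}. E \<inter> exc p)" using finite_B0 finite_T by blast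
qed

lemma child_leaf_over_origin:
  "p \<in> B0 \<Longrightarrow> c \<in> children p \<Longrightarrow> c \<notin> B \<Longrightarrow> c \<in> X \<and> blow_down c = (0, 0)"
  using children_in_X[of p c] child_blow_down[of c p] by (auto simp: B0_def)

lemma special_subset: "p \<in> B0 \<Longrightarrow> special p \<subseteq> B0 \<union> L"
proof
  fix c assume p: "p \<in> B0" and c: "c \<in> special p"
  then have ch: "c \<in> children p" by (simp add: special_def)
  show "c \<in> B0 \<union> L"
  proof (cases "c \<in> B")
    case True
    then show ?thesis using child_blow_down[OF ch] p by (simp add: B0_def)
  next
    case False
    then show ?thesis using child_leaf_over_origin[OF p ch] c by (simp add: special_def L_def)
  qed
qed

lemma finite_special: "p \<in> B0 \<Longrightarrow> finite (special p)"
  using special_subset finite_B0 finite_L finite_subset by (meson finite_UnI)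

text \<open>A point over the origin is a direction at some centre and lies on the curve over it. If
  it lies on no second component, injectivity of \<open>excX\<close> identifies that centre as
  \<open>p\<close>.\<close>

lemma stratum_excX:
  assumes p: "p \<in> B0"
  shows "{q \<in> X. blow_down q = (0, 0) \<and> through q = {excX p}} = children p - special p"
proof (intro equalityI subsetI)
  fix q assume "q \<in> {q \<in> X. blow_down q = (0, 0) \<and> through q = {excX p}}"
  then have q: "q \<in> X" "blow_down q = (0, 0)" "through q = {excX p}" by auto
  have "q \<notin> B" using q(1) by (simp add: X_iff)
  obtain b where b: "q \<in> children b"
    using over_origin_exc[OF q(1,2)] by (cases q) (auto simp: exc_def)
  have "b \<in> panc q" using child_anc[OF b] child_not_anc[OF b] anc_refl[of b] by auto
  then have "b \<in> B" using q(1) unfolding X_iff by blast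
  moreover have "blow_down b = (0, 0)" using child_blow_down[OF b] q(2) by simp
  ultimately have "b \<in> B0" by (simp add: B0_def)
  moreover have "q \<in> exc b" using b children_subset_exc by blast
  ultimately have "excX b \<in> through q" using B0_component q(1) by (simp add: through_def)
  then have "excX b = excX p" using q(3) by simp
  then have "b = p" using excX_inj \<open>b \<in> B\<close> p by (auto simp: inj_on_def B0_def)
  with b q(3) \<open>q \<notin> B\<close> show "q \<in> children p - special p" by (simp add: special_def)
next
  fix q assume q: "q \<in> children p - special p"
  then have "q \<notin> B" "card (through q) < 2" by (auto simp: special_def)
  with child_leaf_over_origin[OF p] q have qX: "q \<in> X" "blow_down q = (0, 0)" by auto
  have "q \<in> exc p" using q children_subset_exc[of p] by blast
  then have "excX p \<in> through q" using B0_component[OF p] qX(1) by (simp add: through_def)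
  have "card (through q) \<le> Suc 0" using \<open>card (through q) < 2\<close> by simp
  then have all: "\<forall>E\<in>through q. \<forall>E'\<in>through q. E = E'"
    unfolding card_le_Suc0_iff_eq[OF finite_through[of q]] .
  have "through q = {excX p}"
  proof (intro equalityI subsetI)
    fix E assume "E \<in> through q"
    with all \<open>excX p \<in> through q\<close> have "E = excX p" by (meson bspec)
    then show "E \<in> {excX p}" by simp
  qed (use \<open>excX p \<in> through q\<close> in simp)
  with qX show "q \<in> {q \<in> X. blow_down q = (0, 0) \<and> through q = {excX p}}" by simp
qed

lemma euler_stratum_excX:
  assumes p: "p \<in> B0" shows "euler_stratum {excX p} = 2 - int (card (special p))"
proof -
  have sub: "children p - special p \<subseteq> X"
    unfolding stratum_excX[OF p, symmetric] by blast
  interpret C: punctured_curve U B X p "special p"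
  proof
    show "p \<in> B" using p by (simp add: B0_def)
    show "finite (special p)" by (rule finite_special[OF p])
    show "special p \<subseteq> children p" by (auto simp: special_def)
  qed (rule sub)
  show ?thesis unfolding euler_stratum_def stratum_excX[OF p]
    by (rule has_euler_imp_euler_char[OF C.has_euler_curve])
qed

text \<open>The fibre over the blown up origin is covered by exceptional curves over it, so a
  component of another kind is never alone there.\<close>

lemma euler_stratum_other:
  assumes "E \<notin> excX ` B0" shows "euler_stratum {E} = 0"
proof -
  have *: "{q \<in> X. blow_down q = (0, 0) \<and> through q = {E}} = {}"
  proof (rule ccontr)
    assume "{q \<in> X. blow_down q = (0, 0) \<and> through q = {E}} \<noteq> {}"
    then obtain q where q: "q \<in> X" "blow_down q = (0, 0)" "through q = {E}" by blast
    from over_origin_exc[OF q(1,2)] obtain p where p: "p \<in> B0" "q \<in> exc p" by blast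
    then have "excX p \<in> through q" using B0_component q(1) by (simp add: through_def)
    then have "excX p = E" using q(3) by simp
    then have "E \<in> excX ` B0" using imageI[OF p(1), of excX] by simp
    with assms show False ..
  qed
  show ?thesis using euler_stratum_finite[of "{E}"] unfolding * by simp
qed

text \<open>No point over the origin lies on no component, so \<open>card J \<noteq> 1\<close>
  selects finite sets of crossings. Their Euler characteristics count points, and regrouping by
  points gives the sum over \<open>L\<close>.\<close>

lemma sum_point_strata:
  "(\<Sum>J | J \<in> Pow T \<and> card J \<noteq> 1. of_int (euler_stratum J) * (\<Prod>E\<in>J. factor s E)) = (\<Sum>q\<in>L. leaf_weight s q)"
proof -
  let ?P = "{J. J \<in> Pow T \<and> card J \<noteq> 1}"
  have finP: "finite ?P" using finite_T by simp
  have eq: "{q \<in> X. blow_down q = (0, 0) \<and> through q = J} = {q \<in> L. through q = J}" if J: "J \<in> ?P" for J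
  proof -
    have "2 \<le> card (through q)" if q: "q \<in> X" "blow_down q = (0, 0)" "through q = J" for q
    proof -
      from over_origin_exc[OF q(1,2)] obtain p where p: "p \<in> B0" "q \<in> exc p" by blast
      then have "excX p \<in> through q" using B0_component q(1) by (simp add: through_def)
      then have "card (through q) \<noteq> 0" using finite_through[of q] by auto
      with J q(3) show ?thesis by auto
    qed
    then show ?thesis by (auto simp: L_def)
  qed
  have "of_int (euler_stratum J) * (\<Prod>E\<in>J. factor s E) = (\<Sum>q | q \<in> L \<and> through q = J. leaf_weight s q)" if J: "J \<in> ?P" for J
  proof -
    have "finite {q \<in> X. blow_down q = (0, 0) \<and> through q = J}" unfolding eq[OF J] using finite_L by simp
    from euler_stratum_finite[OF this] have "euler_stratum J = int (card {q \<in> L. through q = J})"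
      unfolding eq[OF J] .
    then show ?thesis by (simp add: leaf_weight_def)
  qed
  then have "(\<Sum>J\<in>?P. of_int (euler_stratum J) * (\<Prod>E\<in>J. factor s E)) =
      (\<Sum>J\<in>?P. \<Sum>q | q \<in> L \<and> through q = J. leaf_weight s q)" by (intro sum.cong) auto
  also have "\<dots> = (\<Sum>q\<in>L. leaf_weight s q)"
    by (rule sum.group[OF finite_L finP]) (auto simp: L_def through_def)
  finally show ?thesis .
qed

lemma B0_L_disjoint: "B0 \<inter> L = {}"
  by (auto simp: B0_def L_def X_iff)

lemma zeta_of_tree_sum: "zeta_of X I s = tree_sum s (Proper 0 0)"
proof -
  let ?f = "\<lambda>J. of_int (euler_stratum J) * (\<Prod>E\<in>J. factor s E)"
  let ?S = "(\<lambda>E. {E}) ` T"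
  have part: "Pow T = ?S \<union> {J. J \<in> Pow T \<and> card J \<noteq> 1}"
  proof (intro equalityI subsetI)
    fix J assume J: "J \<in> Pow T"
    show "J \<in> ?S \<union> {J. J \<in> Pow T \<and> card J \<noteq> 1}"
    proof (cases "card J = 1")
      case True
      then obtain E where "J = {E}" by (rule card_1_singletonE)
      with J show ?thesis by blast
    qed (use J in blast)
  qed blast
  have "zeta_of X I s = sum ?f ?S + sum ?f {J. J \<in> Pow T \<and> card J \<noteq> 1}"
    unfolding zeta_of_eq
  proof (subst part, rule sum.union_disjoint)
    show "finite ?S" by (rule finite_imageI[OF finite_T])
    have "{J. J \<in> Pow T \<and> card J \<noteq> 1} \<subseteq> Pow T" by blast
    then show "finite {J. J \<in> Pow T \<and> card J \<noteq> 1}"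
      using finite_T finite_Pow_iff[of T] finite_subset by blast
    show "?S \<inter> {J. J \<in> Pow T \<and> card J \<noteq> 1} = {}"
    proof (rule equals0I)
      fix J assume "J \<in> ?S \<inter> {J. J \<in> Pow T \<and> card J \<noteq> 1}"
      then obtain E where "J = {E}" "card J \<noteq> 1" by blast
      then show False by simp
    qed
  qed
  also have "sum ?f ?S = (\<Sum>E\<in>T. of_int (euler_stratum {E}) * factor s E)"
    by (subst sum.reindex) (auto simp: inj_on_def)
  also have "\<dots> = (\<Sum>E\<in>excX ` B0. of_int (euler_stratum {E}) * factor s E)"
    by (rule sum.mono_neutral_right) (use finite_T B0_component euler_stratum_other in auto)
  also have "\<dots> = (\<Sum>p\<in>B0. of_int (euler_stratum {excX p}) * factor s (excX p))"
    by (subst sum.reindex) (use excX_inj in \<open>auto simp: inj_on_def B0_def\<close>)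
  also have "\<dots> = (\<Sum>p\<in>B0. weight s p)"
  proof (rule sum.cong[OF refl])
    fix p assume p: "p \<in> B0"
    then have "p \<in> B" by (simp add: B0_def)
    then show "of_int (euler_stratum {excX p}) * factor s (excX p) = weight s p"
      by (simp add: euler_stratum_excX[OF p] factor_excX weight_def)
  qed
  also have "sum ?f {J. J \<in> Pow T \<and> card J \<noteq> 1} = (\<Sum>q\<in>L. weight s q)"
    unfolding sum_point_strata by (rule sum.cong) (auto simp: weight_def L_def X_iff)
  also have "(\<Sum>p\<in>B0. weight s p) + (\<Sum>q\<in>L. weight s q) = (\<Sum>q\<in>B0 \<union> L. weight s q)"
    by (rule sum.union_disjoint[symmetric]) (use finite_B0 finite_L B0_L_disjoint in auto)
  also have "B0 \<union> L = {r. r \<in> B0 \<union> L \<and> Proper 0 0 \<in> anc r}"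
  proof -
    have "Proper 0 0 \<in> anc r" if "r \<in> B0 \<union> L" for r
      using that root_anc[of r] by (auto simp: B0_def L_def)
    then show ?thesis by blast
  qed
  finally show ?thesis by (simp add: tree_sum_def)
qed

lemma tree_sum_leaf:
  assumes "q \<in> L" shows "tree_sum s q = leaf_weight s q"
proof -
  have "q \<notin> B" using assms by (simp add: L_def X_iff)
  have "r = q" if r: "r \<in> B0 \<union> L" "q \<in> anc r" for r
  proof (rule ccontr)
    assume "r \<noteq> q"
    then have "q \<in> panc r" using r(2) by blast
    then have "q \<in> B" using r(1) anc_B[of r] by (auto simp: B0_def L_def X_iff)
    with \<open>q \<notin> B\<close> show False ..
  qed
  then have "{r. r \<in> B0 \<union> L \<and> q \<in> anc r} = {q}" using assms by auto
  then show ?thesis using \<open>q \<notin> B\<close> by (simp add: tree_sum_def weight_def)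
qed

text \<open>The descendants of \<open>q\<close> are divided according to the child of
  \<open>q\<close> they pass through; a child that is neither a centre nor a crossing has none to
  count.\<close>

lemma tree_sum_branch:
  assumes q: "q \<in> B0"
  shows "tree_sum s q = of_int (2 - int (card (special q))) / denom s q + (\<Sum>c\<in>special q. tree_sum s c)"
proof -
  let ?D = "\<lambda>q. {r. r \<in> B0 \<union> L \<and> q \<in> anc r}"
  have finD: "finite (?D c)" for c using finite_B0 finite_L by simp
  have qB: "q \<in> B" using q by (simp add: B0_def)
  have D: "?D q = insert q (\<Union>c\<in>special q. ?D c)"
  proof (intro equalityI subsetI)
    fix r assume r: "r \<in> ?D q"
    show "r \<in> insert q (\<Union>c\<in>special q. ?D c)"
    proof (cases "r = q")
      case False
      with r obtain c where c: "c \<in> children q" "c \<in> anc r" using anc_child_between[of q r] by auto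
      have "c \<in> special q"
      proof (cases "c = r")
        case True
        then show ?thesis using r c by (auto simp: special_def B0_def L_def)
      next
        case False
        then have "c \<in> B" using r c(2) anc_B[of r] by (auto simp: B0_def L_def X_iff)
        then show ?thesis using c by (simp add: special_def)
      qed
      then show ?thesis using r c by blast
    qed simp
  next
    fix r assume "r \<in> insert q (\<Union>c\<in>special q. ?D c)"
    then show "r \<in> ?D q"
    proof
      assume "r \<in> (\<Union>c\<in>special q. ?D c)"
      then obtain c where c: "c \<in> children q" "r \<in> B0 \<union> L" "c \<in> anc r" by (auto simp: special_def)
      have "q \<in> anc c" using child_anc[OF c(1)] anc_refl[of q] by auto
      with c show ?thesis using anc_trans by blast
    qed (use q in simp)
  qed
  have nq: "q \<notin> (\<Union>c\<in>special q. ?D c)"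
    using child_not_anc by (auto simp: special_def)
  have disj: "?D c \<inter> ?D c' = {}" if c: "c \<in> special q" "c' \<in> special q" "c \<noteq> c'" for c c'
  proof (rule ccontr)
    assume "?D c \<inter> ?D c' \<noteq> {}"
    then obtain r where "c \<in> anc r" "c' \<in> anc r" by blast
    then have "c \<in> anc c' \<or> c' \<in> anc c" by (rule anc_linear)
    then show False
      using c child_anc[of c q] child_anc[of c' q] child_not_anc[of c q] child_not_anc[of c' q]
      by (auto simp: special_def)
  qed
  have "tree_sum s q = weight s q + sum (weight s) (\<Union>c\<in>special q. ?D c)"
    unfolding tree_sum_def D using nq finite_special[OF q] finD by (subst sum.insert) auto
  also have "sum (weight s) (\<Union>c\<in>special q. ?D c) = (\<Sum>c\<in>special q. tree_sum s c)"
    unfolding tree_sum_def using finite_special[OF q] finD disj by (intro sum.UNION_disjoint) auto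
  finally show ?thesis using qB by (simp add: weight_def)
qed

end

section \<open>Poles lie in the given set\<close>

lemma ordge_mult: "ordge a f \<Longrightarrow> ordge b g \<Longrightarrow> ordge (a + b) (f * g)"
  unfolding varx_dvd_blow_x[symmetric] subst2_mult power_add by (rule mult_dvd_mono)

lemma ordge_varx_vary: "ordge (a + b) (varx ^ a * vary ^ b)"
proof (rule ordge_mult)
  show "ordge a (varx ^ a)" unfolding varx_dvd_blow_x[symmetric] by simp
  show "ordge b (vary ^ b)" unfolding varx_dvd_blow_x[symmetric] by (simp add: power_mult_distrib)
qed

lemma monomial_at_not_ordge:
  assumes "monomial_at a b f" shows "\<not> ordge (Suc (a + b)) f"
  using monomial_at_mult(2)[OF monomial_at_Slope[OF assms, of 0]]
  unfolding varx_dvd_shift_y varx_dvd_blow_x .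

lemma varx_vary_dvd:
  assumes "varx ^ a dvd f" "vary ^ b dvd f" shows "varx ^ a * vary ^ b dvd f"
proof -
  from assms(1) obtain h where h: "f = varx ^ a * h" by (auto simp: dvd_def)
  have "vary ^ b dvd h"
    by (rule prime_elem_power_dvd_cancel[OF prime_elem_vary not_vary_dvd_varx_power assms(2)[unfolded h]])
  then show ?thesis unfolding h by (rule mult_dvd_mono[OF dvd_refl])
qed

lemma dvd_ordge_monomial_at:
  assumes "varx ^ a dvd f" "vary ^ b dvd f"
  shows "ordge (a + b) f" "\<not> ordge (Suc (a + b)) f \<Longrightarrow> monomial_at a b f"
proof -
  from varx_vary_dvd[OF assms] obtain g where g: "f = varx ^ a * vary ^ b * g" by (auto simp: dvd_def)
  show "ordge (a + b) f"
    unfolding g using ordge_mult[OF ordge_varx_vary[of a b], of 0 g] by simp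
  assume no: "\<not> ordge (Suc (a + b)) f"
  have "eval2 g (0, 0) \<noteq> 0"
  proof
    assume "eval2 g (0, 0) = 0"
    then have "ordge (Suc 0) g" by (simp add: ordge_1_iff)
    from ordge_mult[OF ordge_varx_vary this, of a b] no show False by (simp add: g)
  qed
  with g show "monomial_at a b f" by (auto simp: monomial_at_def)
qed

section \<open>Finite limits of sums and products of linear factors\<close>

lemma eventually_affine_nonzero:
  fixes s0 :: complex
  assumes "a \<noteq> 0" shows "eventually (\<lambda>s. a + s * b \<noteq> 0) (at s0)"
proof (cases "b = 0")
  case False
  then have "a + s * b = 0 \<longleftrightarrow> s = - a / b" for s by (auto simp: field_simps add_eq_0_iff)
  moreover have "eventually (\<lambda>s. s \<noteq> - a / b) (at s0)"
    by (rule eventually_neq_at_within)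
  ultimately show ?thesis by simp
qed (use assms in simp)

text \<open>A finite limit at \<open>s0\<close> excludes a pole and, unlike continuity, is
  insensitive to the values at \<open>s0\<close> itself, where divisions by 0 may occur.\<close>

definition has_lim :: "complex \<Rightarrow> (complex \<Rightarrow> complex) \<Rightarrow> bool" where
  "has_lim s0 f \<longleftrightarrow> (\<exists>l. (f \<longlongrightarrow> l) (at s0))"

lemma has_lim_const [simp]: "has_lim s0 (\<lambda>s. c)"
  unfolding has_lim_def by (blast intro: tendsto_const)

lemma has_lim_add: "has_lim s0 f \<Longrightarrow> has_lim s0 g \<Longrightarrow> has_lim s0 (\<lambda>s. f s + g s)"
  unfolding has_lim_def by (blast intro: tendsto_add)

lemma has_lim_mult: "has_lim s0 f \<Longrightarrow> has_lim s0 g \<Longrightarrow> has_lim s0 (\<lambda>s. f s * g s)"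
  unfolding has_lim_def by (blast intro: tendsto_mult)

lemma has_lim_sum: "(\<And>x. x \<in> A \<Longrightarrow> has_lim s0 (f x)) \<Longrightarrow> has_lim s0 (\<lambda>s. \<Sum>x\<in>A. f x s)"
  by (induction A rule: infinite_finite_induct) (auto intro: has_lim_add)

lemma has_lim_prod: "(\<And>x. x \<in> A \<Longrightarrow> has_lim s0 (f x)) \<Longrightarrow> has_lim s0 (\<lambda>s. \<Prod>x\<in>A. f x s)"
  by (induction A rule: infinite_finite_induct) (auto intro: has_lim_mult)

lemma has_lim_inverse_affine:
  assumes "a + s0 * b \<noteq> 0" shows "has_lim s0 (\<lambda>s. c / (a + s * b))"
proof -
  have "((\<lambda>s. c / (a + s * b)) \<longlongrightarrow> c / (a + s0 * b)) (at s0)"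
    by (intro tendsto_intros assms)
  then show ?thesis unfolding has_lim_def by blast
qed

lemma has_lim_cong:
  assumes "has_lim s0 f" "eventually (\<lambda>s. g s = f s) (at s0)" shows "has_lim s0 g"
  using assms tendsto_cong[OF assms(2)] unfolding has_lim_def by blast

lemma has_lim_not_pole: "has_lim s0 f \<Longrightarrow> \<not> is_pole f s0"
  unfolding has_lim_def is_pole_def
  using not_tendsto_and_filterlim_at_infinity[of "at s0" f] by auto

section \<open>Monomial and non-monomial infinitely near points\<close>

context principalized
begin

definition n1 :: "pt \<Rightarrow> nat" where "n1 q = (case ax1 q of None \<Rightarrow> 0 | Some p \<Rightarrow> NE p)"
definition n2 :: "pt \<Rightarrow> nat" where "n2 q = (case ax2 q of None \<Rightarrow> 0 | Some p \<Rightarrow> NE p)"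

text \<open>The linear factor of the axis \<open>u = 0\<close> at \<open>q\<close>, as
  \<open>A2\<close> is for \<open>v = 0\<close>. A missing axis has data \<nu> = 1, N = 0 and so the
  factor 1.\<close>

definition A1 :: "complex \<Rightarrow> pt \<Rightarrow> complex" where
  "A1 s q = of_nat (Suc (fst (jac_mult q))) + s * of_nat (n1 q)"
definition A2 :: "complex \<Rightarrow> pt \<Rightarrow> complex" where
  "A2 s q = of_nat (Suc (snd (jac_mult q))) + s * of_nat (n2 q)"

lemma A1_ax: "A1 s q = (case ax1 q of None \<Rightarrow> 1 | Some p \<Rightarrow> denom s p)"
  and A2_ax: "A2 s q = (case ax2 q of None \<Rightarrow> 1 | Some p \<Rightarrow> denom s p)"
  unfolding A1_def A2_def jac_mult_ax1 jac_mult_ax2 by (auto simp: n1_def n2_def denom_def split: option.split)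

text \<open>Together with \<open>axes_dvd\<close> this says that the ideal is locally generated by
  the monomial of the exceptional axes, i.e. its weak transform has multiplicity 0 at
  \<open>q\<close>.\<close>

definition mono_at :: "pt \<Rightarrow> bool" where
  "mono_at q \<longleftrightarrow> (\<exists>f\<in>I. monomial_at (n1 q) (n2 q) (pullback q f))"

lemma axes_dvd:
  assumes "f \<in> I"
  shows "varx ^ n1 q dvd pullback q f" "vary ^ n2 q dvd pullback q f"
proof -
  show "varx ^ n1 q dvd pullback q f"
    using pullback_dvd_ax1[of q] NE(1)[OF assms] by (cases "ax1 q") (auto simp: n1_def)
  show "vary ^ n2 q dvd pullback q f"
    using pullback_dvd_ax2[of q] NE(1)[OF assms] by (cases "ax2 q") (auto simp: n2_def)
qed

lemma NE_mono:
  assumes "mono_at q" shows "NE q = n1 q + n2 q"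
proof (rule antisym)
  from assms obtain f where f: "f \<in> I" "monomial_at (n1 q) (n2 q) (pullback q f)" by (auto simp: mono_at_def)
  show "NE q \<le> n1 q + n2 q"
    using monomial_at_not_ordge[OF f(2)] NE(1)[OF f(1), of q] ordge_mono not_less_eq_eq by blast
  from NE(2) obtain g where g: "g \<in> I" "\<not> ordge (Suc (NE q)) (pullback q g)" by blast
  show "n1 q + n2 q \<le> NE q"
    using dvd_ordge_monomial_at(1)[OF axes_dvd[OF g(1), of q]] g(2) ordge_mono not_less_eq_eq
    by blast
qed

text \<open>The difference of the two sides is the multiplicity of the weak transform at
  \<open>q\<close>. If it were 0, a member of minimal order would be the monomial of the axes times
  a unit.\<close>

lemma NE_not_mono:
  assumes "\<not> mono_at q" shows "n1 q + n2 q < NE q"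
proof -
  from NE(2) obtain g where g: "g \<in> I" "\<not> ordge (Suc (NE q)) (pullback q g)" by blast
  note d = dvd_ordge_monomial_at[OF axes_dvd[OF g(1), of q]]
  have le: "n1 q + n2 q \<le> NE q" using d(1) g(2) ordge_mono not_less_eq_eq by blast
  have "n1 q + n2 q \<noteq> NE q"
  proof
    assume e: "n1 q + n2 q = NE q"
    then have "monomial_at (n1 q) (n2 q) (pullback q g)" using d(2) g(2) by simp
    with g(1) assms show False unfolding mono_at_def by blast
  qed
  with le show ?thesis by simp
qed

lemma mono_at_child:
  assumes m: "mono_at q" and c: "c \<in> children q" shows "mono_at c"
proof -
  from m obtain f where f: "f \<in> I" "monomial_at (n1 q) (n2 q) (pullback q f)" by (auto simp: mono_at_def)
  from c consider t where "c = Slope q t" | "c = Vertical q" by (auto simp: children_def)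
  then show ?thesis
  proof cases
    case 1
    have "n1 c = n1 q + n2 q" using NE_mono[OF m] by (simp add: n1_def 1)
    moreover have "n2 c = (if t = 0 then n2 q else 0)" by (simp add: n2_def 1)
    ultimately have "monomial_at (n1 c) (n2 c) (pullback c f)"
      using monomial_at_Slope[OF f(2), of t] unfolding 1 pullback_Slope by simp
    with f(1) show ?thesis unfolding mono_at_def by blast
  next
    case 2
    have "n2 c = n1 q + n2 q" using NE_mono[OF m] by (simp add: n2_def 2)
    moreover have "n1 c = n1 q" by (simp add: n1_def 2)
    ultimately have "monomial_at (n1 c) (n2 c) (pullback c f)"
      using monomial_at_Vertical[OF f(2)] unfolding 2 by simp
    with f(1) show ?thesis unfolding mono_at_def by blast
  qed
qed

text \<open>This is \<nu> \<le> N + 1 for both axes. Children of monomial points are monomial, so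
  every predecessor of \<open>q\<close> is non-monomial. Each blow-up then adds at least 1 to
  \<open>n1 + n2\<close>, while the Jacobian multiplicity gains exactly 1 over its sum.\<close>

lemma not_mono_jac_mult:
  "\<not> mono_at q \<Longrightarrow> fst (jac_mult q) \<le> n1 q \<and> snd (jac_mult q) \<le> n2 q"
proof (induction q)
  case (Slope q t)
  then have nm: "\<not> mono_at q" using mono_at_child[of q "Slope q t"] by auto
  have ax: "n1 (Slope q t) = NE q" "n2 (Slope q t) = (if t = 0 then n2 q else 0)"
    by (simp_all add: n1_def n2_def)
  have "fst (jac_mult q) \<le> n1 q" "snd (jac_mult q) \<le> n2 q" using Slope.IH[OF nm] by blast+
  then show ?case unfolding ax using NE_not_mono[OF nm] by (cases "t = 0") simp_all
next
  case (Vertical q)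
  then have nm: "\<not> mono_at q" using mono_at_child[of q "Vertical q"] by auto
  have ax: "n2 (Vertical q) = NE q" "n1 (Vertical q) = n1 q" by (simp_all add: n1_def n2_def)
  have "fst (jac_mult q) \<le> n1 q" "snd (jac_mult q) \<le> n2 q" using Vertical.IH[OF nm] by blast+
  then show ?case unfolding ax using NE_not_mono[OF nm] by simp
qed simp

text \<open>A component consisting of one proper point could only be the origin, which normal
  crossings rule out; any other non-exceptional component is a curve with \<nu> = 1.\<close>

lemma through_cases:
  assumes q: "q \<in> X" "blow_down q = (0, 0)" and E: "E \<in> through q"
  shows "(\<exists>p\<in>B. (ax1 q = Some p \<or> ax2 q = Some p) \<and> E = excX p) \<or> num_nu X E = 1"
proof -
  have ET: "E \<in> T" "q \<in> E" using E by (auto simp: through_def)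
  from component_cases[OF ET(1)] show ?thesis
  proof
    assume "\<exists>p\<in>B. blow_down p \<in> Supp I \<and> E = excX p"
    then obtain p where p: "p \<in> B" "E = excX p" by blast
    with ET(2) have "ax1 q = Some p \<or> ax2 q = Some p" by (simp add: exc_def)
    with p show ?thesis by blast
  next
    assume nonexc: "\<forall>p\<in>B. \<not> E \<subseteq> exc p"
    have "E \<noteq> {Proper a b}" for a b
    proof
      assume e: "E = {Proper a b}"
      with ET(2) q(2) have e': "E = {Proper 0 0}" "Proper 0 0 \<in> X" using q(1) by auto
      with origin_not_component[OF origin(1) e'(2) snc[OF e'(2)]] ET(1) show False by simp
    qed
    then have "num_nu X E = 1" using nonexc by (intro nonexceptional_num_nu[OF ET(1)]) auto
    then show ?thesis ..
  qed
qed

text \<open>A non-exceptional component through \<open>q\<close> lies in a strict transform. A local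
  factor of that transform would divide the monomial and hence be an axis, but a strict transform
  contains no axis.\<close>

lemma through_mono:
  assumes q: "q \<in> X" "blow_down q = (0, 0)" and m: "mono_at q"
  shows "through q = excX ` {p. ax1 q = Some p \<or> ax2 q = Some p}"
proof (intro equalityI subsetI)
  fix E assume "E \<in> excX ` {p. ax1 q = Some p \<or> ax2 q = Some p}"
  then obtain p where p: "q \<in> exc p" "E = excX p" by (auto simp: exc_def)
  have "p \<in> B" by (rule exc_B[OF q(1) p(1)])
  moreover have "blow_down p \<in> Supp I" using exc_blow_down[OF p(1)] q(2) origin by simp
  ultimately show "E \<in> through q" using excX_component[of p] p q(1) by (simp add: through_def)
next
  fix E assume "E \<in> through q"
  then have ET: "E \<in> T" "q \<in> E" by (auto simp: through_def)
  from component_cases[OF ET(1)] show "E \<in> excX ` {p. ax1 q = Some p \<or> ax2 q = Some p}"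
  proof
    assume "\<exists>p\<in>B. blow_down p \<in> Supp I \<and> E = excX p"
    then obtain p where "p \<in> B" "E = excX p" by blast
    with ET(2) show ?thesis by (auto simp: exc_def)
  next
    assume nonexc: "\<forall>p\<in>B. \<not> E \<subseteq> exc p"
    from m obtain f g where f: "f \<in> I" "pullback q f = varx ^ n1 q * vary ^ n2 q * g" "eval2 g (0, 0) \<noteq> 0"
      by (auto simp: mono_at_def monomial_at_def)
    have "pullback q f \<noteq> 0"
    proof -
      have "g \<noteq> 0" "varx \<noteq> 0" "vary \<noteq> 0" using f(3) prime_elem_varx prime_elem_vary by auto
      then show ?thesis unfolding f(2) by simp
    qed
    then have f0: "f \<noteq> 0" by auto
    have "irreducible_closed ztop E" "E \<subseteq> Z" using ET(1) by (auto simp: component_iff)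
    then have "\<exists>F. irred F \<and> F dvd f \<and> E \<subseteq> St F"
      by (intro irreducible_in_zero_set) (use nonexc f0 f(1) in \<open>auto simp: Supp_def\<close>)
    then obtain F where F: "irred F" "F dvd f" "E \<subseteq> St F" by blast
    then have F0: "F \<noteq> 0" by auto
    have "eval2 (strict q F) (0, 0) = 0" using F(3) ET(2) by (auto simp: St_def)
    then obtain P where P: "irred P" "P dvd strict q F" "eval2 P (0, 0) = 0"
      using irreducible_factor_through[OF strict_nonzero[OF F0]] by blast
    have "pullback q F dvd pullback q f" using F(2) by (auto simp: dvd_def)
    then have "P dvd varx ^ n1 q * vary ^ n2 q * g"
      using P(2) strict_dvd_pullback[OF F0, of q] dvd_trans f(2) by metis
    moreover have "\<not> P dvd g" by (rule nonzero_at_0_not_dvd[OF f(3) P(3)])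
    ultimately consider "P dvd varx ^ n1 q" | "P dvd vary ^ n2 q"
      using irred_imp_prime[OF P(1)] by (auto simp: prime_elem_dvd_mult_iff)
    then have False
    proof cases
      case 1
      have "ax1 q \<noteq> None"
      proof
        assume "ax1 q = None"
        then have "is_unit P" using 1 by (simp add: n1_def)
        with P(1) show False by (simp add: Factorial_Ring.irreducible_def)
      qed
      moreover have "P dvd varx" using prime_elem_dvd_power[OF irred_imp_prime[OF P(1)] 1] .
      then have "varx dvd P" by (rule irred_dvd_irred[OF P(1) irreducible_varx])
      then have "varx dvd strict q F" using P(2) by (rule dvd_trans)
      ultimately show False using strict_not_dvd[OF F0, of q] by blast
    next
      case 2
      have "ax2 q \<noteq> None"
      proof
        assume "ax2 q = None"
        then have "is_unit P" using 2 by (simp add: n2_def)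
        with P(1) show False by (simp add: Factorial_Ring.irreducible_def)
      qed
      moreover have "P dvd vary" using prime_elem_dvd_power[OF irred_imp_prime[OF P(1)] 2] .
      then have "vary dvd P" by (rule irred_dvd_irred[OF P(1) irreducible_vary])
      then have "vary dvd strict q F" using P(2) by (rule dvd_trans)
      ultimately show False using strict_not_dvd[OF F0, of q] by blast
    qed
    then show ?thesis ..
  qed
qed

lemma axes_B: "q \<in> X \<Longrightarrow> ax1 q = Some p \<or> ax2 q = Some p \<Longrightarrow> p \<in> B"
  by (rule exc_B[of q p]) (simp_all add: exc_def)

lemma leaf_weight_axes:
  assumes q: "q \<in> X" and th: "through q = excX ` {p. ax1 q = Some p \<or> ax2 q = Some p}"
  shows "leaf_weight s q = 1 / (A1 s q * A2 s q)"
proof -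
  let ?S = "{p. ax1 q = Some p \<or> ax2 q = Some p}"
  have S: "?S = set_option (ax1 q) \<union> set_option (ax2 q)" by auto
  have sub: "?S \<subseteq> B" using axes_B[OF q] by blast
  have "leaf_weight s q = (\<Prod>p\<in>?S. factor s (excX p))"
    unfolding leaf_weight_def th by (subst prod.reindex) (use excX_inj sub inj_on_subset in auto)
  also have "\<dots> = (\<Prod>p\<in>?S. 1 / denom s p)"
    by (rule prod.cong) (use sub factor_excX in auto)
  also have "\<dots> = (\<Prod>p\<in>set_option (ax1 q). 1 / denom s p) * (\<Prod>p\<in>set_option (ax2 q). 1 / denom s p)"
    unfolding S by (rule prod.union_disjoint) (use ax1_neq_ax2 in auto)
  also have "\<dots> = 1 / (A1 s q * A2 s q)"
    unfolding A1_ax A2_ax by (cases "ax1 q"; cases "ax2 q") auto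
  finally show ?thesis .
qed

end

section \<open>Regularity outside the given set\<close>

locale generic_point = principalized +
  fixes s0 :: real
  assumes s0: "s0 \<notin> {-1..<0} \<union> {-1 - 1 / real i |i :: nat. i > 0}"
begin

text \<open>For N = 0 there is no root. Otherwise the root is -v/N, which lies in [-1, 0) for v
  \<le> N and equals -1 - 1/N for v = N + 1; \<open>s0\<close> avoids both.\<close>

lemma good_pair:
  assumes "1 \<le> (v::nat)" "v \<le> Suc N" shows "of_nat v + complex_of_real s0 * of_nat N \<noteq> 0"
proof
  assume "of_nat v + complex_of_real s0 * of_nat N = 0"
  then have "complex_of_real (real v + s0 * real N) = 0" by simp
  then have e: "real v + s0 * real N = 0" using of_real_eq_0_iff by blast
  then have N: "N > 0" using assms(1) by (cases N) auto
  then have s: "s0 = - (real v / real N)" using e by (simp add: field_simps)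
  show False
  proof (cases "v \<le> N")
    case True
    have "real v / real N \<le> 1" "0 < real v / real N" using True N assms(1) by simp_all
    then have "s0 \<in> {-1..<0}" using s by simp
    with s0 show False by blast
  next
    case False
    then have "v = Suc N" using assms(2) by simp
    moreover have e: "real (Suc N) / real N = 1 + 1 / real N" using N by (simp add: field_simps)
    ultimately have "s0 = - (1 + 1 / real N)" using s by (simp only: e)
    then have "s0 = -1 - 1 / real N" by simp
    with s0 N show False by blast
  qed
qed

abbreviation "c0 \<equiv> complex_of_real s0"

lemma not_mono_good:
  assumes "\<not> mono_at q" shows "A1 c0 q \<noteq> 0" "A2 c0 q \<noteq> 0" "denom c0 q \<noteq> 0"
proof -
  show "A1 c0 q \<noteq> 0" "A2 c0 q \<noteq> 0"
    unfolding A1_def A2_def using not_mono_jac_mult[OF assms] by (intro good_pair; simp)+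
  have "nu q \<le> Suc (NE q)"
    using not_mono_jac_mult[OF assms] NE_not_mono[OF assms] by (simp add: nu_def)
  then show "denom c0 q \<noteq> 0" unfolding denom_def by (intro good_pair) (simp_all add: nu_def)
qed

lemma has_lim_leaf:
  assumes q: "q \<in> X" "blow_down q = (0, 0)" and good: "A1 c0 q \<noteq> 0" "A2 c0 q \<noteq> 0"
  shows "has_lim c0 (\<lambda>s. leaf_weight s q)"
  unfolding leaf_weight_def
proof (rule has_lim_prod)
  fix E assume "E \<in> through q"
  from through_cases[OF q this] show "has_lim c0 (\<lambda>s. factor s E)"
  proof
    assume "\<exists>p\<in>B. (ax1 q = Some p \<or> ax2 q = Some p) \<and> E = excX p"
    then obtain p where p: "p \<in> B" "ax1 q = Some p \<or> ax2 q = Some p" "E = excX p" by blast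
    then have "denom c0 p \<noteq> 0" using good A1_ax[of c0 q] A2_ax[of c0 q] by auto
    then show ?thesis unfolding p(3) factor_excX[OF p(1)] denom_def by (rule has_lim_inverse_affine)
  next
    assume "num_nu X E = 1"
    then show ?thesis unfolding factor_def using good_pair[of 1 "num_N X I E"]
      by (intro has_lim_inverse_affine) simp
  qed
qed

end

locale generic_point_blown_up = generic_point + origin_blown_up
begin

lemma descendants_less:
  assumes q: "q \<in> B0" and c: "c \<in> special q"
  shows "card {r. r \<in> B0 \<union> L \<and> c \<in> anc r} < card {r. r \<in> B0 \<union> L \<and> q \<in> anc r}"
proof (rule psubset_card_mono)
  show "finite {r. r \<in> B0 \<union> L \<and> q \<in> anc r}" using finite_B0 finite_L by simp
  have ch: "c \<in> children q" using c by (simp add: special_def)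
  have "q \<in> anc c" using child_anc[OF ch] anc_refl[of q] by auto
  moreover have "c \<notin> anc q" by (rule child_not_anc[OF ch])
  ultimately have "q \<in> {r. r \<in> B0 \<union> L \<and> q \<in> anc r}" "q \<notin> {r. r \<in> B0 \<union> L \<and> c \<in> anc r}"
    "{r. r \<in> B0 \<union> L \<and> c \<in> anc r} \<subseteq> {r. r \<in> B0 \<union> L \<and> q \<in> anc r}"
    using q anc_trans[of q c] by simp_all blast
  then show "{r. r \<in> B0 \<union> L \<and> c \<in> anc r} \<subset> {r. r \<in> B0 \<union> L \<and> q \<in> anc r}" by blast
qed

text \<open>A non-special child lies on the curve over \<open>q\<close> and on no other component,
  so its second axis is missing and has factor 1.\<close>

lemma nonspecial_child_weight:
  assumes q: "q \<in> B0" "mono_at q" and c: "c \<in> children q" "c \<notin> special q"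
  shows "A1 s c * A2 s c = denom s q"
proof -
  have "c \<notin> B" using c by (simp add: special_def)
  have "card (through c) < 2" using c by (simp add: special_def not_le)
  from child_leaf_over_origin[OF q(1) c(1) \<open>c \<notin> B\<close>] have cX: "c \<in> X" "blow_down c = (0, 0)" by auto
  note th = through_mono[OF cX mono_at_child[OF q(2) c(1)]]
  have sub: "{p. ax1 c = Some p \<or> ax2 c = Some p} \<subseteq> B" using axes_B[OF cX(1)] by blast
  have "card {p. ax1 c = Some p \<or> ax2 c = Some p} < 2"
    using \<open>card (through c) < 2\<close> unfolding th
    by (subst (asm) card_image) (use excX_inj sub inj_on_subset in auto)
  have no: False if "ax1 c = Some p" "ax2 c = Some p'" for p p'
  proof -
    have "{p. ax1 c = Some p \<or> ax2 c = Some p} = {p, p'}" using that by auto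
    moreover have "p \<noteq> p'" using that ax1_neq_ax2 by blast
    ultimately show False using \<open>card {p. ax1 c = Some p \<or> ax2 c = Some p} < 2\<close> by simp
  qed
  have "ax1 c = Some q \<or> ax2 c = Some q" using c(1) by (auto simp: children_def)
  then show ?thesis
  proof
    assume a: "ax1 c = Some q"
    then have "ax2 c = None" using no by (cases "ax2 c") auto
    with a show ?thesis by (simp add: A1_ax A2_ax)
  next
    assume a: "ax2 c = Some q"
    then have "ax1 c = None" using no by (cases "ax1 c") auto
    with a show ?thesis by (simp add: A1_ax A2_ax)
  qed
qed

text \<open>Over a point where the ideal is monomial the contributions telescope, as they must because
  there the result does not depend on the blow-ups.\<close>

lemma tree_sum_mono:
  assumes "q \<in> B0 \<union> L" "mono_at q"
  shows "eventually (\<lambda>s. tree_sum s q = 1 / (A1 s q * A2 s q)) (at c0)"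
  using assms
proof (induction "card {r. r \<in> B0 \<union> L \<and> q \<in> anc r}" arbitrary: q rule: less_induct)
  case less
  show ?case
  proof (cases "q \<in> L")
    case True
    then have "q \<in> X" "blow_down q = (0, 0)" by (auto simp: L_def)
    then have "leaf_weight s q = 1 / (A1 s q * A2 s q)" for s
      by (intro leaf_weight_axes through_mono less.prems(2))
    then show ?thesis using tree_sum_leaf[OF True] by simp
  next
    case False
    then have q: "q \<in> B0" using less.prems by blast
    have qB: "q \<in> B" using q by (simp add: B0_def)
    define h where "h = (\<lambda>s c. 1 / (A1 s c * A2 s c))"
    \<comment> \<open>At a monomial point the weak transform has multiplicity 0, so N is additive
      just as \<nu> is.\<close>
    have denom: "denom s q = A1 s q + A2 s q" for s
      by (simp add: denom_def A1_def A2_def NE_mono[OF less.prems(2)] nu_def algebra_simps)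
    have IH: "eventually (\<lambda>s. tree_sum s c = h s c) (at c0)" if c: "c \<in> special q" for c
      unfolding h_def
    proof (rule less.hyps)
      show "card {r. r \<in> B0 \<union> L \<and> c \<in> anc r} < card {r. r \<in> B0 \<union> L \<and> q \<in> anc r}"
        by (rule descendants_less[OF q c])
      show "c \<in> B0 \<union> L" using special_subset[OF q] c by blast
      show "mono_at c" using mono_at_child[OF less.prems(2)] c by (simp add: special_def)
    qed
    have "eventually (\<lambda>s. \<forall>c\<in>special q. tree_sum s c = h s c) (at c0)"
      using IH by (intro eventually_ball_finite finite_special[OF q]) blast
    moreover have "eventually (\<lambda>s. A1 s q \<noteq> 0) (at c0)" "eventually (\<lambda>s. A2 s q \<noteq> 0) (at c0)"
      unfolding A1_def A2_def by (rule eventually_affine_nonzero; simp del: of_nat_Suc)+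
    moreover have "eventually (\<lambda>s. denom s q \<noteq> 0) (at c0)"
      unfolding denom_def by (rule eventually_affine_nonzero) (simp add: nu_def del: of_nat_Suc of_nat_add)
    ultimately show ?thesis
    proof eventually_elim
      case (elim s)
      let ?d = "denom s q" and ?a = "Slope q 0" and ?b = "Vertical q"
      \<comment> \<open>The crossings with the two old axes are added to the special points.
        Non-special members and members other than these crossings all have value
        \<open>1 / ?d\<close>, so summing \<open>h\<close> over \<open>?S\<close> in two ways
        eliminates the number of special points.\<close>
      let ?S = "special q \<union> {?a, ?b}"
      have finS: "finite ?S" using finite_special[OF q] by simp
      have chS: "c \<in> children q" if "c \<in> ?S" for c using that by (auto simp: special_def)
      have out: "h s c = 1 / ?d" if "c \<in> ?S - special q" for c
      proof -
        have "c \<in> children q" "c \<notin> special q" using chS[of c] that by blast+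
        then show ?thesis using nonspecial_child_weight[OF q less.prems(2)] by (simp add: h_def)
      qed
      have gen: "h s c = 1 / ?d" if "c \<in> ?S - {?a, ?b}" for c
      proof -
        from chS[of c] that obtain t where "c = Slope q t" "t \<noteq> 0" by (auto simp: children_def)
        then show ?thesis by (simp add: h_def A1_ax A2_ax)
      qed
      have ha: "h s ?a = 1 / (?d * A2 s q)" and hb: "h s ?b = 1 / (A1 s q * ?d)"
        by (simp_all add: h_def A1_ax A2_ax)
      have "sum (h s) ?S = sum (h s) (special q) + sum (h s) (?S - special q)"
        using finS by (metis add.commute sum.subset_diff sup_ge1)
      also have "sum (h s) (?S - special q) = of_nat (card (?S - special q)) / ?d"
      proof -
        have "sum (h s) (?S - special q) = (\<Sum>c\<in>?S - special q. 1 / ?d)" by (rule sum.cong[OF refl out])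
        then show ?thesis by simp
      qed
      also have "card (?S - special q) = card ?S - card (special q)"
        by (rule card_Diff_subset) (use finite_special[OF q] in auto)
      finally have 1: "sum (h s) ?S = sum (h s) (special q) + of_nat (card ?S - card (special q)) / ?d" .
      have "sum (h s) ?S = sum (h s) {?a, ?b} + sum (h s) (?S - {?a, ?b})"
        using finS by (metis add.commute sum.subset_diff sup_ge2)
      also have "sum (h s) (?S - {?a, ?b}) = of_nat (card (?S - {?a, ?b})) / ?d"
      proof -
        have "sum (h s) (?S - {?a, ?b}) = (\<Sum>c\<in>?S - {?a, ?b}. 1 / ?d)" by (rule sum.cong[OF refl gen])
        then show ?thesis by simp
      qed
      also have "card (?S - {?a, ?b}) = card ?S - 2"
        by (subst card_Diff_subset) auto
      also have "sum (h s) {?a, ?b} = 1 / (?d * A2 s q) + 1 / (A1 s q * ?d)"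
        using ha hb by simp
      finally have 2: "sum (h s) ?S = 1 / (?d * A2 s q) + 1 / (A1 s q * ?d) + of_nat (card ?S - 2) / ?d" .
      have c1: "card (special q) \<le> card ?S" and c2: "2 \<le> card ?S"
        using card_mono[OF finS, of "special q"] card_mono[OF finS, of "{?a, ?b}"] by auto
      have n1: "(of_nat (card ?S - card (special q)) :: complex) = of_nat (card ?S) - of_nat (card (special q))"
        and n2: "(of_nat (card ?S - 2) :: complex) = of_nat (card ?S) - 2"
        using c1 c2 by (simp_all add: of_nat_diff)
      have "tree_sum s q = (2 - of_nat (card (special q))) / ?d + sum (h s) (special q)"
        unfolding tree_sum_branch[OF q] using elim(1) by simp
      also have "sum (h s) (special q) =
          1 / (?d * A2 s q) + 1 / (A1 s q * ?d) + of_nat (card ?S - 2) / ?d - of_nat (card ?S - card (special q)) / ?d"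
        using 1 2 by (simp add: algebra_simps)
      also have "(2 - of_nat (card (special q))) / ?d + \<dots> = 1 / (?d * A2 s q) + 1 / (A1 s q * ?d)"
        unfolding n1 n2 using elim(4) by (simp add: field_simps)
      \<comment> \<open>The common numerator \<open>A1 + A2\<close> equals \<open>?d\<close> and
        cancels it: the candidate pole of the new curve disappears.\<close>
      also have "\<dots> = 1 / (A1 s q * A2 s q)"
        using elim(2-4) unfolding denom by (simp add: divide_simps)
      finally show "tree_sum s q = 1 / (A1 s q * A2 s q)" .
    qed
  qed
qed

text \<open>At a monomial point the closed form is regular. Elsewhere the recursion introduces only
  the factor of the curve over \<open>q\<close>, which is nonzero at \<open>c0\<close>, and the axes
  of a child are this curve and possibly an old axis.\<close>

lemma has_lim_tree_sum:
  assumes "q \<in> B0 \<union> L" "A1 c0 q \<noteq> 0" "A2 c0 q \<noteq> 0"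
  shows "has_lim c0 (\<lambda>s. tree_sum s q)"
  using assms
proof (induction "card {r. r \<in> B0 \<union> L \<and> q \<in> anc r}" arbitrary: q rule: less_induct)
  case less
  consider "mono_at q" | "\<not> mono_at q" "q \<in> L" | "\<not> mono_at q" "q \<in> B0" using less.prems(1) by blast
  then show ?case
  proof cases
    case 1
    have "has_lim c0 (\<lambda>s. 1 / A1 s q * (1 / A2 s q))"
      using less.prems(2,3) unfolding A1_def A2_def by (intro has_lim_mult has_lim_inverse_affine)
    then have "has_lim c0 (\<lambda>s. 1 / (A1 s q * A2 s q))" by simp
    then show ?thesis using tree_sum_mono[OF less.prems(1) 1] by (rule has_lim_cong)
  next
    case 2
    then show ?thesis unfolding tree_sum_leaf[OF 2(2)]
      using less.prems by (intro has_lim_leaf) (auto simp: L_def)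
  next
    case 3
    note good = not_mono_good[OF 3(1)]
    have "has_lim c0 (\<lambda>s. tree_sum s c)" if c: "c \<in> special q" for c
    proof (rule less.hyps)
      show "card {r. r \<in> B0 \<union> L \<and> c \<in> anc r} < card {r. r \<in> B0 \<union> L \<and> q \<in> anc r}"
        by (rule descendants_less[OF 3(2) c])
      show "c \<in> B0 \<union> L" using special_subset[OF 3(2)] c by blast
      have "c \<in> children q" using c by (simp add: special_def)
      then consider t where "c = Slope q t" | "c = Vertical q" by (auto simp: children_def)
      then have "A1 c0 c \<noteq> 0 \<and> A2 c0 c \<noteq> 0"
      proof cases
        case 1
        then show ?thesis using good A2_ax[of c0 q] by (simp add: A1_ax A2_ax)
      next
        case 2
        then show ?thesis using good A1_ax[of c0 q] by (simp add: A1_ax A2_ax)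
      qed
      then show "A1 c0 c \<noteq> 0" "A2 c0 c \<noteq> 0" by auto
    qed
    then show ?thesis unfolding tree_sum_branch[OF 3(2)]
      using good(3) unfolding denom_def by (intro has_lim_add has_lim_sum has_lim_inverse_affine)
  qed
qed

end

context generic_point
begin

lemma zeta_not_pole: "\<not> is_pole (zeta_of X I) c0"
proof (rule has_lim_not_pole)
  have good: "A1 c0 (Proper 0 0) \<noteq> 0" "A2 c0 (Proper 0 0) \<noteq> 0" by (simp_all add: A1_ax A2_ax)
  consider "infinite T" | "finite T" "Proper 0 0 \<notin> B" | "finite T" "Proper 0 0 \<in> B" by blast
  then show "has_lim c0 (zeta_of X I)"
  proof cases
    case 1
    then have "zeta_of X I = (\<lambda>s. 0)" by (intro ext zeta_of_infinite)
    then show ?thesis by simp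
  next
    case 2
    have "Proper 0 0 \<in> X" using 2 origin by (simp add: X_iff)
    then have "has_lim c0 (\<lambda>s. leaf_weight s (Proper 0 0))" by (intro has_lim_leaf good) auto
    moreover have "zeta_of X I = (\<lambda>s. leaf_weight s (Proper 0 0))"
      by (rule ext) (rule zeta_of_not_blown_up[OF 2])
    ultimately show ?thesis by simp
  next
    case 3
    interpret G: generic_point_blown_up U B X I f0 s0
      by unfold_locales (use 3 in auto)
    have "Proper 0 0 \<in> B0 \<union> L" using 3 by (simp add: B0_def)
    then have "has_lim c0 (\<lambda>s. tree_sum s (Proper 0 0))" by (rule G.has_lim_tree_sum[OF _ good])
    moreover have "zeta_of X I = (\<lambda>s. tree_sum s (Proper 0 0))"
      by (rule ext) (rule G.zeta_of_tree_sum)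
    ultimately show ?thesis by simp
  qed
qed

end

lemma pole_in_set:
  assumes I: "is_ideal I" "I \<noteq> {0}" "(0, 0) \<in> Supp I" and Z: "local_top_zeta I Z" "is_pole Z (of_real s0)"
  shows "s0 \<in> {-1..<0} \<union> {-1 - 1 / real i |i :: nat. i > 0}"
proof (rule ccontr)
  assume s0: "s0 \<notin> {-1..<0} \<union> {-1 - 1 / real i |i :: nat. i > 0}"
  from Z(1) obtain X U where Zx: "Z = zeta_of X I" "zariski_open_plane U" "(0, 0) \<in> U"
    "iterated_blow_up U X" "\<forall>q\<in>X. snc_at I q"
    by (auto simp: local_top_zeta_def principalization_def)
  from iterated_blow_up_surf[OF Zx(4)] obtain B where Bx: "blow_centres U B" "X = surf U B" by blast
  have "0 \<in> I" using I(1) Modules.module.subspace_0[OF module_times] by (auto simp: is_ideal_def)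
  with I(2) obtain f0 where f0: "f0 \<in> I" "f0 \<noteq> 0" by blast
  interpret generic_point U B X I f0 s0
    by unfold_locales (use Zx Bx f0 I s0 in auto)
  from zeta_not_pole Z(2) show False unfolding Zx(1) by (rule notE)
qed

section \<open>Ideals realizing the poles\<close>

text \<open>Successive points on the strict transforms of the line y = 0, which has slope 0 in each
  of these charts.\<close>

primrec pp :: "nat \<Rightarrow> pt" where
  "pp 0 = Proper 0 0"
| "pp (Suc j) = Slope (pp j) 0"

lemma size_pp: "size (pp j) = j"
  by (induction j) auto

lemma pp_eq_iff [simp]: "pp i = pp j \<longleftrightarrow> i = j"
  using size_pp by metis

lemma pp_neq_Vertical [simp]: "pp i \<noteq> Vertical p" "Vertical p \<noteq> pp i"
  by (cases i; simp)+

lemma pp_child: "pp i \<in> children (pp j) \<Longrightarrow> i = Suc j"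
  by (cases i) auto

lemma anc_pp: "anc (pp j) = pp ` {..j}"
  by (induction j) (auto simp: atMost_Suc)

lemma blow_down_pp [simp]: "blow_down (pp j) = (0, 0)"
  by (induction j) auto

lemma ax2_pp [simp]: "ax2 (pp j) = None"
  by (induction j) auto

lemma ax1_pp: "ax1 (pp j) = (if j = 0 then None else Some (pp (j - 1)))"
  by (cases j) auto

lemma jac_mult_pp: "jac_mult (pp j) = (j, 0)"
  by (induction j) auto

lemma pullback_pp_Suc: "pullback (pp (Suc j)) f = blow_x (pullback (pp j) f)"
  unfolding pp.simps pullback_Slope by simp

lemma pullback_pp_monomial: "pullback (pp j) (varx ^ a * vary ^ b) = varx ^ (a + j * b) * vary ^ b"
proof (induction j)
  case 0
  show ?case by (rule eval2_ext) (simp add: eval2_subst2)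
next
  case (Suc j)
  show ?case unfolding pullback_pp_Suc Suc by (simp add: power_mult_distrib power_add mult_ac)
qed

definition centres :: "nat \<Rightarrow> pt set" where "centres n = pp ` {..<n}"

lemma centres_Suc: "centres (Suc n) = insert (pp n) (centres n)"
  by (simp add: centres_def lessThan_Suc)

lemma pp_in_centres [simp]: "pp j \<in> centres n \<longleftrightarrow> j < n"
  by (auto simp: centres_def)

lemma chain_blow_up:
  "blow_centres UNIV (centres n) \<and> iterated_blow_up UNIV (surf UNIV (centres n))"
proof (induction n)
  case 0
  show ?case using iterated_blow_up.plane[of UNIV] by (simp add: centres_def blow_centres_def surf_empty)
next
  case (Suc n)
  have "panc (pp n) \<subseteq> centres n" unfolding anc_pp by (auto simp: le_less)
  then have p: "pp n \<in> surf UNIV (centres n)" by (simp add: surf_def)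
  then show ?case using Suc surf_insert[of UNIV "centres n" "pp n"] iterated_blow_up.blow_up[of UNIV _ "pp n"]
    by (simp add: centres_Suc)
qed

lemma zariski_open_UNIV: "zariski_open_plane UNIV"
  unfolding zariski_open_plane_def by (intro exI[of _ "{1}"]) auto

lemma ordge_add: "ordge k f \<Longrightarrow> ordge k g \<Longrightarrow> ordge k (f + g)"
  by (simp add: ordge_def)

text \<open>The monomials \<open>x\<^sup>a y\<^sup>b\<close> of this ideal are those with \<open>a + b > r\<close> and \<open>a + n b \<ge> r + n\<close>.\<close>

definition chain_ideal :: "nat \<Rightarrow> nat \<Rightarrow> complex poly poly set" where
  "chain_ideal r n = {f. \<forall>j<n. ordge (Suc (r + j)) (pullback (pp j) f)}"

lemma pullback_add: "pullback q (f + g) = pullback q f + pullback q g"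
  by (rule eval2_ext) (simp add: eval2_pullback)

lemma is_ideal_chain: "is_ideal (chain_ideal r n)"
  unfolding is_ideal_def
proof (rule Modules.module.subspaceI[OF module_times])
  show "0 \<in> chain_ideal r n" by (simp add: chain_ideal_def ordge_def)
  show "f + g \<in> chain_ideal r n" if "f \<in> chain_ideal r n" "g \<in> chain_ideal r n" for f g
    using that by (simp add: chain_ideal_def pullback_add ordge_add)
  show "c * f \<in> chain_ideal r n" if "f \<in> chain_ideal r n" for c f
    using that ordge_mult[of 0 "pullback _ c" _ "pullback _ f"] by (simp add: chain_ideal_def)
qed

lemma monomial_in_chain:
  assumes "\<And>j. j < n \<Longrightarrow> Suc (r + j) \<le> a + j * b + b"
  shows "varx ^ a * vary ^ b \<in> chain_ideal r n"
  unfolding chain_ideal_def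
proof (intro CollectI allI impI)
  fix j assume "j < n"
  show "ordge (Suc (r + j)) (pullback (pp j) (varx ^ a * vary ^ b))"
    unfolding pullback_pp_monomial by (rule ordge_mono[OF ordge_varx_vary assms[OF \<open>j < n\<close>]])
qed

lemma varx_in_chain: "varx ^ (r + n) \<in> chain_ideal r n"
  using monomial_in_chain[of n r "r + n" 0] by simp

lemma vary_in_chain: "vary ^ Suc r \<in> chain_ideal r n"
proof -
  have "Suc (r + j) \<le> 0 + j * Suc r + Suc r" for j by simp
  from monomial_in_chain[of n r 0 "Suc r", OF this] show ?thesis by simp
qed

lemma varx_vary_in_chain: "varx ^ r * vary \<in> chain_ideal r n"
  using monomial_in_chain[of n r r 1] by simp

lemma pullback_pp_varx_vary: "pullback (pp j) (varx ^ r * vary) = varx ^ (r + j) * vary"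
  using pullback_pp_monomial[of j r 1] by simp

lemma pullback_pp_varx: "pullback (pp j) (varx ^ k) = varx ^ k"
  using pullback_pp_monomial[of j k 0] by simp

text \<open>Powers of both variables lie in the ideal, so the origin is its only zero. Hence all
  components will be exceptional.\<close>

lemma Supp_chain:
  assumes "n > 0" shows "Supp (chain_ideal r n) = {(0, 0)}"
proof (intro equalityI subsetI)
  fix w assume w: "w \<in> Supp (chain_ideal r n)"
  then have "eval2 (varx ^ (r + n)) w = 0" "eval2 (vary ^ Suc r) w = 0"
    using varx_in_chain[of r n] vary_in_chain[of r n] unfolding Supp_def by blast+
  then show "w \<in> {(0, 0)}" by (cases w) auto
next
  fix w assume "w \<in> {(0::complex, 0::complex)}"
  moreover have "eval2 f (0, 0) = 0" if f: "f \<in> chain_ideal r n" for f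
  proof -
    have "ordge (Suc 0) (pullback (pp 0) f)" using f assms ordge_mono[of "Suc (r + 0)" _ "Suc 0"]
      by (auto simp: chain_ideal_def simp del: pp.simps)
    then show ?thesis by (simp add: ordge_1_iff eval2_subst2)
  qed
  ultimately show "w \<in> Supp (chain_ideal r n)" by (simp add: Supp_def)
qed

section \<open>The surface of the chain and its zeta function\<close>

locale chain =
  fixes r n :: nat
  assumes n: "n > 0"
begin

abbreviation "J \<equiv> chain_ideal r n"
abbreviation "Xn \<equiv> surf UNIV (centres n)"

lemma in_Xn: "q \<in> Xn \<longleftrightarrow> q \<notin> centres n \<and> panc q \<subseteq> centres n"
  by (simp add: surf_def)

text \<open>The direction of slope 0 at \<open>pp j\<close> is the next centre unless
  \<open>pp j\<close> is the last one, where that direction stays in the surface.\<close>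

lemma Xn_cases:
  assumes "q \<in> Xn"
  obtains a b where "q = Proper a b" "(a, b) \<noteq> (0, 0)"
  | j t where "q = Slope (pp j) t" "j < n" "t \<noteq> 0 \<or> Suc j = n"
  | j where "q = Vertical (pp j)" "j < n"
proof (cases q)
  case (Proper a b)
  have "(a, b) \<noteq> (0, 0)"
  proof
    assume "(a, b) = (0, 0)"
    then have "q = pp 0" using Proper by simp
    then show False using assms n in_Xn pp_in_centres[of 0 n] by simp
  qed
  with Proper show ?thesis by (rule that(1))
next
  case (Slope p t)
  have "p \<in> panc q" using Slope by simp
  then have "p \<in> centres n" using assms in_Xn by blast
  then obtain j where j: "p = pp j" "j < n" by (auto simp: centres_def)
  have "t \<noteq> 0 \<or> Suc j = n"
  proof (rule ccontr)
    assume "\<not> ?thesis"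
    then have "q = pp (Suc j)" "Suc j < n" using Slope j by auto
    then show False using assms in_Xn pp_in_centres by blast
  qed
  with Slope j show ?thesis using that(2) by blast
next
  case (Vertical p)
  have "p \<in> panc q" using Vertical by simp
  then have "p \<in> centres n" using assms in_Xn by blast
  then obtain j where "p = pp j" "j < n" by (auto simp: centres_def)
  with Vertical show ?thesis using that(3) by blast
qed

text \<open>A member attaining both lower bounds up to a unit generates the ideal locally, and the
  chart coordinates serve as parameters.\<close>

lemma local_ideal_J:
  assumes "\<And>f. f \<in> J \<Longrightarrow> varx ^ a dvd pullback q f" "\<And>f. f \<in> J \<Longrightarrow> vary ^ b dvd pullback q f"
    and "f \<in> J" "pullback q f = varx ^ a * vary ^ b * h" "eval2 h (0, 0) \<noteq> 0"
  shows "snc_at J q"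
proof -
  have "local_ideal (pullback q ` J) = local_ideal {varx ^ a * vary ^ b}"
  proof (rule local_ideal_principal[of _ _ h])
    show "varx ^ a * vary ^ b dvd s" if "s \<in> pullback q ` J" for s
      using that varx_vary_dvd assms(1,2) by auto
    show "varx ^ a * vary ^ b * h \<in> pullback q ` J" using assms(3,4) by (metis imageI)
  qed (rule assms(5))
  then show ?thesis unfolding snc_at_def local_parameters_def by blast
qed

text \<open>Which member generates depends on the point: \<open>vary ^ Suc r\<close> at the vertical
  direction of the first centre, \<open>varx ^ (r + n)\<close> at the end of the chain,
  \<open>varx ^ r * vary\<close> at all other exceptional points. Away from the origin the ideal is
  trivial.\<close>

lemma snc_chain:
  assumes q: "q \<in> Xn" shows "snc_at J q"
  using q
proof (cases rule: Xn_cases)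
  case (1 a b)
  have e: "eval2 (pullback q f) (0, 0) = eval2 f (a, b)" for f
    using eval2_pullback[of q f "(0, 0)"] 1 by simp
  have "\<exists>f\<in>J. eval2 f (a, b) \<noteq> 0"
  proof (cases "a = 0")
    case True
    then have "eval2 (vary ^ Suc r) (a, b) \<noteq> 0" using 1(2) by simp
    with vary_in_chain show ?thesis by blast
  next
    case False
    then have "eval2 (varx ^ (r + n)) (a, b) \<noteq> 0" by simp
    with varx_in_chain show ?thesis by blast
  qed
  then obtain f where "f \<in> J" "eval2 (pullback q f) (0, 0) \<noteq> 0" using e by auto
  then show ?thesis by (intro local_ideal_J[of 0 q 0 f "pullback q f"]) simp_all
next
  case (2 j t)
  have dvd: "varx ^ Suc (r + j) dvd pullback q f" if "f \<in> J" for f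
    unfolding 2(1) pullback_Slope varx_dvd_shift_y varx_dvd_blow_x
    using that 2(2) by (simp add: chain_ideal_def)
  show ?thesis
  proof (cases "t = 0")
    case True
    then have e: "q = pp n" "Suc (r + j) = r + n" using 2 by auto
    have "pullback q (varx ^ (r + n)) = varx ^ Suc (r + j) * vary ^ 0 * 1"
      unfolding e(1) pullback_pp_varx e(2) by simp
    with dvd varx_in_chain show ?thesis by (intro local_ideal_J[of "Suc (r + j)" q 0 "varx ^ (r + n)" 1]) simp_all
  next
    case False
    have "pullback q (varx ^ r * vary) = varx ^ Suc (r + j) * vary ^ 0 * (const2 t + vary)"
      unfolding 2(1) pullback_Slope pullback_pp_varx_vary by (simp add: mult_ac)
    with dvd varx_vary_in_chain False show ?thesis
      by (intro local_ideal_J[of "Suc (r + j)" q 0 "varx ^ r * vary" "const2 t + vary"]) simp_all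
  qed
next
  case (3 j)
  have dvd: "vary ^ Suc (r + j) dvd pullback q f" if "f \<in> J" for f
    unfolding 3(1) pullback.simps vary_dvd_blow_y
    using that 3(2) by (simp add: chain_ideal_def)
  show ?thesis
  proof (cases j)
    case 0
    have "pullback q (vary ^ Suc r) = varx ^ 0 * vary ^ Suc (r + j) * 1"
      unfolding 3(1) pullback.simps 0
      using pullback_pp_monomial[of 0 0 "Suc r"] by (simp del: pp.simps)
    with dvd vary_in_chain show ?thesis
      by (intro local_ideal_J[of 0 q "Suc (r + j)" "vary ^ Suc r" 1]) simp_all
  next
    case (Suc i)
    have dvdx: "varx ^ (r + j) dvd pullback q f" if "f \<in> J" for f
      unfolding 3(1) pullback.simps varx_dvd_blow_y unfolding Suc pullback_pp_Suc varx_dvd_blow_x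
      using that 3(2) Suc by (simp add: chain_ideal_def)
    have "pullback q (varx ^ r * vary) = varx ^ (r + j) * vary ^ Suc (r + j) * 1"
      unfolding 3(1) pullback.simps pullback_pp_varx_vary by (simp add: power_mult_distrib mult_ac)
    with dvd dvdx varx_vary_in_chain show ?thesis
      by (intro local_ideal_J[of "r + j" q "Suc (r + j)" "varx ^ r * vary" 1]) simp_all
  qed
qed

sublocale principalized UNIV "centres n" Xn J "varx ^ (r + n)"
proof unfold_locales
  show "varx ^ (r + n) \<noteq> 0" using prime_elem_varx by (auto simp: prime_elem_def)
qed (use zariski_open_UNIV chain_blow_up varx_in_chain snc_chain Supp_chain n in auto)

lemma T_eq: "T = excX ` centres n"
proof (intro equalityI subsetI)
  fix E assume E: "E \<in> T"
  from component_cases[OF E] show "E \<in> excX ` centres n"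
  proof
    assume nonexc: "\<forall>p\<in>centres n. \<not> E \<subseteq> exc p"
    have irr: "irreducible_closed ztop E" and EZ: "E \<subseteq> Z" using E by (auto simp: component_iff)
    have "E \<subseteq> \<Union>(excX ` centres n)"
    proof
      fix q assume "q \<in> E"
      then have q: "q \<in> Xn" "blow_down q = (0, 0)" using EZ Supp_chain[OF n] by auto
      from q(1) show "q \<in> \<Union>(excX ` centres n)"
      proof (cases rule: Xn_cases)
        case (1 a b)
        then show ?thesis using q(2) by simp
      next
        case (2 j t)
        then have "q \<in> excX (pp j)" "pp j \<in> centres n" using q(1) by simp_all
        then show ?thesis by blast
      next
        case (3 j)
        then have "q \<in> excX (pp j)" "pp j \<in> centres n" using q(1) by simp_all
        then show ?thesis by blast
      qed
    qed
    then have "\<exists>A\<in>excX ` centres n. E \<subseteq> A"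
      by (intro irreducible_closed_Union[OF irr]) (use finite_B closedin_excX in auto)
    with nonexc show ?thesis by blast
  qed blast
next
  fix E assume "E \<in> excX ` centres n"
  then obtain j where "j < n" "E = excX (pp j)" by (auto simp: centres_def)
  then show "E \<in> T" using excX_component[of "pp j"] Supp_chain[OF n] by simp
qed

sublocale origin_blown_up UNIV "centres n" Xn J "varx ^ (r + n)"
proof unfold_locales
  show "finite T" unfolding T_eq using finite_B by simp
  show "Proper 0 0 \<in> centres n" using pp_in_centres[of 0 n] n by simp
qed

lemma B0_eq: "B0 = centres n"
  unfolding B0_def by (auto simp: centres_def)

lemma through_chain:
  assumes "q \<in> Xn" shows "through q = excX ` {p. ax1 q = Some p \<or> ax2 q = Some p}"
proof (intro equalityI subsetI)
  fix E assume "E \<in> through q"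
  then obtain p where "E = excX p" "q \<in> exc p" unfolding through_def T_eq by blast
  then show "E \<in> excX ` {p. ax1 q = Some p \<or> ax2 q = Some p}" by (auto simp: exc_def)
next
  fix E assume "E \<in> excX ` {p. ax1 q = Some p \<or> ax2 q = Some p}"
  then obtain p where p: "E = excX p" "q \<in> exc p" by (auto simp: exc_def)
  then have "p \<in> centres n" using exc_B[OF assms] by blast
  with p assms show "E \<in> through q" unfolding through_def T_eq by blast
qed

lemma card_through:
  assumes "q \<in> Xn" shows "card (through q) = card {p. ax1 q = Some p \<or> ax2 q = Some p}"
proof -
  have "{p. ax1 q = Some p \<or> ax2 q = Some p} \<subseteq> centres n" using axes_B[OF assms] by blast
  then show ?thesis unfolding through_chain[OF assms]
    by (intro card_image inj_on_subset[OF excX_inj])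
qed

lemma Vertical_in_Xn: "j < n \<Longrightarrow> Vertical (pp j) \<in> Xn"
  unfolding in_Xn panc_child anc_pp by (auto simp: centres_def)

text \<open>Slope 0 leads to the next centre, and the vertical direction is the crossing with the
  previous curve. At either end of the chain one of them is missing.\<close>

lemma special_chain:
  assumes j: "j < n"
  shows "special (pp j) = (if Suc j < n then {pp (Suc j)} else {}) \<union> (if j > 0 then {Vertical (pp j)} else {})"
proof (intro equalityI subsetI)
  fix c assume c: "c \<in> special (pp j)"
  then have ch: "c \<in> children (pp j)" by (simp add: special_def)
  show "c \<in> (if Suc j < n then {pp (Suc j)} else {}) \<union> (if j > 0 then {Vertical (pp j)} else {})"
  proof (cases "c \<in> centres n")
    case True
    then obtain i where i: "c = pp i" "i < n" by (auto simp: centres_def)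
    then have "i = Suc j" using ch pp_child by blast
    with i show ?thesis by (simp del: pp.simps)
  next
    case False
    then have cX: "c \<in> Xn" using children_in_X[of "pp j" c] ch j by simp
    have two: "2 \<le> card {p. ax1 c = Some p \<or> ax2 c = Some p}"
      using c False unfolding special_def card_through[OF cX, symmetric] by blast
    from ch consider t where "c = Slope (pp j) t" | "c = Vertical (pp j)" by (auto simp: children_def)
    then show ?thesis
    proof cases
      case 1
      then have "{p. ax1 c = Some p \<or> ax2 c = Some p} = {pp j}" by auto
      with two show ?thesis by simp
    next
      case 2
      then have "{p. ax1 c = Some p \<or> ax2 c = Some p} = {pp j}" if "j = 0" using that by auto
      with two 2 show ?thesis by (cases "j = 0") auto
    qed
  qed
next
  fix c assume c: "c \<in> (if Suc j < n then {pp (Suc j)} else {}) \<union> (if j > 0 then {Vertical (pp j)} else {})"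
  then consider "c = pp (Suc j)" "Suc j < n" | "c = Vertical (pp j)" "j > 0" by (auto split: if_splits)
  then show "c \<in> special (pp j)"
  proof cases
    case 1
    then have "c \<in> centres n" by (simp del: pp.simps)
    with 1 show ?thesis by (simp add: special_def)
  next
    case 2
    have "{p. ax1 c = Some p \<or> ax2 c = Some p} = {pp (j - 1), pp j}" using 2 by (auto simp: ax1_pp)
    then have "card {p. ax1 c = Some p \<or> ax2 c = Some p} = 2" using 2(2) by simp
    then have "card (through c) = 2" using card_through[OF Vertical_in_Xn[OF j]] 2(1) by simp
    with 2 show ?thesis by (simp add: special_def)
  qed
qed

text \<open>The lower bound is the condition defining the ideal, and \<open>varx ^ r * vary\<close>
  attains it.\<close>

lemma NE_pp:
  assumes "j < n" shows "NE (pp j) = Suc (r + j)"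
proof (rule antisym)
  have "monomial_at (r + j) 1 (pullback (pp j) (varx ^ r * vary))"
    unfolding pullback_pp_varx_vary monomial_at_def by (intro exI[of _ 1]) simp
  then have no: "\<not> ordge (Suc (Suc (r + j))) (pullback (pp j) (varx ^ r * vary))"
    using monomial_at_not_ordge by fastforce
  show "NE (pp j) \<le> Suc (r + j)"
  proof (rule ccontr)
    assume "\<not> NE (pp j) \<le> Suc (r + j)"
    then have "Suc (Suc (r + j)) \<le> NE (pp j)" by simp
    with NE(1)[OF varx_vary_in_chain, of "pp j"] no show False using ordge_mono by blast
  qed
  from NE(2)[of "pp j"] obtain f where f: "f \<in> J" "\<not> ordge (Suc (NE (pp j))) (pullback (pp j) f)" by blast
  then have "ordge (Suc (r + j)) (pullback (pp j) f)" using assms by (simp add: chain_ideal_def)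
  show "Suc (r + j) \<le> NE (pp j)"
  proof (rule ccontr)
    assume "\<not> Suc (r + j) \<le> NE (pp j)"
    then have "Suc (NE (pp j)) \<le> Suc (r + j)" by simp
    with \<open>ordge (Suc (r + j)) (pullback (pp j) f)\<close> f(2) show False using ordge_mono by blast
  qed
qed

text \<open>The linear factor of the curve over \<open>pp j\<close>. Centres are numbered from 0, so
  the data are \<nu> = j + 2 and N = r + j + 1.\<close>

definition dn :: "complex \<Rightarrow> nat \<Rightarrow> complex" where
  "dn s j = of_nat (j + 2) + s * of_nat (Suc (r + j))"

lemma denom_pp: "j < n \<Longrightarrow> denom s (pp j) = dn s j"
  by (simp add: denom_def dn_def NE_pp nu_def jac_mult_pp)

text \<open>\<nu> and N both grow by 1 along the chain, so the factors form an arithmetic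
  progression; this keeps the partial sums simple.\<close>

lemma dn_diff: "dn s (j + k) = dn s j + of_nat k * (1 + s)"
  by (simp add: dn_def algebra_simps)

lemma tree_sum_Vertical:
  assumes "j < n" "j > 0"
  shows "tree_sum s (Vertical (pp j)) = 1 / (dn s (j - 1) * dn s j)"
proof -
  let ?v = "Vertical (pp j)"
  have vX: "?v \<in> Xn" by (rule Vertical_in_Xn[OF assms(1)])
  have "?v \<in> special (pp j)" using special_chain[OF assms(1)] assms(2) by simp
  then have "?v \<in> L" using special_subset[of "pp j"] assms(1) vX in_Xn unfolding B0_eq by auto
  then have "tree_sum s ?v = leaf_weight s ?v" by (rule tree_sum_leaf)
  also have "\<dots> = 1 / (A1 s ?v * A2 s ?v)" by (rule leaf_weight_axes[OF vX through_chain[OF vX]])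
  also have "\<dots> = 1 / (dn s (j - 1) * dn s j)"
    using assms by (simp add: A1_ax A2_ax ax1_pp denom_pp)
  finally show ?thesis .
qed

text \<open>Induction from the end of the chain, where \<open>k\<close> is the distance from the
  last centre. An inner line has two punctures and \<chi> = 0, so each step only adds the crossing
  with the previous curve; the last line has one puncture.\<close>

lemma tree_sum_pp:
  assumes nz: "\<And>j. j < n \<Longrightarrow> dn s j \<noteq> 0" and j: "Suc k < n"
  shows "tree_sum s (pp (n - 1 - k)) = (dn s (n - 2 - k) + of_nat (Suc k)) / (dn s (n - 2 - k) * dn s (n - 1))"
  using j
proof (induction k)
  case 0
  then obtain m where m: "n = Suc (Suc m)" by (cases n; cases "n - 1") auto
  have mn: "Suc m < n" using m by simp
  have sp: "special (pp (Suc m)) = {Vertical (pp (Suc m))}"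
    using special_chain[OF mn] m by (simp del: pp.simps)
  have B: "pp (Suc m) \<in> B0" using mn by (simp add: B0_eq del: pp.simps)
  have z: "dn s (Suc m) \<noteq> 0" "dn s m \<noteq> 0" using nz m by auto
  have V: "tree_sum s (Vertical (pp (Suc m))) = 1 / (dn s m * dn s (Suc m))"
    using tree_sum_Vertical[OF mn] by (simp del: pp.simps)
  have "tree_sum s (pp (Suc m)) = 1 / dn s (Suc m) + 1 / (dn s m * dn s (Suc m))"
    unfolding tree_sum_branch[OF B] sp denom_pp[OF mn] using V by (simp del: pp.simps)
  also have "\<dots> = (dn s m + 1) / (dn s m * dn s (Suc m))"
    using z by (simp add: divide_simps)
  finally show ?case using m by (simp del: pp.simps)
next
  case (Suc k)
  define i where "i = n - 2 - Suc k"
  have i: "n - 1 - Suc k = Suc i" "n - 2 - k = Suc i" "n - 1 - k = Suc (Suc i)" "n - 1 = Suc i + Suc k" "Suc (Suc i) < n"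
    using Suc.prems by (auto simp: i_def)
  have sp: "special (pp (Suc i)) = {pp (Suc (Suc i)), Vertical (pp (Suc i))}"
    using special_chain[of "Suc i"] i by (auto simp del: pp.simps)
  have B: "pp (Suc i) \<in> B0" using i by (simp add: B0_eq del: pp.simps)
  have ne: "pp (Suc (Suc i)) \<noteq> Vertical (pp (Suc i))" by simp
  let ?x = "dn s i" and ?y = "dn s (Suc i)" and ?z = "dn s (n - 1)"
  have z: "?x \<noteq> 0" "?y \<noteq> 0" "?z \<noteq> 0" using nz i by auto
  have y: "?y = ?x + (1 + s)" using dn_diff[of s i 1] by simp
  have zz: "?z = ?x + (1 + s) + (1 + of_nat k) * (1 + s)" using dn_diff[of s "Suc i" "Suc k"] i(4) y by simp
  have IH: "tree_sum s (pp (Suc (Suc i))) = (?y + of_nat (Suc k)) / (?y * ?z)"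
    using Suc.IH Suc.prems unfolding i(2,3) by simp
  have V: "tree_sum s (Vertical (pp (Suc i))) = 1 / (?x * ?y)"
    using tree_sum_Vertical[of "Suc i" s] i(5) by (simp del: pp.simps)
  have "tree_sum s (pp (Suc i)) = (?y + of_nat (Suc k)) / (?y * ?z) + 1 / (?x * ?y)"
    unfolding tree_sum_branch[OF B] sp using ne IH V by (simp del: pp.simps)
  also have "\<dots> = (?x * (?y + of_nat (Suc k)) + ?z) / (?x * ?y * ?z)"
    using z by (simp add: divide_simps)
  \<comment> \<open>Left minus right is \<open>(k + 1) * (?x - ?y) + (?z - ?y)\<close>, which is 0
    because \<open>?y - ?x = 1 + s\<close> and \<open>?z - ?y = (k + 1) * (1 + s)\<close>. After
    this the inner factor \<open>?y\<close> cancels.\<close>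
  also have "?x * (?y + of_nat (Suc k)) + ?z = ?y * (?x + of_nat (Suc (Suc k)))"
    unfolding y zz by (simp add: algebra_simps)
  also have "?y * (?x + of_nat (Suc (Suc k))) / (?x * ?y * ?z) = (?x + of_nat (Suc (Suc k))) / (?x * ?z)"
    using z by (simp add: divide_simps)
  finally show ?case unfolding i(1) i_def[symmetric] .
qed

text \<open>A single blow-up leaves an unpunctured sphere, whence the numerator 2. In general the
  first line has one puncture and adds \<open>1 / dn s 0\<close> to the sum over the rest of the
  chain.\<close>

lemma zeta_chain:
  assumes nz: "\<And>j. j < n \<Longrightarrow> dn s j \<noteq> 0"
  shows "zeta_of Xn J s =
    (if n = 1 then 2 / dn s 0 else (dn s (n - 1) + dn s 0 + of_nat (n - 1)) / (dn s 0 * dn s (n - 1)))"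
proof -
  have B: "pp 0 \<in> B0" using n by (simp add: B0_eq del: pp.simps)
  have root: "zeta_of Xn J s = tree_sum s (pp 0)" using zeta_of_tree_sum by simp
  show ?thesis
  proof (cases "n = 1")
    case True
    then have sp: "special (pp 0) = {}" using special_chain[OF n] by simp
    have "tree_sum s (pp 0) = 2 / dn s 0"
      unfolding tree_sum_branch[OF B] sp denom_pp[OF n] by simp
    then show ?thesis unfolding root using True by simp
  next
    case False
    then obtain m where m: "n = Suc (Suc m)" using n by (cases n; cases "n - 1") auto
    have sp: "special (pp 0) = {pp 1}" using special_chain[of 0] m by simp
    have z: "dn s 0 \<noteq> 0" "dn s (n - 1) \<noteq> 0" using nz m by auto
    have "tree_sum s (pp 1) = (dn s 0 + of_nat (n - 1)) / (dn s 0 * dn s (n - 1))"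
      using tree_sum_pp[OF nz, of m] m by (simp del: pp.simps of_nat_Suc)
    then have "tree_sum s (pp 0) = 1 / dn s 0 + (dn s 0 + of_nat (n - 1)) / (dn s 0 * dn s (n - 1))"
      unfolding tree_sum_branch[OF B] sp using n by (simp add: denom_pp del: pp.simps)
    also have "\<dots> = (dn s (n - 1) + dn s 0 + of_nat (n - 1)) / (dn s 0 * dn s (n - 1))"
      using z by (simp add: divide_simps)
    finally show ?thesis unfolding root using False by simp
  qed
qed

lemma tendsto_dn: "((\<lambda>s. dn s j) \<longlongrightarrow> dn s0 j) (at s0)"
  unfolding dn_def by (intro tendsto_intros)

text \<open>The last factor vanishes at \<open>s0\<close> and the numerator does not. Treating the
  denominator as a whole also covers r = 1, where every factor vanishes at -1 and for n > 1 the pole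
  has order 2.\<close>

lemma chain_pole:
  fixes s0 :: real
  assumes s0: "s0 = - real (Suc n) / real (r + n)"
  shows "is_pole (zeta_of Xn J) (complex_of_real s0)"
proof -
  let ?c = "complex_of_real s0"
  have rn: "real (r + n) \<noteq> 0" using n by simp
  have dn_real: "dn ?c j = complex_of_real (real (j + 2) + s0 * real (Suc (r + j)))" for j
    by (simp add: dn_def)
  have last: "dn ?c (n - 1) = 0"
  proof -
    have "real (n - 1 + 2) + s0 * real (Suc (r + (n - 1))) = 0"
      unfolding s0 using n rn by (simp add: of_nat_diff field_simps)
    then show ?thesis unfolding dn_real by simp
  qed
  have ev: "eventually (\<lambda>s. \<forall>j\<in>{..<n}. dn s j \<noteq> 0) (at ?c)"
    unfolding dn_def
    by (intro eventually_ball_finite ballI eventually_affine_nonzero) (simp_all del: of_nat_add of_nat_Suc)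
  define num where "num = (\<lambda>s. if n = 1 then 2 else dn s (n - 1) + dn s 0 + of_nat (n - 1))"
  define den where "den = (\<lambda>s. if n = 1 then dn s 0 else dn s 0 * dn s (n - 1))"
  have eq: "eventually (\<lambda>s. zeta_of Xn J s = num s / den s) (at ?c)"
    using ev by eventually_elim (subst zeta_chain, auto simp: num_def den_def)
  have "filterlim (\<lambda>s. num s / den s) at_infinity (at ?c)"
  proof (rule filterlim_divide_at_infinity)
    show "(num \<longlongrightarrow> num ?c) (at ?c)"
      unfolding num_def by (cases "n = 1") (auto intro!: tendsto_intros tendsto_dn)
    have "(den \<longlongrightarrow> den ?c) (at ?c)"
      unfolding den_def by (cases "n = 1") (auto intro!: tendsto_intros tendsto_dn)
    moreover have "den ?c = 0" using last unfolding den_def by (cases "n = 1") simp_all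
    moreover have "eventually (\<lambda>s. den s \<noteq> 0) (at ?c)"
      using ev by eventually_elim (use n in \<open>auto simp: den_def\<close>)
    ultimately show "filterlim den (at 0) (at ?c)" by (simp add: filterlim_at)
    show "num ?c \<noteq> 0"
    proof (cases "n = 1")
      case False
      \<comment> \<open>As the last factor is 0, the numerator at \<open>s0\<close> reduces to
        \<open>dn ?c 0 + (n - 1)\<close>, and its value is nonzero for n > 1.\<close>
      have "real 2 + s0 * real (Suc r) + real (n - 1) = real (Suc n) * real (n - 1) / real (r + n)"
        unfolding s0 using n rn by (simp add: of_nat_diff field_simps)
      also have "\<dots> \<noteq> 0" using False n rn by simp
      finally have "complex_of_real (real 2 + s0 * real (Suc r) + real (n - 1)) \<noteq> 0"
        using of_real_eq_0_iff by blast
      moreover have "num ?c = dn ?c 0 + of_nat (n - 1)" using False last by (simp add: num_def)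
      moreover have "dn ?c 0 + of_nat (n - 1) = complex_of_real (real 2 + s0 * real (Suc r) + real (n - 1))"
        by (simp add: dn_def)
      ultimately show ?thesis by simp
    qed (simp add: num_def)
  qed
  then show ?thesis unfolding is_pole_def filterlim_cong[OF refl refl eq] .
qed

lemma chain_local_top_zeta: "local_top_zeta J (zeta_of Xn J)"
proof -
  have "principalization J Xn"
    unfolding principalization_def using zariski_open_UNIV chain_blow_up[of n] snc_chain by blast
  then show ?thesis unfolding local_top_zeta_def by blast
qed

end

lemma pole_exists:
  fixes s0 :: real
  assumes "n > 0" "s0 = - real (Suc n) / real (r + n)"
  shows "\<exists>I Z. is_ideal I \<and> I \<noteq> {0} \<and> (0, 0) \<in> Supp I \<and> local_top_zeta I Z \<and> is_pole Z (complex_of_real s0)"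
proof -
  interpret chain r n by unfold_locales (rule assms)
  have "varx ^ (r + n) \<in> J" "varx ^ (r + n) \<noteq> 0" using f0 by auto
  then have "J \<noteq> {0}" by blast
  then show ?thesis
    using is_ideal_chain[of r n] Supp_chain[OF assms(1)] chain_local_top_zeta chain_pole[OF assms(2)]
    by blast
qed

theorem theorem5p3:
  shows "{s0 :: real. s0 \<in> \<rat> \<and>
           (\<exists>(I :: complex poly poly set) Z.
              is_ideal I \<and> I \<noteq> {0} \<and> (0, 0) \<in> Supp I \<and>
              local_top_zeta I Z \<and> is_pole Z (of_real s0))}
       = \<rat> \<inter> ({-1..<0} \<union> {-1 - 1 / real i |i :: nat. i > 0})"
proof (intro equalityI subsetI)
  fix s0 :: real
  assume "s0 \<in> {s0 :: real. s0 \<in> \<rat> \<and>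
           (\<exists>(I :: complex poly poly set) Z.
              is_ideal I \<and> I \<noteq> {0} \<and> (0, 0) \<in> Supp I \<and>
              local_top_zeta I Z \<and> is_pole Z (of_real s0))}"
  then show "s0 \<in> \<rat> \<inter> ({-1..<0} \<union> {-1 - 1 / real i |i :: nat. i > 0})"
    using pole_in_set by blast
next
  fix s0 :: real
  assume s0: "s0 \<in> \<rat> \<inter> ({-1..<0} \<union> {-1 - 1 / real i |i :: nat. i > 0})"
  have "\<exists>n r. n > 0 \<and> s0 = - real (Suc n) / real (r + n)"
  proof (cases "s0 \<in> {-1..<0}")
    case True
    from s0 obtain a b :: nat where ab: "b \<noteq> 0" "\<bar>s0\<bar> = real a / real b"
      using Rats_abs_nat_div_natE[of s0] by blast
    then have s: "s0 = - (real a / real b)" using True by simp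
    with True ab have "a > 0" by (cases a) auto
    have "real a / real b \<le> 1" using True s by simp
    then have "a \<le> b" using ab(1) by (simp add: divide_le_eq_1)
    \<comment> \<open>Here n = 2a - 1 and r = 2b - 2a + 1. Writing the fraction as 2a/2b keeps n
      positive even for a = 1.\<close>
    have "- real (Suc (2 * a - 1)) / real ((2 * b - (2 * a - 1)) + (2 * a - 1)) = - (real (2 * a) / real (2 * b))"
      using \<open>a > 0\<close> \<open>a \<le> b\<close> by simp
    also have "\<dots> = s0" unfolding s by simp
    finally have "2 * a - 1 > 0 \<and> s0 = - real (Suc (2 * a - 1)) / real ((2 * b - (2 * a - 1)) + (2 * a - 1))"
      using \<open>a > 0\<close> by simp
    then show ?thesis by blast
  next
    case False
    then obtain i :: nat where i: "i > 0" "s0 = -1 - 1 / real i" using s0 by blast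
    \<comment> \<open>With r = 0 and n = i all multiplicities are 1 and \<nu> = N + 1 along the
      whole chain.\<close>
    then have "s0 = - real (Suc i) / real (0 + i)" by (simp add: field_simps)
    with i(1) show ?thesis by blast
  qed
  then obtain n r where "n > 0" "s0 = - real (Suc n) / real (r + n)" by blast
  from pole_exists[OF this] s0
  show "s0 \<in> {s0 :: real. s0 \<in> \<rat> \<and>
           (\<exists>(I :: complex poly poly set) Z.
              is_ideal I \<and> I \<noteq> {0} \<and> (0, 0) \<in> Supp I \<and>
              local_top_zeta I Z \<and> is_pole Z (of_real s0))}" by blast
qed

end
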